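(* Let $L>0$, $D>0$, $b_1\in\mathbb R$, $b_2>0$, let $U,\beta,k_0\ge 0$, and let $p_0\in L^2(0,L)$. Then for every $\alpha\ge 0$, every $T>0$ and all initial data $(w_0,w_1)\in\mathscr H_\alpha$, there exists a weak solution on $[0,T]$ to the beam problem $$\begin{cases}(1-\alpha\partial_x^2)w_{tt}+D\partial_x^4w+k_0(1-\alpha\partial_x^2)w_t+(b_1-b_2\|w_x\|^2)w_{xx}=p_0(x)-\beta(w_t+Uw_x) & \text{in } (0,L)\times(0,T),\\ w(t=0)=w_0,\quad w_t(t=0)=w_1,\\ w(0)=w_x(0)=0,\quad w_{xx}(L)=0,\\ -\alpha\partial_x[w_{tt}+k_0w_t]+D\partial_x^3w+(b_1-b_2\|w_x\|^2)w_x=0\ \text{ at } x=L.\end{cases}$$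
   Context: $(\cdot,\cdot)$ and $\|\cdot\|$ are the inner product and norm of $L^2(0,L)$. $H^2_*=\{v\in H^2(0,L): v(0)=v_x(0)=0\}$ with inner product $(v,w)_{H^2_*}=D(v_{xx},w_{xx})$; $H^1_*=\{v\in H^1(0,L): v(0)=0\}$ with inner product $(u_x,v_x)$. $L_\alpha=H^1_*$ if $\alpha>0$, with norm $\|v\|_{L_\alpha}^2=\alpha\|v_x\|^2+\|v\|^2$, and $L_0=L^2(0,L)$. $\mathscr H_\alpha=H^2_*\times L_\alpha$. $C_w([0,T];X)$ denotes weakly continuous $X$-valued functions. Weak solution on $[0,T]$: a function $w\in H^1(0,T;L^2(0,L))$ such that $w\in L^\infty(0,T;H^2_* )\cap C_w([0,T];H^2_* )$, $w_t\in L^\infty(0,T;L_\alpha)\cap C_w([0,T];L_\alpha)$; for every $\phi\in H^2_*$, $$\frac{d}{dt}\big[(w_t,\phi)+\alpha(w_{tx},\phi_x)\big]+(w,\phi)_{H^2_*}+(b_2\|w_x\|^2-b_1)(w_x,\phi_x)+k_0(w_t,\phi)+\alpha k_0(w_{tx},\phi_x)=(p_0,\phi)-\beta(w_t,\phi)-\beta U(w_x,\phi)$$ with $d/dt$ in the sense of distributions $\mathscr D'(0,T)$ (terms with coefficient $\alpha$ are absent if $\alpha=0$); and for all $\chi\in H^2_*$, $\psi\in L^2(0,L)$, $$(w,\chi)_{H^2_*}\big|_{t\to0^+}=(w_0,\chi)_{H^2_*},\qquad (w_t,\psi)\big|_{t\to0^+}=(w_1,\psi).$$ *)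

theory Defs
  imports "HOL-Analysis.Analysis"
begin

section \<open>Lebesgue and Sobolev spaces on an interval\<close>

text \<open>Elements of the spaces below are represented by functions \<open>real \<Rightarrow> real\<close>; two functions
  represent the same element iff they agree almost everywhere on the interval. Norms and inner
  products do not depend on the representative.\<close>

definition L2 :: "real \<Rightarrow> real \<Rightarrow> (real \<Rightarrow> real) set" where
  "L2 a b = {f. f \<in> borel_measurable (lebesgue_on {a<..<b}) \<and>
                integrable (lebesgue_on {a<..<b}) (\<lambda>x. (f x)\<^sup>2)}"

definition L2_inner :: "real \<Rightarrow> real \<Rightarrow> (real \<Rightarrow> real) \<Rightarrow> (real \<Rightarrow> real) \<Rightarrow> real" where
  "L2_inner a b f g = (LINT x|lebesgue_on {a<..<b}. f x * g x)"

definition L2_norm :: "real \<Rightarrow> real \<Rightarrow> (real \<Rightarrow> real) \<Rightarrow> real" where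
  "L2_norm a b f = sqrt (L2_inner a b f f)"

definition test_function :: "real \<Rightarrow> real \<Rightarrow> (real \<Rightarrow> real) \<Rightarrow> bool" where
  "test_function a b \<theta> \<longleftrightarrow>
     (\<forall>n x. (deriv ^^ n) \<theta> differentiable at x) \<and>
     (\<exists>c d. a < c \<and> d < b \<and> (\<forall>x. x \<notin> {c..d} \<longrightarrow> \<theta> x = 0))"

definition locally_integrable :: "real \<Rightarrow> real \<Rightarrow> (real \<Rightarrow> real) \<Rightarrow> bool" where
  "locally_integrable a b f \<longleftrightarrow>
     (\<forall>c d. a < c \<longrightarrow> d < b \<longrightarrow> integrable (lebesgue_on {c..d}) f)"

text \<open>\<open>f' = g\<close> in the sense of distributions on \<open>(a,b)\<close>, for regular distributions \<open>f\<close>, \<open>g\<close>.\<close>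

definition has_distr_deriv :: "real \<Rightarrow> real \<Rightarrow> (real \<Rightarrow> real) \<Rightarrow> (real \<Rightarrow> real) \<Rightarrow> bool" where
  "has_distr_deriv a b f g \<longleftrightarrow>
     locally_integrable a b f \<and> locally_integrable a b g \<and>
     (\<forall>\<theta>. test_function a b \<theta> \<longrightarrow>
        (LINT x|lebesgue_on {a<..<b}. f x * deriv \<theta> x)
          = - (LINT x|lebesgue_on {a<..<b}. g x * \<theta> x))"

text \<open>The weak derivative on \<open>(0,L)\<close>. It is determined only almost everywhere; the choice is
  meaningful only for functions that have a weak derivative.\<close>

definition wderiv :: "real \<Rightarrow> (real \<Rightarrow> real) \<Rightarrow> (real \<Rightarrow> real)" where
  "wderiv L v = (SOME g. has_distr_deriv 0 L v g)"

definition H1 :: "real \<Rightarrow> (real \<Rightarrow> real) set" where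
  "H1 L = {v \<in> L2 0 L. \<exists>g \<in> L2 0 L. has_distr_deriv 0 L v g}"

definition H2 :: "real \<Rightarrow> (real \<Rightarrow> real) set" where
  "H2 L = {v \<in> L2 0 L. \<exists>g \<in> L2 0 L. \<exists>h \<in> L2 0 L.
             has_distr_deriv 0 L v g \<and> has_distr_deriv 0 L g h}"

text \<open>\<open>v(0) = 0\<close>, read for the continuous representative of \<open>v\<close> on \<open>[0,L]\<close>.\<close>

definition vanishes_at_0 :: "real \<Rightarrow> (real \<Rightarrow> real) \<Rightarrow> bool" where
  "vanishes_at_0 L v \<longleftrightarrow>
     (\<exists>c. continuous_on {0..L} c \<and> (AE x in lebesgue_on {0<..<L}. v x = c x) \<and> c 0 = 0)"

definition H1_star :: "real \<Rightarrow> (real \<Rightarrow> real) set" where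
  "H1_star L = {v \<in> H1 L. vanishes_at_0 L v}"

definition H2_star :: "real \<Rightarrow> (real \<Rightarrow> real) set" where
  "H2_star L = {v \<in> H2 L. vanishes_at_0 L v \<and> vanishes_at_0 L (wderiv L v)}"

definition H2_star_inner :: "real \<Rightarrow> real \<Rightarrow> (real \<Rightarrow> real) \<Rightarrow> (real \<Rightarrow> real) \<Rightarrow> real" where
  "H2_star_inner D L v w = D * L2_inner 0 L (wderiv L (wderiv L v)) (wderiv L (wderiv L w))"

definition H2_star_norm :: "real \<Rightarrow> real \<Rightarrow> (real \<Rightarrow> real) \<Rightarrow> real" where
  "H2_star_norm D L v = sqrt (H2_star_inner D L v v)"

definition L_alpha :: "real \<Rightarrow> real \<Rightarrow> (real \<Rightarrow> real) set" where
  "L_alpha \<alpha> L = (if \<alpha> > 0 then H1_star L else L2 0 L)"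

definition L_alpha_norm :: "real \<Rightarrow> real \<Rightarrow> (real \<Rightarrow> real) \<Rightarrow> real" where
  "L_alpha_norm \<alpha> L v =
     (if \<alpha> > 0 then sqrt (\<alpha> * (L2_norm 0 L (wderiv L v))\<^sup>2 + (L2_norm 0 L v)\<^sup>2)
      else L2_norm 0 L v)"

definition H_alpha :: "real \<Rightarrow> real \<Rightarrow> ((real \<Rightarrow> real) \<times> (real \<Rightarrow> real)) set" where
  "H_alpha \<alpha> L = H2_star L \<times> L_alpha \<alpha> L"

section \<open>Functions of time with values in a normed function space\<close>

text \<open>In this section \<open>X\<close> is a linear space of functions with (semi)norm \<open>N\<close>, and
  \<open>u t\<close> is the value of \<open>u\<close> at time \<open>t\<close>. Measurability is strong (Bochner) measurability.\<close>

definition strongly_measurable ::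
  "real \<Rightarrow> (real \<Rightarrow> real) set \<Rightarrow> ((real \<Rightarrow> real) \<Rightarrow> real) \<Rightarrow> (real \<Rightarrow> real \<Rightarrow> real) \<Rightarrow> bool" where
  "strongly_measurable T X N u \<longleftrightarrow>
     (\<exists>s. (\<forall>n::nat. simple_function (lebesgue_on {0<..<T}) (s n) \<and> (\<forall>t\<in>{0<..<T}. s n t \<in> X)) \<and>
          (AE t in lebesgue_on {0<..<T}.
             u t \<in> X \<and> (\<lambda>n. N (\<lambda>x. s n t x - u t x)) \<longlonglongrightarrow> 0))"

definition L2_time ::
  "real \<Rightarrow> (real \<Rightarrow> real) set \<Rightarrow> ((real \<Rightarrow> real) \<Rightarrow> real) \<Rightarrow> (real \<Rightarrow> real \<Rightarrow> real) set" where
  "L2_time T X N = {u. strongly_measurable T X N u \<and>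
                       integrable (lebesgue_on {0<..<T}) (\<lambda>t. (N (u t))\<^sup>2)}"

definition Linf_time ::
  "real \<Rightarrow> (real \<Rightarrow> real) set \<Rightarrow> ((real \<Rightarrow> real) \<Rightarrow> real) \<Rightarrow> (real \<Rightarrow> real \<Rightarrow> real) set" where
  "Linf_time T X N = {u. strongly_measurable T X N u \<and>
                         (\<exists>C. AE t in lebesgue_on {0<..<T}. N (u t) \<le> C)}"

definition bounded_functional ::
  "(real \<Rightarrow> real) set \<Rightarrow> ((real \<Rightarrow> real) \<Rightarrow> real) \<Rightarrow> ((real \<Rightarrow> real) \<Rightarrow> real) \<Rightarrow> bool" where
  "bounded_functional X N l \<longleftrightarrow>
     (\<forall>u\<in>X. \<forall>v\<in>X. \<forall>a b. l (\<lambda>x. a * u x + b * v x) = a * l u + b * l v) \<and>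
     (\<exists>C. \<forall>u\<in>X. \<bar>l u\<bar> \<le> C * N u)"

definition C_weak ::
  "real \<Rightarrow> (real \<Rightarrow> real) set \<Rightarrow> ((real \<Rightarrow> real) \<Rightarrow> real) \<Rightarrow> (real \<Rightarrow> real \<Rightarrow> real) set" where
  "C_weak T X N = {u. (\<forall>t\<in>{0..T}. u t \<in> X) \<and>
     (\<forall>l. bounded_functional X N l \<longrightarrow> continuous_on {0..T} (\<lambda>t. l (u t)))}"

text \<open>\<open>u' = v\<close> weakly in time for \<open>L\<^sup>2(0,L)\<close>-valued functions: the identity
  \<open>\<integral> u \<theta>' dt = - \<integral> v \<theta> dt\<close> between Bochner integrals in \<open>L\<^sup>2(0,L)\<close>, tested against
  every element of \<open>L\<^sup>2(0,L)\<close> (the inner product commutes with the Bochner integral).\<close>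

definition has_weak_time_deriv ::
  "real \<Rightarrow> real \<Rightarrow> (real \<Rightarrow> real \<Rightarrow> real) \<Rightarrow> (real \<Rightarrow> real \<Rightarrow> real) \<Rightarrow> bool" where
  "has_weak_time_deriv T L u v \<longleftrightarrow>
     (\<forall>\<psi> \<in> L2 0 L. has_distr_deriv 0 T (\<lambda>t. L2_inner 0 L (u t) \<psi>) (\<lambda>t. L2_inner 0 L (v t) \<psi>))"

section \<open>Weak solutions of the beam problem\<close>

text \<open>\<open>w t x\<close> is the displacement and \<open>wt\<close> its weak time derivative; the first line of the definition
  says \<open>w \<in> H\<^sup>1(0,T;L\<^sup>2(0,L))\<close>. In the variational equation all terms other than the
  distributional time derivative are locally integrable functions of \<open>t\<close> and are collected on the
  right. For \<open>\<alpha> = 0\<close> the terms with coefficient \<open>\<alpha>\<close> are \<open>0\<close>, whatever \<open>wderiv L (wt t)\<close> is.\<close>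

definition weak_solution ::
  "real \<Rightarrow> real \<Rightarrow> real \<Rightarrow> real \<Rightarrow> real \<Rightarrow> real \<Rightarrow> real \<Rightarrow> (real \<Rightarrow> real) \<Rightarrow> real \<Rightarrow> real \<Rightarrow>
     (real \<Rightarrow> real) \<Rightarrow> (real \<Rightarrow> real) \<Rightarrow> (real \<Rightarrow> real \<Rightarrow> real) \<Rightarrow> bool" where
  "weak_solution L D b1 b2 U \<beta> k0 p0 \<alpha> T w0 w1 w \<longleftrightarrow> (\<exists>wt.
     w \<in> L2_time T (L2 0 L) (L2_norm 0 L) \<and> wt \<in> L2_time T (L2 0 L) (L2_norm 0 L) \<and>
       has_weak_time_deriv T L w wt \<and>
     w \<in> Linf_time T (H2_star L) (H2_star_norm D L) \<inter> C_weak T (H2_star L) (H2_star_norm D L) \<and>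
     wt \<in> Linf_time T (L_alpha \<alpha> L) (L_alpha_norm \<alpha> L) \<inter> C_weak T (L_alpha \<alpha> L) (L_alpha_norm \<alpha> L) \<and>
     (\<forall>\<phi> \<in> H2_star L.
        has_distr_deriv 0 T
          (\<lambda>t. L2_inner 0 L (wt t) \<phi> + \<alpha> * L2_inner 0 L (wderiv L (wt t)) (wderiv L \<phi>))
          (\<lambda>t. (L2_inner 0 L p0 \<phi> - \<beta> * L2_inner 0 L (wt t) \<phi>
                  - \<beta> * U * L2_inner 0 L (wderiv L (w t)) \<phi>)
               - (H2_star_inner D L (w t) \<phi>
                  + (b2 * (L2_norm 0 L (wderiv L (w t)))\<^sup>2 - b1)
                      * L2_inner 0 L (wderiv L (w t)) (wderiv L \<phi>)
                  + k0 * L2_inner 0 L (wt t) \<phi>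
                  + \<alpha> * k0 * L2_inner 0 L (wderiv L (wt t)) (wderiv L \<phi>)))) \<and>
     (\<forall>\<eta> \<in> H2_star L.
        ((\<lambda>t. H2_star_inner D L (w t) \<eta>) \<longlongrightarrow> H2_star_inner D L w0 \<eta>) (at_right 0)) \<and>
     (\<forall>\<psi> \<in> L2 0 L.
        ((\<lambda>t. L2_inner 0 L (wt t) \<psi>) \<longlongrightarrow> L2_inner 0 L w1 \<psi>) (at_right 0)))"

end

theory Submission
  imports Defs "HOL-Complex_Analysis.Great_Picard"
begin

text \<open>The displacement is described by \<open>u = w\<^sub>x\<^sub>x\<close>: with \<open>(K f)(x) = \<integral>\<^sub>0\<^sup>x f\<close> one has \<open>w = K (K u)\<close> and
  \<open>w\<^sub>x = K u\<close> for \<open>w \<in> H\<^sup>2\<^sub>*\<close>. The velocity is \<open>w\<^sub>t = V z\<close>, where \<open>V = K\<close> if \<open>\<alpha> > 0\<close> and \<open>V\<close> is the identity if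
  \<open>\<alpha> = 0\<close>. The kinetic energy becomes the coercive form \<open>m z z' = (V z, V z') + \<alpha> (z, z')\<close> on \<open>L\<^sup>2\<close>, and the
  beam equation the system \<open>P u' = z\<close>,
  \<open>m z (P \<eta>)' = - D (u, \<eta>) - (b\<^sub>2 \<parallel>K u\<parallel>\<^sup>2 - b\<^sub>1) (K u, K \<eta>) + (lower order terms)\<close> in \<open>L\<^sup>2\<close>, in which
  \<open>P = V\<inverse> K K\<close> and \<open>K\<close> are bounded operators.

  Galerkin approximations are taken in vectors \<open>\<eta>\<^sub>j\<close> for which \<open>P \<eta>\<^sub>j\<close> is orthonormal for \<open>m\<close>, so that no mass
  matrix has to be inverted. Truncating \<open>\<parallel>K u\<parallel>\<^sup>2\<close> at a level \<open>R\<close> makes the differential equations globally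
  Lipschitz; the energy bound is uniform in the dimension and in \<open>R\<close>, so that the truncation is inactive for
  large \<open>R\<close>. A subsequence converges weakly at every time, and the nonlinear term passes to the limit because \<open>K\<close> is
  compact.\<close>

section \<open>Orthonormal systems for a coercive form\<close>

text \<open>A solution carries weak derivatives, a boundary condition at 0 and representatives fixed
  only almost everywhere. Writing it through \<open>K\<close> removes all three: the conditions at 0
  are built into the range of \<open>K\<close>, those at L are natural and contained in the
  variational equation, and the analysis takes place in one abstract Hilbert space. The a priori
  bound is the energy identity: testing with \<open>u'\<close>, for which \<open>P u' = z\<close>,
  cancels the stiffness terms against the derivative of the elastic energy. That energy is bounded
  below by - b1^2 / (4 b2), whatever the sign of b1, because the quartic term dominates. The
  obstacle is compactness in time: \<open>u'\<close> has no bound uniform in the dimension, only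
  \<open>P u'\<close> has. Hence \<open>u\<close> is controlled through the adjoint of
  \<open>P\<close>. Separability enters as the countable family of bumps with rational endpoints. It
  yields the Galerkin vectors, the Riesz representation, weak limits and strong measurability. Bumps
  are test functions and so lie in the range of \<open>K K\<close>, which makes the range of
  \<open>P\<close> dense.\<close>

locale pos_form =
  fixes b :: "'a::real_vector \<Rightarrow> 'a \<Rightarrow> real"
  assumes add_l: "b (x + y) z = b x z + b y z"
    and scale_l: "b (c *\<^sub>R x) z = c * b x z"
    and sym: "b x y = b y x"
    and pos: "x \<noteq> 0 \<Longrightarrow> b x x > 0"
begin

lemma scale_r: "b z (c *\<^sub>R x) = c * b z x"
  using scale_l sym by metis

lemma zero_l [simp]: "b 0 x = 0"
  using scale_l[of 0 0 x] by simp

lemma zero_r [simp]: "b x 0 = 0"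
  using sym zero_l by metis

lemma sum_l: "b (\<Sum>i\<in>I. f i) z = (\<Sum>i\<in>I. b (f i) z)"
  by (induction I rule: infinite_finite_induct) (auto simp: add_l)

lemma diff_l: "b (x - y) z = b x z - b y z"
  using add_l[of "x - y" y z] by simp

text \<open>A vector that depends on its predecessors has \<open>r = 0\<close> and is sent to \<open>0\<close>, because
  \<open>inverse 0 = 0\<close>. This is why the orthonormal systems below may contain \<open>0\<close>.\<close>

fun gram_schmidt :: "(nat \<Rightarrow> 'a) \<Rightarrow> nat \<Rightarrow> 'a" where
  "gram_schmidt g n =
     (let r = g n - (\<Sum>i<n. b (g n) (gram_schmidt g i) *\<^sub>R gram_schmidt g i) in r /\<^sub>R sqrt (b r r))"

declare gram_schmidt.simps [simp del]

lemma gram_schmidt_normed: "gram_schmidt g n = 0 \<or> b (gram_schmidt g n) (gram_schmidt g n) = 1"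
proof -
  define r where "r = g n - (\<Sum>i<n. b (g n) (gram_schmidt g i) *\<^sub>R gram_schmidt g i)"
  have e: "gram_schmidt g n = r /\<^sub>R sqrt (b r r)"
    by (subst gram_schmidt.simps) (simp add: r_def Let_def)
  show ?thesis
  proof (cases "r = 0")
    case False
    then have "b r r > 0" by (rule pos)
    then show ?thesis unfolding e by (simp add: scale_l scale_r field_simps)
  qed (simp add: e)
qed

lemma gram_schmidt_orthogonal_less: "i < n \<Longrightarrow> b (gram_schmidt g n) (gram_schmidt g i) = 0"
proof (induction n arbitrary: i rule: less_induct)
  case (less n)
  define r where "r = g n - (\<Sum>i<n. b (g n) (gram_schmidt g i) *\<^sub>R gram_schmidt g i)"
  have e: "gram_schmidt g n = r /\<^sub>R sqrt (b r r)"
    by (subst gram_schmidt.simps) (simp add: r_def Let_def)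
  have o: "b (gram_schmidt g k) (gram_schmidt g i) = 0" if "k < n" "k \<noteq> i" for k
    using less that sym by (metis nat_neq_iff)
  have "(\<Sum>k<n. b (g n) (gram_schmidt g k) * b (gram_schmidt g k) (gram_schmidt g i))
      = (\<Sum>k<n. if k = i then b (g n) (gram_schmidt g i) else 0)"
  proof (rule sum.cong)
    fix k assume "k \<in> {..<n}"
    then show "b (g n) (gram_schmidt g k) * b (gram_schmidt g k) (gram_schmidt g i) =
      (if k = i then b (g n) (gram_schmidt g i) else 0)"
      using o[of k] gram_schmidt_normed[of g i] by auto
  qed simp
  also have "\<dots> = b (g n) (gram_schmidt g i)"
    using less.prems by simp
  finally have "b r (gram_schmidt g i) = 0"
    by (simp add: r_def diff_l sum_l scale_l)
  then show ?case by (simp add: e scale_l)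
qed

lemma gram_schmidt_orthogonal: "i \<noteq> n \<Longrightarrow> b (gram_schmidt g n) (gram_schmidt g i) = 0"
  using gram_schmidt_orthogonal_less[of i n g] gram_schmidt_orthogonal_less[of n i g] sym
  by (metis nat_neq_iff)

text \<open>The residual \<open>r\<close> is a multiple of the new vector, also when
  \<open>g n\<close> depends on its predecessors and \<open>r\<close> is 0; the rest of
  \<open>g n\<close> lies in the span of the earlier vectors.\<close>

lemma span_gram_schmidt_source: "g n \<in> span (range (gram_schmidt g))"
proof -
  define s where "s = (\<Sum>i<n. b (g n) (gram_schmidt g i) *\<^sub>R gram_schmidt g i)"
  define r where "r = g n - s"
  have e: "gram_schmidt g n = r /\<^sub>R sqrt (b r r)"
    by (subst gram_schmidt.simps) (simp add: r_def s_def Let_def)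
  have "r = sqrt (b r r) *\<^sub>R gram_schmidt g n"
    using pos[of r] by (cases "r = 0") (auto simp: e)
  then have "r \<in> span (range (gram_schmidt g))"
    by (metis rangeI span_base span_scale)
  moreover have "s \<in> span (range (gram_schmidt g))"
    unfolding s_def by (intro span_sum span_scale span_base rangeI)
  ultimately have "r + s \<in> span (range (gram_schmidt g))" by (rule span_add)
  then show ?thesis by (simp add: r_def)
qed

lemma gram_schmidt_in_span: "gram_schmidt g n \<in> span (range g)"
proof (induction n rule: less_induct)
  case (less n)
  then have "(\<Sum>i<n. b (g n) (gram_schmidt g i) *\<^sub>R gram_schmidt g i) \<in> span (range g)"
    by (intro span_sum span_scale) auto
  then have "g n - (\<Sum>i<n. b (g n) (gram_schmidt g i) *\<^sub>R gram_schmidt g i) \<in> span (range g)"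
    by (simp add: span_diff span_base)
  then show ?case
    by (subst gram_schmidt.simps) (simp add: Let_def span_scale)
qed

end

text \<open>Used with two forms: the kinetic form, in which the velocity is expanded, and the inner
  product with constant 1 (\<open>ip\<close> below), in which the displacement is expanded.
  Coercivity makes \<open>m\<close> an equivalent inner product, so the Hilbert space facts are
  proved once for both.\<close>

locale coercive_form = bounded_bilinear m
  for m :: "'a::{real_inner,banach} \<Rightarrow> 'a \<Rightarrow> real" +
  fixes \<kappa> :: real
  assumes sym: "m x y = m y x"
    and \<kappa>: "\<kappa> > 0"
    and coercive: "\<kappa> * (norm x)\<^sup>2 \<le> m x x"
begin

lemma nonneg: "m x x \<ge> 0"
  using coercive[of x] \<kappa> by (meson mult_nonneg_nonneg order.trans less_imp_le zero_le_power2)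

lemma norm_le: "norm x \<le> sqrt (m x x / \<kappa>)"
  by (rule real_le_rsqrt) (use coercive[of x] \<kappa> in \<open>simp add: field_simps\<close>)

definition orthonormal :: "(nat \<Rightarrow> 'a) \<Rightarrow> bool" where
  "orthonormal f \<longleftrightarrow> (\<forall>i j. i \<noteq> j \<longrightarrow> m (f i) (f j) = 0) \<and> (\<forall>i. f i = 0 \<or> m (f i) (f i) = 1)"

text \<open>Totality by orthogonality instead of density of the span: this is the form that the
  fundamental lemma provides for bumps; \<open>expansion\<close> recovers density.\<close>

definition total :: "(nat \<Rightarrow> 'a) \<Rightarrow> bool" where
  "total f \<longleftrightarrow> (\<forall>x. (\<forall>j. m x (f j) = 0) \<longrightarrow> x = 0)"

text \<open>The assumption on \<open>a\<close> compensates for the zero vectors that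
  \<open>orthonormal\<close> admits: there \<open>m (f j) (f j)\<close> is 0 instead of 1. Asking it
  of one family suffices, since only the products survive.\<close>

lemma m_sum_sum:
  assumes "orthonormal f" "finite I" "\<And>j. f j = 0 \<Longrightarrow> a j = 0"
  shows "m (\<Sum>j\<in>I. a j *\<^sub>R f j) (\<Sum>j\<in>I. c j *\<^sub>R f j) = (\<Sum>j\<in>I. a j * c j)"
proof -
  have "m (\<Sum>j\<in>I. a j *\<^sub>R f j) (\<Sum>j\<in>I. c j *\<^sub>R f j) = (\<Sum>i\<in>I. \<Sum>j\<in>I. a i * (c j * m (f i) (f j)))"
    by (subst sum_left, subst sum_right) (simp add: scaleR_left scaleR_right ac_simps)
  also have "\<dots> = (\<Sum>i\<in>I. \<Sum>j\<in>I. if i = j then a i * c i else 0)"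
  proof (intro sum.cong refl)
    fix i j
    show "a i * (c j * m (f i) (f j)) = (if i = j then a i * c i else 0)"
      using assms(1) assms(3)[of i] unfolding orthonormal_def by (cases "i = j"; cases "f j = 0") (auto simp: zero_left zero_right)
  qed
  also have "\<dots> = (\<Sum>j\<in>I. a j * c j)" using assms(2) by simp
  finally show ?thesis .
qed

lemma m_sum_single:
  assumes "orthonormal f" "finite I" "\<And>j. f j = 0 \<Longrightarrow> a j = 0"
  shows "m (\<Sum>j\<in>I. a j *\<^sub>R f j) (f i) = (if i \<in> I then a i else 0)"
proof -
  have "m (\<Sum>j\<in>I. a j *\<^sub>R f j) (f i) = (\<Sum>j\<in>I. a j * m (f j) (f i))"
    by (simp add: sum_left scaleR_left)
  also have "\<dots> = (\<Sum>j\<in>I. if j = i then a i else 0)"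
  proof (intro sum.cong refl)
    fix j
    show "a j * m (f j) (f i) = (if j = i then a i else 0)"
      using assms(1) assms(3)[of j] unfolding orthonormal_def by (cases "i = j"; cases "f j = 0") (auto simp: zero_left zero_right)
  qed
  finally show ?thesis using assms(2) by simp
qed

lemma bessel:
  assumes "orthonormal f"
  shows "(\<Sum>j<N. (m x (f j))\<^sup>2) \<le> m x x"
proof -
  define s where "s = (\<Sum>j<N. m x (f j) *\<^sub>R f j)"
  have ss: "m s s = (\<Sum>j<N. (m x (f j))\<^sup>2)"
    unfolding s_def using m_sum_sum[OF assms(1), where I = "{..<N}" and a = "\<lambda>j. m x (f j)" and c = "\<lambda>j. m x (f j)"]
    by (simp add: zero_right power2_eq_square)
  have xs: "m x s = (\<Sum>j<N. (m x (f j))\<^sup>2)"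
    unfolding s_def by (simp add: sum_right scaleR_right power2_eq_square)
  have "0 \<le> m (x - s) (x - s)" by (rule nonneg)
  also have "\<dots> = m x x - m x s - m s x + m s s"
    by (simp add: diff_left diff_right)
  finally show ?thesis using ss xs sym[of s x] by simp
qed

text \<open>Riesz-Fischer for the form: by coercivity the squared norm of a tail is at most the tail
  of the squared coefficients divided by \<open>\<kappa>\<close>; completeness gives the sum,
  continuity of \<open>m\<close> its coefficients.\<close>

lemma orthonormal_series:
  assumes f: "orthonormal f" and z: "\<And>j. f j = 0 \<Longrightarrow> a j = 0"
    and B: "\<And>N. (\<Sum>j<N. (a j)\<^sup>2) \<le> B"
  shows "summable (\<lambda>j. a j *\<^sub>R f j)" and "m (\<Sum>j. a j *\<^sub>R f j) (f i) = a i"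
proof -
  have "summable (\<lambda>j. (a j)\<^sup>2)"
    by (rule summableI_nonneg_bounded[OF _ B]) auto
  show S: "summable (\<lambda>j. a j *\<^sub>R f j)"
    unfolding summable_Cauchy
  proof (intro allI impI)
    fix e :: real assume e: "e > 0"
    have "\<kappa> * e\<^sup>2 > 0" using e \<kappa> by simp
    then obtain N where N: "\<And>k n. k \<ge> N \<Longrightarrow> norm (sum (\<lambda>j. (a j)\<^sup>2) {k..<n}) < \<kappa> * e\<^sup>2"
      using \<open>summable (\<lambda>j. (a j)\<^sup>2)\<close> unfolding summable_Cauchy by blast
    show "\<exists>N. \<forall>k\<ge>N. \<forall>n. norm (\<Sum>j = k..<n. a j *\<^sub>R f j) < e"
    proof (intro exI allI impI)
      fix k n assume "N \<le> k"
      define s where "s = (\<Sum>j = k..<n. a j *\<^sub>R f j)"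
      have "\<kappa> * (norm s)\<^sup>2 \<le> m s s" by (rule coercive)
      also have "\<dots> = (\<Sum>j = k..<n. (a j)\<^sup>2)"
        unfolding s_def using m_sum_sum[OF f _ z, where I = "{k..<n}" and c = a] by (simp add: power2_eq_square)
      also have "\<dots> < \<kappa> * e\<^sup>2" using N[OF \<open>N \<le> k\<close>, of n] by (simp add: abs_less_iff)
      finally have "(norm s)\<^sup>2 < e\<^sup>2" using \<kappa> by simp
      then show "norm (\<Sum>j = k..<n. a j *\<^sub>R f j) < e"
        using e unfolding s_def by (simp add: power_less_imp_less_base)
    qed
  qed
  have "(\<lambda>N. m (\<Sum>j<N. a j *\<^sub>R f j) (f i)) \<longlonglongrightarrow> m (\<Sum>j. a j *\<^sub>R f j) (f i)"
    by (intro tendsto tendsto_const summable_LIMSEQ S)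
  moreover have "(\<lambda>N. m (\<Sum>j<N. a j *\<^sub>R f j) (f i)) \<longlonglongrightarrow> a i"
  proof (rule tendsto_eventually)
    show "\<forall>\<^sub>F N in sequentially. m (\<Sum>j<N. a j *\<^sub>R f j) (f i) = a i"
      using eventually_gt_at_top[of i]
      by eventually_elim (simp add: m_sum_single[OF f _ z])
  qed
  ultimately show "m (\<Sum>j. a j *\<^sub>R f j) (f i) = a i" by (rule LIMSEQ_unique)
qed

lemma expansion:
  assumes f: "orthonormal f" and t: "total f"
  shows "(\<lambda>j. m x (f j) *\<^sub>R f j) sums x"
proof -
  define y where "y = (\<Sum>j. m x (f j) *\<^sub>R f j)"
  have z: "m x (f j) = 0" if "f j = 0" for j using that by (simp add: zero_right)
  note s = orthonormal_series[of f "\<lambda>j. m x (f j)", OF f z bessel[OF f]]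
  have "m (x - y) (f j) = 0" for j unfolding y_def by (simp add: diff_left s(2))
  then have "x - y = 0" using t unfolding total_def by blast
  then show ?thesis using summable_sums[OF s(1)] unfolding y_def by simp
qed

text \<open>The density principle behind most later extensions: a closed subspace containing a total
  system contains all partial sums of all expansions. It serves for linear identities, for
  continuity in time and for weak convergence.\<close>

lemma total_induct:
  assumes f: "orthonormal f" "total f" and S: "subspace S" "closed S" "\<And>j. f j \<in> S"
  shows "x \<in> S"
proof -
  have "(\<lambda>n. \<Sum>j<n. m x (f j) *\<^sub>R f j) \<longlonglongrightarrow> x"
    using expansion[OF f] unfolding sums_def .
  moreover have "(\<Sum>j<n. m x (f j) *\<^sub>R f j) \<in> S" for n
    using S by (intro subspace_sum subspace_scale) auto
  ultimately show ?thesis using closed_sequentially[OF S(2), of "\<lambda>n. \<Sum>j<n. m x (f j) *\<^sub>R f j" x] by blast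
qed

lemma riesz:
  assumes f: "orthonormal f" "total f" and l: "bounded_linear l"
  shows "\<exists>r. \<forall>x. l x = m x r"
proof -
  interpret l: bounded_linear l by fact
  obtain A where A: "\<And>x. \<bar>l x\<bar> \<le> norm x * A" "A \<ge> 0"
    using l.nonneg_bounded by auto
  \<comment> \<open>Testing \<open>l\<close> with its own partial sum \<open>s\<close>: both
    \<open>l s\<close> and \<open>m s s\<close> equal \<open>S\<close>. Boundedness and coercivity
    together give \<kappa> S^2 \<le> S A^2, from which one factor \<open>S\<close> cancels.\<close>
  have B: "(\<Sum>j<N. (l (f j))\<^sup>2) \<le> A\<^sup>2 / \<kappa>" for N
  proof -
    define s where "s = (\<Sum>j<N. l (f j) *\<^sub>R f j)"
    define S where "S = (\<Sum>j<N. (l (f j))\<^sup>2)"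
    have "m s s = S"
      unfolding s_def S_def using m_sum_sum[OF f(1), where I = "{..<N}" and a = "\<lambda>j. l (f j)" and c = "\<lambda>j. l (f j)"]
      by (simp add: l.zero power2_eq_square)
    moreover have "l s = S"
      unfolding s_def S_def by (simp add: l.sum l.scaleR power2_eq_square)
    ultimately have "S \<le> norm s * A" "\<kappa> * (norm s)\<^sup>2 \<le> S"
      using A(1)[of s] coercive[of s] by auto
    have "S \<ge> 0" unfolding S_def by (simp add: sum_nonneg)
    have "\<kappa> * S\<^sup>2 \<le> \<kappa> * (norm s * A)\<^sup>2"
      using \<open>S \<le> norm s * A\<close> \<open>S \<ge> 0\<close> \<kappa> by (intro mult_left_mono power_mono) auto
    also have "\<dots> = (\<kappa> * (norm s)\<^sup>2) * A\<^sup>2" by (simp add: power_mult_distrib)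
    also have "\<dots> \<le> S * A\<^sup>2" by (rule mult_right_mono) (use \<open>\<kappa> * (norm s)\<^sup>2 \<le> S\<close> in auto)
    finally have "S * (\<kappa> * S) \<le> S * A\<^sup>2" by (simp add: power2_eq_square ac_simps)
    then have "\<kappa> * S \<le> A\<^sup>2" using \<open>S \<ge> 0\<close> by (cases "S = 0") auto
    then show ?thesis using \<kappa> unfolding S_def by (simp add: field_simps)
  qed
  have z: "l (f j) = 0" if "f j = 0" for j using that by (simp add: l.zero)
  note s = orthonormal_series[of f "\<lambda>j. l (f j)", OF f(1) z B]
  define r where "r = (\<Sum>j. l (f j) *\<^sub>R f j)"
  define S where "S = {x. l x = m x r}"
  have "x \<in> S" for x
  proof (rule total_induct[OF f])
    show "subspace S" unfolding S_def
      by (rule subspaceI) (auto simp: l.zero zero_left l.add add_left l.scaleR scaleR_left)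
    show "closed S" unfolding S_def
      by (intro closed_Collect_eq continuous_intros l.continuous_on continuous_on)
    show "f j \<in> S" for j unfolding S_def using s(2)[of j] sym by (simp add: r_def)
  qed
  then show ?thesis unfolding S_def by auto
qed

text \<open>Uniformity over a bounded family allows a limit in the test vector to be interchanged
  with a limit along a sequence or with continuity in time. The next two lemmas use it to see that
  the good test vectors form a closed set.\<close>

lemma uniform_limit_form:
  assumes C: "\<And>t. t \<in> A \<Longrightarrow> norm (u t) \<le> C" and x: "x \<longlonglongrightarrow> r"
  shows "uniform_limit A (\<lambda>k t. m (u t) (x k)) (\<lambda>t. m (u t) r) sequentially"
  unfolding uniform_limit_iff
proof (intro allI impI)
  fix e :: real assume "e > 0"
  obtain M where M: "\<And>x y. \<bar>m x y\<bar> \<le> norm x * norm y * M" "M > 0"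
    using pos_bounded by auto
  have mb: "\<bar>m (u t) y\<bar> \<le> C * norm y * M" if "t \<in> A" for t y
    using M(1)[of "u t" y] C[OF that] M(2)
    by (meson mult_right_mono norm_ge_zero order_trans less_imp_le)
  have "(\<lambda>k. C * norm (x k - r) * M) \<longlonglongrightarrow> C * norm (r - r) * M"
    by (intro tendsto_intros x)
  then have "\<forall>\<^sub>F k in sequentially. C * norm (x k - r) * M < e"
    using \<open>e > 0\<close> by (intro order_tendstoD(2)) auto
  then show "\<forall>\<^sub>F k in sequentially. \<forall>t\<in>A. dist (m (u t) (x k)) (m (u t) r) < e"
    by eventually_elim (use mb in \<open>auto simp: dist_real_def diff_right[symmetric] intro: le_less_trans\<close>)
qed

text \<open>A concrete weak compactness: by Bessel's inequality the limits of the coefficients are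
  square summable and define a vector; convergence against the total system extends to all
  functionals by density and \<open>riesz\<close>.\<close>

lemma weak_limit:
  assumes f: "orthonormal f" "total f" and C: "\<And>n. norm (z n) \<le> C"
    and conv: "\<And>j. convergent (\<lambda>n. m (z n) (f j))"
  shows "\<exists>w. norm w \<le> C \<and> (\<forall>l. bounded_linear l \<longrightarrow> (\<lambda>n. l (z n) :: real) \<longlonglongrightarrow> l w)"
proof -
  define a where "a j = lim (\<lambda>n. m (z n) (f j))" for j
  have a: "(\<lambda>n. m (z n) (f j)) \<longlonglongrightarrow> a j" for j
    using conv[of j] unfolding a_def by (simp add: convergent_LIMSEQ_iff)
  have za: "a j = 0" if "f j = 0" for j
    using a[of j] that by (simp add: zero_right LIMSEQ_const_iff)
  obtain M where M: "\<And>x y. \<bar>m x y\<bar> \<le> norm x * norm y * M" "M > 0"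
    using pos_bounded by auto
  have C0: "C \<ge> 0" using C[of 0] norm_ge_zero order_trans by blast
  have mb: "\<bar>m (z n) y\<bar> \<le> C * norm y * M" for n y
    using M(1)[of "z n" y] C[of n] M(2)
    by (meson mult_right_mono norm_ge_zero order_trans less_imp_le)
  have B: "(\<Sum>j<N. (a j)\<^sup>2) \<le> C * C * M" for N
  proof (rule LIMSEQ_le_const2)
    show "(\<lambda>n. \<Sum>j<N. (m (z n) (f j))\<^sup>2) \<longlonglongrightarrow> (\<Sum>j<N. (a j)\<^sup>2)"
      by (intro tendsto_sum tendsto_power a)
    have "(\<Sum>j<N. (m (z n) (f j))\<^sup>2) \<le> C * C * M" for n
    proof -
      have "(\<Sum>j<N. (m (z n) (f j))\<^sup>2) \<le> m (z n) (z n)" by (rule bessel[OF f(1)])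
      also have "\<dots> \<le> C * norm (z n) * M" using mb[of n "z n"] by simp
      also have "\<dots> \<le> C * C * M" using C[of n] M(2) C0 by (intro mult_right_mono mult_left_mono) auto
      finally show ?thesis .
    qed
    then show "\<exists>N'. \<forall>n\<ge>N'. (\<Sum>j<N. (m (z n) (f j))\<^sup>2) \<le> C * C * M" by blast
  qed
  note s = orthonormal_series[of f a, OF f(1) za B]
  define w where "w = (\<Sum>j. a j *\<^sub>R f j)"
  define S where "S = {r. (\<lambda>n. m (z n) r) \<longlonglongrightarrow> m w r}"
  have S: "r \<in> S" for r
  proof (rule total_induct[OF f])
    show "subspace S" unfolding S_def
      by (rule subspaceI) (auto simp: zero_right add_right scaleR_right intro!: tendsto_add tendsto_mult_left)
    show "closed S"
    proof (unfold closed_sequential_limits, intro allI impI)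
      fix x r assume xr: "(\<forall>n. x n \<in> S) \<and> x \<longlonglongrightarrow> r"
      have "(\<lambda>n. m (z n) r) \<longlonglongrightarrow> m w r"
      proof (rule swap_uniform_limit'[where f = "\<lambda>k n. m (z n) (x k)" and g = "\<lambda>k. m w (x k)" and F = sequentially])
        show "\<forall>\<^sub>F k in sequentially. ((\<lambda>n. m (z n) (x k)) \<longlongrightarrow> m w (x k)) sequentially"
          using xr unfolding S_def by auto
        show "((\<lambda>k. m w (x k)) \<longlongrightarrow> m w r) sequentially"
          using xr by (intro tendsto tendsto_const) auto
        show "uniform_limit UNIV (\<lambda>k n. m (z n) (x k)) (\<lambda>n. m (z n) r) sequentially"
          by (rule uniform_limit_form[OF C]) (use xr in auto)
      qed (auto)
      then show "r \<in> S" unfolding S_def by simp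
    qed
    show "f j \<in> S" for j unfolding S_def using s(2)[of j] a[of j] by (simp add: w_def)
  qed
  have wl: "(\<lambda>n. l (z n)) \<longlonglongrightarrow> l w" if "bounded_linear l" for l :: "'a \<Rightarrow> real"
  proof -
    obtain r where "\<And>x. l x = m x r" using riesz[OF f \<open>bounded_linear l\<close>] by auto
    then show ?thesis using S[of r] unfolding S_def by simp
  qed
  \<comment> \<open>Pairing with \<open>w\<close> in the inner product instead of \<open>m\<close>
    gives the bound with \<open>C\<close> itself, without a factor depending on
    \<open>\<kappa>\<close>.\<close>
  have "(\<lambda>n. z n \<bullet> w) \<longlonglongrightarrow> w \<bullet> w" by (rule wl) (rule bounded_linear_inner_left)
  moreover have "z n \<bullet> w \<le> C * norm w" for n
    using norm_cauchy_schwarz[of "z n" w] C[of n] by (meson mult_right_mono norm_ge_zero order_trans)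
  ultimately have "w \<bullet> w \<le> C * norm w" by (intro LIMSEQ_le_const2) auto
  then have "norm w * norm w \<le> C * norm w" by (simp add: dot_square_norm power2_eq_square)
  then have "norm w \<le> C" using C0 by (cases "norm w = 0") (auto simp: mult_le_cancel_right)
  then show ?thesis using wl by blast
qed

text \<open>Boundedness lets continuity of the coefficients carry over to all functionals, because
  uniform limits of continuous functions of time are continuous.\<close>

lemma weakly_continuous:
  assumes f: "orthonormal f" "total f" and C: "\<And>t. t \<in> A \<Longrightarrow> norm (u t) \<le> C"
    and cont: "\<And>j. continuous_on A (\<lambda>t. m (u t) (f j))" and l: "bounded_linear l"
  shows "continuous_on A (\<lambda>t. l (u t) :: real)"
proof -
  define S where "S = {r. continuous_on A (\<lambda>t. m (u t) r)}"
  have S: "r \<in> S" for r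
  proof (rule total_induct[OF f])
    show "subspace S" unfolding S_def
      by (rule subspaceI) (auto simp: zero_right add_right scaleR_right intro!: continuous_intros)
    show "closed S"
    proof (unfold closed_sequential_limits, intro allI impI)
      fix x r assume xr: "(\<forall>n. x n \<in> S) \<and> x \<longlonglongrightarrow> r"
      have "continuous_on A (\<lambda>t. m (u t) r)"
      proof (rule uniform_limit_theorem[where f = "\<lambda>k t. m (u t) (x k)" and F = sequentially])
        show "\<forall>\<^sub>F k in sequentially. continuous_on A (\<lambda>t. m (u t) (x k))"
          using xr unfolding S_def by auto
        show "uniform_limit A (\<lambda>k t. m (u t) (x k)) (\<lambda>t. m (u t) r) sequentially"
          by (rule uniform_limit_form[OF C]) (use xr in auto)
      qed auto
      then show "r \<in> S" unfolding S_def by simp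
    qed
    show "f j \<in> S" for j unfolding S_def using cont by simp
  qed
  obtain r where "\<And>x. l x = m x r" using riesz[OF f l] by auto
  then show ?thesis using S[of r] unfolding S_def by simp
qed

end

section \<open>Ordinary differential equations and weakly continuous paths\<close>

lemma picard_lindelof:
  fixes F :: "'a::banach \<Rightarrow> 'a"
  assumes lip: "\<And>x y. norm (F x - F y) \<le> B * norm (x - y)" and T: "0 \<le> T"
  shows "\<exists>x. x 0 = x0 \<and> (\<forall>t\<in>{0..T}. (x has_vector_derivative F (x t)) (at t within {0..T}))"
proof -
  \<comment> \<open>The unknown is \<open>y t = exp (- \<mu> t) x t\<close>: for \<open>\<mu> > B\<close> the integral operator contracts on the whole
    of \<open>[0,T]\<close>. The time is clipped to \<open>[0,T]\<close> to work with bounded functions on the line.\<close>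
  define B' where "B' = \<bar>B\<bar>"
  have B': "B' \<ge> 0" by (simp add: B'_def)
  have lip': "norm (F x - F y) \<le> B' * norm (x - y)" for x y
    using lip[of x y] mult_right_mono[OF abs_ge_self norm_ge_zero, of B "x - y"]
    unfolding B'_def by linarith
  define \<mu> where "\<mu> = B' + 1"
  have \<mu>: "\<mu> > 0" "B' / \<mu> < 1" "B' / \<mu> \<ge> 0" using B' by (auto simp: \<mu>_def)
  have contF: "continuous_on UNIV F"
    by (rule lipschitz_on_continuous_on[OF lipschitz_onI[of _ _ B']])
       (use lip' B' in \<open>auto simp: dist_norm\<close>)
  define G where "G y s = F (exp (\<mu> * s) *\<^sub>R apply_bcontfun y s)" for y :: "real \<Rightarrow>\<^sub>C 'a" and s
  have ci: "continuous_on S (G y)" for y S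
    unfolding G_def by (rule continuous_on_compose2[OF contF])
       (auto intro!: continuous_intros continuous_on_subset[OF continuous_on_apply_bcontfun])
  have ii: "G y integrable_on {0..t}" for y t
    by (rule integrable_continuous_real[OF ci])
  define P where "P y t = exp (- \<mu> * t) *\<^sub>R (x0 + integral {0..t} (G y))" for y t
  define clip where "clip t = max 0 (min T t)" for t :: real
  have clip: "clip t \<in> {0..T}" "t \<in> {0..T} \<Longrightarrow> clip t = t" for t
    using T by (auto simp: clip_def)
  have cP: "continuous_on {0..T} (P y)" for y
    unfolding P_def by (intro continuous_intros indefinite_integral_continuous_1 ii)
  have "(\<lambda>t. P y (clip t)) \<in> bcontfun" for y
  proof -
    have "continuous_on UNIV (\<lambda>t. P y (clip t))"
      by (rule continuous_on_compose2[OF cP]) (use clip in \<open>auto simp: clip_def intro!: continuous_intros\<close>)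
    moreover have "bounded (P y ` {0..T})"
      by (intro compact_imp_bounded compact_continuous_image cP) auto
    then obtain b where b: "\<forall>t\<in>{0..T}. norm (P y t) \<le> b"
      unfolding bounded_iff by blast
    then have "\<And>t. norm (P y (clip t)) \<le> b" using clip by blast
    ultimately show ?thesis by (rule bcontfun_normI)
  qed
  then have ap: "apply_bcontfun (Bcontfun (\<lambda>t. P y (clip t))) t = P y (clip t)" for y t
    by (simp add: Bcontfun_inverse)
  have "\<exists>!y. Bcontfun (\<lambda>t. P y (clip t)) = y"
  proof (rule banach_fix_type[OF \<mu>(3,2)], intro allI)
    fix y z :: "real \<Rightarrow>\<^sub>C 'a"
    show "dist (Bcontfun (\<lambda>t. P y (clip t))) (Bcontfun (\<lambda>t. P z (clip t))) \<le> B' / \<mu> * dist y z"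
    proof (rule dist_bound, unfold ap)
      fix t'
      define t where "t = clip t'"
      have t: "0 \<le> t" using clip[of t'] by (auto simp: t_def)
      define d where "d = dist y z"
      have d: "d \<ge> 0" by (simp add: d_def)
      \<comment> \<open>The weight integrates to at most \<open>exp (\<mu> * t) / \<mu>\<close>, and
        the factor \<open>exp (- \<mu> * t)\<close> in \<open>P\<close> cancels the exponential. The
        contraction constant \<open>B' / \<mu>\<close> is therefore independent of
        \<open>T\<close>.\<close>
      have ei: "((\<lambda>s. B' * d * exp (\<mu> * s)) has_integral (B' * d * exp (\<mu> * t) / \<mu> - B' * d * exp (\<mu> * 0) / \<mu>)) {0..t}"
        by (rule fundamental_theorem_of_calculus[OF t])
           (use \<mu> in \<open>auto intro!: derivative_eq_intros simp: has_real_derivative_iff_has_vector_derivative[symmetric]\<close>)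
      have "norm (integral {0..t} (\<lambda>s. G y s - G z s))
          \<le> integral {0..t} (\<lambda>s. B' * d * exp (\<mu> * s))"
      proof (rule integral_norm_bound_integral)
        fix s
        have "norm (G y s - G z s)
            \<le> B' * norm (exp (\<mu> * s) *\<^sub>R apply_bcontfun y s - exp (\<mu> * s) *\<^sub>R apply_bcontfun z s)"
          unfolding G_def by (rule lip')
        also have "\<dots> = B' * (exp (\<mu> * s) * dist (apply_bcontfun y s) (apply_bcontfun z s))"
          by (simp add: dist_norm scaleR_diff_right[symmetric])
        also have "\<dots> \<le> B' * (exp (\<mu> * s) * d)"
          unfolding d_def by (intro mult_left_mono dist_bounded B') auto
        finally show "norm (G y s - G z s) \<le> B' * d * exp (\<mu> * s)"
          by (simp add: ac_simps)
      qed (use ei ii in \<open>auto intro!: integrable_diff\<close>)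
      also have "\<dots> = B' * d * exp (\<mu> * t) / \<mu> - B' * d / \<mu>" by (simp only: integral_unique[OF ei] mult_zero_right exp_zero mult_1_right)
      also have "\<dots> \<le> B' * d * exp (\<mu> * t) / \<mu>" using \<mu> d B' by simp
      finally have n: "norm (integral {0..t} (\<lambda>s. G y s - G z s))
          \<le> B' * d * exp (\<mu> * t) / \<mu>" .
      have "dist (P y t) (P z t) = exp (- \<mu> * t) *
         norm (integral {0..t} (\<lambda>s. G y s - G z s))"
        unfolding P_def dist_norm scaleR_diff_right[symmetric]
        by (simp add: integral_diff[OF ii ii])
      also have "\<dots> \<le> exp (- \<mu> * t) * (B' * d * exp (\<mu> * t) / \<mu>)" using n by (intro mult_left_mono) auto
      also have "\<dots> = B' / \<mu> * d" by (simp add: exp_minus field_simps)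
      finally show "dist (P y (clip t')) (P z (clip t')) \<le> B' / \<mu> * dist y z" unfolding t_def d_def .
    qed
  qed
  then obtain y where y: "Bcontfun (\<lambda>t. P y (clip t)) = y" by blast
  define x where "x t = exp (\<mu> * t) *\<^sub>R apply_bcontfun y t" for t
  have xt: "x t = x0 + integral {0..t} (\<lambda>s. F (x s))" if "t \<in> {0..T}" for t
  proof -
    have "apply_bcontfun y t = P y t" using ap[of y t] clip(2)[OF that] y by simp
    then show ?thesis by (simp add: x_def P_def G_def[abs_def] exp_minus)
  qed
  have "(x has_vector_derivative F (x t)) (at t within {0..T})" if "t \<in> {0..T}" for t
  proof -
    have "((\<lambda>u. x0 + integral {0..u} (\<lambda>s. F (x s))) has_vector_derivative F (x t)) (at t within {0..T})"
      using integral_has_vector_derivative[OF _ that, of "\<lambda>s. F (x s)"] ci[of "{0..T}" y]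
      by (auto simp: x_def G_def[abs_def] intro!: derivative_eq_intros)
    then show ?thesis
      by (rule has_vector_derivative_transform[OF that, rotated]) (use xt in auto)
  qed
  moreover have "x 0 = x0" using xt[of 0] T by simp
  ultimately show ?thesis by blast
qed

lemma gronwall:
  fixes E E' :: "real \<Rightarrow> real"
  assumes d: "\<And>t. t \<in> {0..T} \<Longrightarrow> (E has_real_derivative E' t) (at t within {0..T})"
    and le: "\<And>t. t \<in> {0..T} \<Longrightarrow> E' t \<le> A * E t" and t: "t \<in> {0..T}"
  shows "E t \<le> E 0 * exp (A * t)"
proof (cases "t = 0")
  case False
  then have t0: "0 < t" using t by simp
  define h where "h s = E s * exp (- A * s)" for s
  have hd: "(h has_derivative (\<lambda>x. ((E' s - A * E s) * exp (- A * s)) * x)) (at s within {0..t})" if "s \<in> {0..t}" for s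
  proof -
    have "(E has_real_derivative E' s) (at s within {0..t})"
      using d[of s] that t by (auto intro: DERIV_subset)
    then have "(h has_real_derivative ((E' s - A * E s) * exp (- A * s))) (at s within {0..t})"
      unfolding h_def by (auto intro!: derivative_eq_intros simp: algebra_simps)
    then show ?thesis unfolding has_field_derivative_def .
  qed
  from mvt_simple[OF t0, of h "\<lambda>s x. ((E' s - A * E s) * exp (- A * s)) * x"] hd
  obtain s where s: "s \<in> {0<..<t}" "h t - h 0 = ((E' s - A * E s) * exp (- A * s)) * (t - 0)" by auto
  have "E' s - A * E s \<le> 0" using le[of s] s t by auto
  then have "h t - h 0 \<le> 0" unfolding s(2) using t0 by (simp add: mult_nonpos_nonneg mult_le_0_iff)
  then have "E t * exp (- A * t) \<le> E 0" by (simp add: h_def)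
  then have "(E t * exp (- A * t)) * exp (A * t) \<le> E 0 * exp (A * t)" by (rule mult_right_mono) simp
  then show ?thesis by (simp add: mult.assoc exp_add[symmetric])
qed simp

text \<open>The part of the Arzela-Ascoli argument that follows the diagonal choice: a common
  Lipschitz constant transports convergence from rational times to all times.\<close>

lemma equi_lipschitz_convergent:
  fixes f :: "nat \<Rightarrow> real \<Rightarrow> real"
  assumes lip: "\<And>n s t. s \<in> {0..T} \<Longrightarrow> t \<in> {0..T} \<Longrightarrow> \<bar>f n s - f n t\<bar> \<le> A * \<bar>s - t\<bar>"
    and conv: "\<And>t. t \<in> {0..T} \<inter> \<rat> \<Longrightarrow> convergent (\<lambda>n. f n t)" and T: "T > 0" and t: "t \<in> {0..T}"
  shows "convergent (\<lambda>n. f n t)"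
proof -
  have "Cauchy (\<lambda>n. f n t)"
  proof (rule metric_CauchyI)
    fix e :: real assume e: "e > 0"
    define \<delta> where "\<delta> = e / (3 * (\<bar>A\<bar> + 1))"
    have \<delta>: "\<delta> > 0" "\<bar>A\<bar> * \<delta> < e / 3" using e by (auto simp: \<delta>_def field_simps)
    \<comment> \<open>The window is cut to (0,T), so that a nearby rational time inside the interval
      exists even if \<open>t\<close> is an endpoint.\<close>
    have "max 0 (t - \<delta>) < min T (t + \<delta>)" using T t \<delta> by auto
    then obtain q where q: "q \<in> \<rat>" "max 0 (t - \<delta>) < q" "q < min T (t + \<delta>)"
      using Rats_dense_in_real by blast
    then have qT: "q \<in> {0..T} \<inter> \<rat>" by auto
    have "\<bar>q - t\<bar> \<le> \<delta>" using q by auto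
    then have near: "\<bar>f n q - f n t\<bar> < e / 3" for n
    proof -
      have "\<bar>f n q - f n t\<bar> \<le> A * \<bar>q - t\<bar>" using lip qT t by auto
      also have "\<dots> \<le> \<bar>A\<bar> * \<bar>q - t\<bar>" by (rule mult_right_mono) auto
      also have "\<dots> \<le> \<bar>A\<bar> * \<delta>" using \<open>\<bar>q - t\<bar> \<le> \<delta>\<close> by (intro mult_left_mono) auto
      finally show ?thesis using \<delta> by simp
    qed
    have "Cauchy (\<lambda>n. f n q)" using conv[OF qT] by (rule convergent_Cauchy)
    then obtain M where M: "\<And>m n. m \<ge> M \<Longrightarrow> n \<ge> M \<Longrightarrow> dist (f m q) (f n q) < e / 3"
      using metric_CauchyD[of _ "e / 3"] e by (metis divide_pos_pos zero_less_numeral)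
    have "dist (f m t) (f n t) < e" if "m \<ge> M" "n \<ge> M" for m n
      using M[OF that] near[of m] near[of n] unfolding dist_real_def by linarith
    then show "\<exists>M. \<forall>m\<ge>M. \<forall>n\<ge>M. dist (f m t) (f n t) < e" by blast
  qed
  then show ?thesis by (rule Cauchy_convergent)
qed

text \<open>The path is sampled at grid times with step 1 / k: only finitely many of them meet the
  interval, and uniform continuity bounds the error once 1 / k < d.\<close>

lemma continuous_simple_approximation:
  fixes v :: "real \<Rightarrow> 'a::metric_space"
  assumes cont: "continuous_on {0..T} v" and e: "e > 0"
  shows "\<exists>s. simple_function (lebesgue_on {0<..<T}) s \<and> (\<forall>t\<in>{0<..<T}. dist (s t) (v t) < e)"
proof -
  obtain d where d: "d > 0" "\<And>s t. s \<in> {0..T} \<Longrightarrow> t \<in> {0..T} \<Longrightarrow> dist s t < d \<Longrightarrow> dist (v s) (v t) < e"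
    using compact_uniformly_continuous[OF cont] e unfolding uniformly_continuous_on_def
    by (metis compact_Icc)
  obtain k :: nat where k: "1 / d < real k" using reals_Archimedean2 by blast
  then have k0: "k > 0" using d(1) by (cases k) (auto simp: field_simps dest: order_less_trans)
  have fl: "simple_function (lebesgue_on {0<..<T}) (\<lambda>t. \<lfloor>real k * t\<rfloor>)"
    unfolding simple_function_def
  proof
    have "(\<lambda>t. \<lfloor>real k * t\<rfloor>) ` space (lebesgue_on {0<..<T}) \<subseteq> {0..\<lfloor>real k * T\<rfloor>}"
      by (auto intro!: floor_mono mult_left_mono)
    then show "finite ((\<lambda>t. \<lfloor>real k * t\<rfloor>) ` space (lebesgue_on {0<..<T}))"
      using finite_subset by blast
    have fm: "(\<lambda>t. \<lfloor>real k * t\<rfloor>) \<in> measurable (lebesgue_on {0<..<T}) (count_space UNIV)"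
      by (rule measurable_compose[of "\<lambda>t. real k * t" _ borel, OF _ measurable_real_floor])
         (intro continuous_imp_measurable_on_sets_lebesgue continuous_intros, simp)
    show "\<forall>x\<in>(\<lambda>t. \<lfloor>real k * t\<rfloor>) ` space (lebesgue_on {0<..<T}).
        (\<lambda>t. \<lfloor>real k * t\<rfloor>) -` {x} \<inter> space (lebesgue_on {0<..<T}) \<in> sets (lebesgue_on {0<..<T})"
      by (intro ballI measurable_sets[OF fm]) simp
  qed
  have "dist (v (real_of_int \<lfloor>real k * t\<rfloor> / real k)) (v t) < e" if t: "t \<in> {0<..<T}" for t
  proof (rule d(2))
    let ?s = "real_of_int \<lfloor>real k * t\<rfloor> / real k"
    have "real_of_int \<lfloor>real k * t\<rfloor> \<le> real k * t" "real k * t < real_of_int \<lfloor>real k * t\<rfloor> + 1" by linarith+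
    then have 1: "?s \<le> t" "t < ?s + 1 / real k" using k0 by (auto simp: field_simps)
    have "0 \<le> ?s" using t k0 by (intro divide_nonneg_pos) auto
    then show "?s \<in> {0..T}" "t \<in> {0..T}" using 1 t by auto
    have "1 / real k < d" using k d(1) k0 by (simp add: field_simps)
    then show "dist ?s t < d" using 1 by (auto simp: dist_real_def)
  qed
  moreover have "simple_function (lebesgue_on {0<..<T}) (\<lambda>t. v (real_of_int \<lfloor>real k * t\<rfloor> / real k))"
    using simple_function_compose1[OF fl, of "\<lambda>i. v (real_of_int i / real k)"] by simp
  ultimately show ?thesis by blast
qed

context coercive_form
begin

text \<open>A separable case of Pettis' theorem: the partial sums of the expansion are norm
  continuous in time, hence close to simple functions; allowing the error 1 / (n + 1) at stage n
  gives convergence at every time.\<close>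

lemma weakly_continuous_simple_approximation:
  fixes u :: "real \<Rightarrow> 'a"
  assumes f: "orthonormal f" "total f" and cont: "\<And>j. continuous_on {0..T} (\<lambda>t. m (u t) (f j))"
  shows "\<exists>s. (\<forall>n. simple_function (lebesgue_on {0<..<T}) (s n)) \<and> (\<forall>t\<in>{0<..<T}. (\<lambda>n. s n t) \<longlonglongrightarrow> u t)"
proof -
  define v where "v n t = (\<Sum>j<n. m (u t) (f j) *\<^sub>R f j)" for n t
  have vc: "continuous_on {0..T} (v n)" for n
    unfolding v_def by (intro continuous_intros cont)
  have "\<forall>n. \<exists>s. simple_function (lebesgue_on {0<..<T}) s \<and> (\<forall>t\<in>{0<..<T}. dist (s t) (v n t) < 1 / real (Suc n))"
    by (rule allI, rule continuous_simple_approximation[OF vc]) simp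
  from choice[OF this] obtain s where s: "\<And>n. simple_function (lebesgue_on {0<..<T}) (s n)"
    "\<And>n t. t \<in> {0<..<T} \<Longrightarrow> dist (s n t) (v n t) < 1 / real (Suc n)"
    by blast
  have "(\<lambda>n. s n t) \<longlonglongrightarrow> u t" if t: "t \<in> {0<..<T}" for t
  proof -
    have "(\<lambda>n. dist (v n t) (u t)) \<longlonglongrightarrow> 0"
      using expansion[OF f, of "u t"] unfolding v_def sums_def tendsto_dist_iff[symmetric] .
    moreover have "(\<lambda>n. dist (s n t) (v n t)) \<longlonglongrightarrow> 0"
      by (rule tendsto_sandwich[OF _ _ tendsto_const lim_1_over_n[THEN LIMSEQ_Suc]])
         (use s(2)[OF t] in \<open>auto intro!: always_eventually less_imp_le\<close>)
    ultimately have "(\<lambda>n. dist (s n t) (v n t) + dist (v n t) (u t)) \<longlonglongrightarrow> 0"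
      using tendsto_add_zero by blast
    then have "(\<lambda>n. dist (s n t) (u t)) \<longlonglongrightarrow> 0"
      by (rule tendsto_sandwich[OF _ _ tendsto_const, rotated 2])
         (auto intro!: always_eventually dist_triangle)
    then show ?thesis by (subst tendsto_dist_iff)
  qed
  with s(1) show ?thesis by blast
qed

end

section \<open>Galerkin approximation of the abstract beam equation\<close>

text \<open>The differential equation needs only some Lipschitz constant; hiding it lets the closure
  properties be chained as introduction rules.\<close>

lemma bounded_linear_lipschitz_ex:
  assumes "bounded_linear f"
  shows "\<exists>L. L-lipschitz_on UNIV f"
  using bounded_linear.lipschitz_boundE[OF assms] by metis

lemma lipschitz_ex_compose:
  assumes "\<exists>L. L-lipschitz_on UNIV f" "\<exists>L. L-lipschitz_on UNIV h"
  shows "\<exists>L. L-lipschitz_on UNIV (\<lambda>x. f (h x))"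
  using assms lipschitz_on_compose2[of _ UNIV h _ f] by (metis lipschitz_on_subset subset_UNIV)

lemma lipschitz_ex_add:
  fixes f h :: "'a::metric_space \<Rightarrow> 'b::real_normed_vector"
  assumes "\<exists>L. L-lipschitz_on UNIV f" "\<exists>L. L-lipschitz_on UNIV h"
  shows "\<exists>L. L-lipschitz_on UNIV (\<lambda>x. f x + h x)"
  using assms lipschitz_on_add by blast

lemma lipschitz_ex_sum:
  fixes f :: "'i \<Rightarrow> 'a::metric_space \<Rightarrow> 'b::real_normed_vector"
  assumes "\<And>i. i \<in> I \<Longrightarrow> \<exists>L. L-lipschitz_on UNIV (f i)"
  shows "\<exists>L. L-lipschitz_on UNIV (\<lambda>x. \<Sum>i\<in>I. f i x)"
  using assms
proof (induction I rule: infinite_finite_induct)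
  case (insert i I)
  then show ?case by (simp add: lipschitz_ex_add)
qed (auto intro: lipschitz_on_constant)

text \<open>The difference of the vectors costs R, the change of the scalar factor times the smaller
  norm another 2 R. The latter is bounded because the factor stops growing where the norm reaches
  \<open>sqrt R\<close>.\<close>

lemma truncated_cubic_lipschitz:
  fixes x y :: "'a::real_normed_vector"
  assumes R: "R \<ge> 0"
  shows "norm (min ((norm x)\<^sup>2) R *\<^sub>R x - min ((norm y)\<^sup>2) R *\<^sub>R y) \<le> 3 * R * norm (x - y)"
proof -
  have *: "norm (min ((norm x)\<^sup>2) R *\<^sub>R x - min ((norm y)\<^sup>2) R *\<^sub>R y) \<le> 3 * R * norm (x - y)"
    if "norm x \<le> norm y" for x y :: 'a
  proof -
    define a b r where "a = norm x" and "b = norm y" and "r = sqrt R"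
    have ab: "0 \<le> a" "a \<le> b" "0 \<le> r" and Rr: "R = r * r"
      using that R by (auto simp: a_def b_def r_def)
    have key: "\<bar>min (a\<^sup>2) R - min (b\<^sup>2) R\<bar> * a \<le> 2 * R * (b - a)"
    proof (cases "r \<le> a")
      case True
      then have "R \<le> a\<^sup>2" "R \<le> b\<^sup>2" using ab unfolding Rr power2_eq_square by (auto intro!: mult_mono)
      then show ?thesis using ab R by simp
    next
      case False
      then have "a\<^sup>2 \<le> R" using ab unfolding Rr power2_eq_square by (auto intro!: mult_mono)
      \<comment> \<open>\<open>c\<close> is the smaller of \<open>b\<close> and \<open>r\<close>:
        the truncated square of \<open>b\<close> equals \<open>c * c\<close>, and (c - a) (c + a) a
        is at most (b - a) 2 r r.\<close>
      have "\<exists>c. a \<le> c \<and> c \<le> b \<and> c \<le> r \<and> min (b\<^sup>2) R = c * c"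
      proof (cases "b \<le> r")
        case True
        then have "b\<^sup>2 \<le> R" using ab unfolding Rr power2_eq_square by (auto intro!: mult_mono)
        then show ?thesis using True ab by (intro exI[of _ b]) (auto simp: power2_eq_square)
      next
        case F: False
        then have "R \<le> b\<^sup>2" using ab unfolding Rr power2_eq_square by (auto intro!: mult_mono)
        then show ?thesis using F False ab Rr by (intro exI[of _ r]) auto
      qed
      then obtain c where c: "a \<le> c" "c \<le> b" "c \<le> r" "min (b\<^sup>2) R = c * c" by blast
      have "a * a \<le> c * c" using c ab by (intro mult_mono) auto
      then have "\<bar>min (a\<^sup>2) R - min (b\<^sup>2) R\<bar> * a = (c - a) * ((c + a) * a)"
        using \<open>a\<^sup>2 \<le> R\<close> c by (simp add: power2_eq_square algebra_simps)
      also have "\<dots> \<le> (b - a) * ((2 * r) * r)"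
        using c ab False by (intro mult_mono) auto
      finally show ?thesis by (simp add: Rr algebra_simps)
    qed
    have "norm (min (a\<^sup>2) R *\<^sub>R x - min (b\<^sup>2) R *\<^sub>R y)
        = norm (min (b\<^sup>2) R *\<^sub>R (x - y) + (min (a\<^sup>2) R - min (b\<^sup>2) R) *\<^sub>R x)"
      by (simp add: algebra_simps)
    also have "\<dots> \<le> min (b\<^sup>2) R * norm (x - y) + \<bar>min (a\<^sup>2) R - min (b\<^sup>2) R\<bar> * a"
      using R by (intro order_trans[OF norm_triangle_ineq]) (simp add: a_def)
    also have "\<dots> \<le> R * norm (x - y) + 2 * R * norm (x - y)"
    proof (rule add_mono)
      show "min (b\<^sup>2) R * norm (x - y) \<le> R * norm (x - y)" by (intro mult_right_mono) auto
      have "b - a \<le> norm (x - y)" unfolding a_def b_def by (metis norm_minus_commute norm_triangle_ineq2)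
      then have "2 * R * (b - a) \<le> 2 * R * norm (x - y)" using R by (intro mult_left_mono) auto
      then show "\<bar>min (a\<^sup>2) R - min (b\<^sup>2) R\<bar> * a \<le> 2 * R * norm (x - y)" using key by simp
    qed
    finally show ?thesis by (simp add: a_def b_def)
  qed
  show ?thesis
    using *[of x y] *[of y x] by (cases "norm x \<le> norm y") (auto simp: norm_minus_commute)
qed

text \<open>Replaces \<open>s\<^sup>2 / 2\<close> in the energy of the truncated problem, where \<open>min s R\<close> replaces \<open>s\<close>.\<close>

definition trunc_primitive :: "real \<Rightarrow> real \<Rightarrow> real" where
  "trunc_primitive R s = (if s \<le> R then s\<^sup>2 / 2 else R * s - R\<^sup>2 / 2)"

text \<open>A Taylor estimate of second order: the expected derivative \<open>min x R\<close> is
  1-Lipschitz. It settles differentiability at the corner \<open>x = R\<close> along with all other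
  points.\<close>

lemma trunc_primitive_quadratic:
  "\<bar>trunc_primitive R y - trunc_primitive R x - min x R * (y - x)\<bar> \<le> (y - x)\<^sup>2"
proof -
  consider "x \<le> R" "y \<le> R" | "x \<le> R" "y > R" | "x > R" "y \<le> R" | "x > R" "y > R" by linarith
  then show ?thesis
  proof cases
    case 1
    have "trunc_primitive R y - trunc_primitive R x - min x R * (y - x) = (y - x)\<^sup>2 / 2"
      using 1 by (simp add: trunc_primitive_def power2_eq_square field_simps)
    then show ?thesis using zero_le_power2[of "y - x"] by linarith
  next
    case 2
    have e: "trunc_primitive R y - trunc_primitive R x - min x R * (y - x) = (R - x) * (y - x) - (R - x)\<^sup>2 / 2"
      using 2 by (simp add: trunc_primitive_def power2_eq_square field_simps)
    have "(R - x) * (R - x) \<le> (R - x) * (y - x)" "(R - x) * (y - x) \<le> (y - x) * (y - x)"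
      using 2 by (auto intro!: mult_mono)
    then show ?thesis unfolding e power2_eq_square using zero_le_square[of "R - x"] by linarith
  next
    case 3
    have e: "trunc_primitive R y - trunc_primitive R x - min x R * (y - x) = (y - R)\<^sup>2 / 2"
      using 3 by (simp add: trunc_primitive_def power2_eq_square field_simps)
    have "(y - R)\<^sup>2 \<le> (y - x)\<^sup>2"
      using 3 by (intro abs_le_square_iff[THEN iffD1]) auto
    then show ?thesis unfolding e using zero_le_power2[of "y - R"] by linarith
  next
    case 4
    have "trunc_primitive R y - trunc_primitive R x - min x R * (y - x) = 0"
      using 4 by (simp add: trunc_primitive_def power2_eq_square field_simps)
    then show ?thesis by simp
  qed
qed

lemma trunc_primitive_has_derivative:
  "(trunc_primitive R has_real_derivative min x R) (at x)"
  unfolding has_field_derivative_def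
proof (rule has_derivativeI_sandwich[where e = 1 and H = "\<lambda>y. \<bar>y - x\<bar>"])
  show "bounded_linear ((*) (min x R))" by (rule bounded_linear_mult_right)
  show "norm (trunc_primitive R y - trunc_primitive R x - min x R * (y - x)) / norm (y - x) \<le> \<bar>y - x\<bar>" if "y \<noteq> x" for y
    using trunc_primitive_quadratic[of R y x] that
    by (simp add: field_simps power2_eq_square abs_mult[symmetric])
  show "(\<lambda>y. \<bar>y - x\<bar>) \<midarrow>x\<rightarrow> 0"
    by (rule tendsto_eq_intros refl tendsto_rabs_zero LIM_zero | simp)+
qed simp

lemma trunc_primitive_le: "trunc_primitive R s \<le> s\<^sup>2 / 2"
  using zero_le_power2[of "s - R"] by (auto simp: trunc_primitive_def power2_eq_square field_simps)

text \<open>Below \<open>R\<close> this is completing the square in b2 s^2 / 4 - b1 s / 2. Above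
  \<open>R\<close> the function is affine with slope (b2 R - b1) / 2, which the threshold on
  \<open>R\<close> makes nonnegative.\<close>

lemma trunc_potential_lower:
  assumes s: "s \<ge> 0" and b2: "b2 > 0" and R: "R \<ge> \<bar>b1\<bar> / b2"
  shows "- (b1\<^sup>2 / (4 * b2)) \<le> b2 / 2 * trunc_primitive R s - b1 / 2 * s"
proof -
  have q: "- (b1\<^sup>2 / (4 * b2)) \<le> b2 / 2 * (x\<^sup>2 / 2) - b1 / 2 * x" for x
  proof -
    have "0 \<le> (b2 * x - b1)\<^sup>2 / (4 * b2)" using b2 by simp
    also have "\<dots> = b2 / 2 * (x\<^sup>2 / 2) - b1 / 2 * x + b1\<^sup>2 / (4 * b2)"
      using b2 by (simp add: power2_eq_square field_simps)
    finally show ?thesis by simp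
  qed
  show ?thesis
  proof (cases "s \<le> R")
    case True
    then show ?thesis using q[of s] by (simp add: trunc_primitive_def)
  next
    case False
    have "b2 * R \<ge> \<bar>b1\<bar>" using R b2 by (simp add: field_simps)
    then have "0 \<le> (b2 * R - b1) * (s - R) / 2" using False by simp
    then have "b2 / 2 * (R\<^sup>2 / 2) - b1 / 2 * R \<le> b2 / 2 * (R * s - R\<^sup>2 / 2) - b1 / 2 * s"
      by (simp add: power2_eq_square field_simps)
    then show ?thesis using q[of R] False by (simp add: trunc_primitive_def)
  qed
qed

interpretation ip: coercive_form "inner :: 'a::{real_inner,banach} \<Rightarrow> 'a \<Rightarrow> real" 1
proof -
  interpret bounded_bilinear "inner :: 'a \<Rightarrow> 'a \<Rightarrow> real" by (rule bounded_bilinear_inner)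
  show "coercive_form (inner :: 'a \<Rightarrow> 'a \<Rightarrow> real) 1"
    by unfold_locales (auto simp: inner_commute power2_norm_eq_inner)
qed

interpretation ipg: pos_form "inner :: 'a::{real_inner,banach} \<Rightarrow> 'a \<Rightarrow> real"
  by unfold_locales (simp_all add: inner_add_left, rule inner_commute)

lemma ip_gram_schmidt:
  assumes "\<And>x. (\<And>j. x \<bullet> h j = 0) \<Longrightarrow> x = 0"
  shows "ip.orthonormal (ipg.gram_schmidt h)" "ip.total (ipg.gram_schmidt h)"
proof -
  show "ip.orthonormal (ipg.gram_schmidt h)"
    unfolding ip.orthonormal_def using ipg.gram_schmidt_orthogonal ipg.gram_schmidt_normed by metis
  show "ip.total (ipg.gram_schmidt h)"
    unfolding ip.total_def
  proof (intro allI impI)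
    fix x assume o: "\<forall>j. x \<bullet> ipg.gram_schmidt h j = 0"
    have "range (ipg.gram_schmidt h) \<subseteq> {y. x \<bullet> y = 0}" using o by auto
    moreover have "subspace {y. x \<bullet> y = 0}" by (rule subspace_hyperplane)
    ultimately have "span (range (ipg.gram_schmidt h)) \<subseteq> {y. x \<bullet> y = 0}" by (rule span_minimal)
    then have "x \<bullet> h j = 0" for j using ipg.span_gram_schmidt_source[of h j] by auto
    then show "x = 0" by (rule assms)
  qed
qed

text \<open>The test function of the beam problem is \<open>K (K \<eta>)\<close>, which the velocity
  side sees as \<open>P \<eta>\<close>. \<open>P_dense\<close> is density of the range of
  \<open>P\<close> with respect to \<open>m\<close>; \<open>K_compact\<close> is compactness as
  sequential continuity from weak to strong; \<open>g_total\<close> encodes separability.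
  \<open>p\<close>, \<open>B1\<close> and \<open>B2\<close> carry the load, the damping and the term
  with \<open>U\<close>.\<close>

locale beam_equation = coercive_form m \<kappa>
  for m :: "'a::{real_inner,banach} \<Rightarrow> 'a \<Rightarrow> real" and \<kappa> +
  fixes P K :: "'a \<Rightarrow> 'a" and p :: "'a \<Rightarrow> real" and B1 B2 :: "'a \<Rightarrow> 'a \<Rightarrow> real"
    and D b1 b2 :: real and g :: "nat \<Rightarrow> 'a"
  assumes P: "bounded_linear P" and P_inj: "P x = 0 \<Longrightarrow> x = 0"
    and P_dense: "(\<And>\<eta>. m x (P \<eta>) = 0) \<Longrightarrow> x = 0"
    and K: "bounded_linear K"
    and K_compact: "(\<And>n. norm (v n) \<le> C) \<Longrightarrow>
      (\<And>l. bounded_linear l \<Longrightarrow> (\<lambda>n. l (v n) :: real) \<longlonglongrightarrow> l y) \<Longrightarrow> (\<lambda>n. K (v n)) \<longlonglongrightarrow> K y"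
    and p: "bounded_linear p" and B1: "bounded_bilinear B1" and B2: "bounded_bilinear B2"
    and D: "D > 0" and b2: "b2 > 0"
    and g_total: "(\<And>j. x \<bullet> g j = 0) \<Longrightarrow> x = 0"
begin

definition force :: "real \<Rightarrow> 'a \<Rightarrow> 'a \<Rightarrow> 'a \<Rightarrow> real" where
  "force R u z \<eta> = - D * (u \<bullet> \<eta>) - (b2 * min ((norm (K u))\<^sup>2) R - b1) * (K u \<bullet> K \<eta>)
     + p (P \<eta>) + B1 z (P \<eta>) + B2 u (P \<eta>)"

lemma bounded_linear_force: "bounded_linear (force R u z)"
  unfolding force_def
  by (intro bounded_linear_add bounded_linear_sub bounded_linear_const_mult
      bounded_linear_compose[OF p P] bounded_linear_compose[OF bounded_bilinear.bounded_linear_right[OF B1] P]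
      bounded_linear_compose[OF bounded_bilinear.bounded_linear_right[OF B2] P]
      bounded_linear_inner_right bounded_linear_compose[OF bounded_linear_inner_right K])

text \<open>Uniform over the ball in which all Galerkin solutions stay. The constant
  \<open>A\<close> later gives the Lipschitz bound in time of the velocity coefficients and the
  dominating function in the limit passage.\<close>

lemma force_bound:
  assumes R: "R \<ge> 0"
  shows "\<exists>A\<ge>0. \<forall>u z \<eta>. norm u \<le> C \<longrightarrow> norm z \<le> C \<longrightarrow> \<bar>force R u z \<eta>\<bar> \<le> A * norm \<eta>"
proof -
  have bound: "\<exists>A\<ge>0. \<forall>x \<eta>. norm x \<le> C \<longrightarrow> \<bar>h x \<eta>\<bar> \<le> A * norm \<eta>" if h: "bounded_bilinear h" for h :: "'a \<Rightarrow> 'a \<Rightarrow> real"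
  proof -
    obtain k where k: "k \<ge> 0" "\<And>x y. norm (h x y) \<le> norm x * norm y * k"
      using bounded_bilinear.nonneg_bounded[OF h] by auto
    have "\<bar>h x \<eta>\<bar> \<le> (\<bar>C\<bar> * k) * norm \<eta>" if "norm x \<le> C" for x \<eta>
    proof -
      have "norm x * norm \<eta> * k \<le> \<bar>C\<bar> * norm \<eta> * k" using that k(1) by (intro mult_right_mono) auto
      then show ?thesis using k(2)[of x \<eta>] by (simp add: ac_simps)
    qed
    then show ?thesis using k(1) by (intro exI[of _ "\<bar>C\<bar> * k"]) auto
  qed
  obtain A0 where A0: "A0 \<ge> 0" "\<forall>(u::'a) \<eta>. norm u \<le> C \<longrightarrow> \<bar>u \<bullet> \<eta>\<bar> \<le> A0 * norm \<eta>"
    using bound[OF bounded_bilinear_inner] by blast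
  obtain AK where AK: "AK \<ge> 0" "\<forall>u \<eta>. norm u \<le> C \<longrightarrow> \<bar>K u \<bullet> K \<eta>\<bar> \<le> AK * norm \<eta>"
    using bound[OF bounded_bilinear.comp[OF bounded_bilinear_inner K K]] by blast
  obtain A1 where A1: "A1 \<ge> 0" "\<forall>z \<eta>. norm z \<le> C \<longrightarrow> \<bar>B1 z (P \<eta>)\<bar> \<le> A1 * norm \<eta>"
    using bound[OF bounded_bilinear.comp[OF B1 bounded_linear_ident P]] by blast
  obtain A2 where A2: "A2 \<ge> 0" "\<forall>u \<eta>. norm u \<le> C \<longrightarrow> \<bar>B2 u (P \<eta>)\<bar> \<le> A2 * norm \<eta>"
    using bound[OF bounded_bilinear.comp[OF B2 bounded_linear_ident P]] by blast
  obtain A3 where A3: "A3 \<ge> 0" "\<And>\<eta>. \<bar>p (P \<eta>)\<bar> \<le> norm \<eta> * A3"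
    using bounded_linear.nonneg_bounded[OF bounded_linear_compose[OF p P]] by auto
  define A where "A = D * A0 + (b2 * R + \<bar>b1\<bar>) * AK + A3 + A1 + A2"
  have "A \<ge> 0" unfolding A_def using A0 AK A1 A2 A3 D b2 R by auto
  moreover have "\<bar>force R u z \<eta>\<bar> \<le> A * norm \<eta>" if uz: "norm u \<le> C" "norm z \<le> C" for u z \<eta>
  proof -
    have 1: "\<bar>D * (u \<bullet> \<eta>)\<bar> \<le> D * (A0 * norm \<eta>)"
      using A0(2)[rule_format, OF uz(1), of \<eta>] D by (simp add: abs_mult)
    have "0 \<le> b2 * min ((norm (K u))\<^sup>2) R" "b2 * min ((norm (K u))\<^sup>2) R \<le> b2 * R" using b2 R by auto
    then have "\<bar>b2 * min ((norm (K u))\<^sup>2) R - b1\<bar> \<le> b2 * R + \<bar>b1\<bar>" by linarith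
    then have 2: "\<bar>(b2 * min ((norm (K u))\<^sup>2) R - b1) * (K u \<bullet> K \<eta>)\<bar> \<le> (b2 * R + \<bar>b1\<bar>) * (AK * norm \<eta>)"
      unfolding abs_mult using AK(2)[rule_format, OF uz(1)] b2 R by (intro mult_mono) auto
    have "\<bar>force R u z \<eta>\<bar> \<le> D * (A0 * norm \<eta>) + (b2 * R + \<bar>b1\<bar>) * (AK * norm \<eta>)
        + norm \<eta> * A3 + A1 * norm \<eta> + A2 * norm \<eta>"
      unfolding force_def using 1 2 A3(2)[of \<eta>] A1(2)[rule_format, OF uz(2), of \<eta>] A2(2)[rule_format, OF uz(1), of \<eta>] by linarith
    also have "\<dots> = A * norm \<eta>" by (simp add: A_def algebra_simps)
    finally show ?thesis .
  qed
  ultimately show ?thesis by blast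
qed

lemma force_lipschitz:
  assumes R: "R \<ge> 0"
  shows "\<exists>L. L-lipschitz_on UNIV (\<lambda>x. force R (fst x) (snd x) \<eta>)"
proof -
  \<comment> \<open>The only nonlinearity is the truncated cubic map applied to \<open>K u\<close>;
    everything else is linear in the pair or constant.\<close>
  define N :: "'a \<Rightarrow> 'a" where "N w = min ((norm w)\<^sup>2) R *\<^sub>R w" for w
  have e: "force R (fst x) (snd x) \<eta> =
     (- D * (fst x \<bullet> \<eta>) + b1 * (K (fst x) \<bullet> K \<eta>) + B1 (snd x) (P \<eta>) + B2 (fst x) (P \<eta>))
     + ((- b2) * (N (K (fst x)) \<bullet> K \<eta>) + p (P \<eta>))" for x
    unfolding force_def N_def by (simp add: algebra_simps)
  have N: "\<exists>L. L-lipschitz_on UNIV N"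
    using truncated_cubic_lipschitz[OF R] R
    by (intro exI[of _ "3 * R"] lipschitz_onI) (auto simp: N_def dist_norm)
  have Kf: "bounded_linear (\<lambda>x::'a \<times> 'a. K (fst x))" by (rule bounded_linear_compose[OF K bounded_linear_fst])
  have "bounded_linear (\<lambda>x. - D * (fst x \<bullet> \<eta>) + b1 * (K (fst x) \<bullet> K \<eta>) + B1 (snd x) (P \<eta>) + B2 (fst x) (P \<eta>))"
    by (intro bounded_linear_add bounded_linear_const_mult
        bounded_linear_compose[OF bounded_linear_inner_left bounded_linear_fst]
        bounded_linear_compose[OF bounded_linear_inner_left Kf]
        bounded_linear_compose[OF bounded_bilinear.bounded_linear_left[OF B1] bounded_linear_snd]
        bounded_linear_compose[OF bounded_bilinear.bounded_linear_left[OF B2] bounded_linear_fst])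
  then have 1: "\<exists>L. L-lipschitz_on UNIV (\<lambda>x. - D * (fst x \<bullet> \<eta>) + b1 * (K (fst x) \<bullet> K \<eta>) + B1 (snd x) (P \<eta>) + B2 (fst x) (P \<eta>))"
    by (rule bounded_linear_lipschitz_ex)
  have "\<exists>L. L-lipschitz_on UNIV (\<lambda>x::'a \<times> 'a. N (K (fst x)))"
    by (rule lipschitz_ex_compose[where f = N, OF N bounded_linear_lipschitz_ex[OF Kf]])
  then have "\<exists>L. L-lipschitz_on UNIV (\<lambda>x::'a \<times> 'a. (- b2) * (N (K (fst x)) \<bullet> K \<eta>))"
    by (rule lipschitz_ex_compose[where f = "\<lambda>w. (- b2) * (w \<bullet> K \<eta>)", rotated])
       (rule bounded_linear_lipschitz_ex, rule bounded_linear_const_mult, rule bounded_linear_inner_left)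
  then have 2: "\<exists>L. L-lipschitz_on UNIV (\<lambda>x::'a \<times> 'a. (- b2) * (N (K (fst x)) \<bullet> K \<eta>) + p (P \<eta>))"
    by (rule lipschitz_ex_add) (auto intro: lipschitz_on_constant)
  show ?thesis unfolding e by (rule lipschitz_ex_add[OF 1 2])
qed

text \<open>The two sums are transposes of each other: pairing \<open>z\<close> with its derivative
  gives the force tested with the derivative of \<open>u\<close>, which is the energy identity. For
  orthonormal \<open>P (\<eta> j)\<close>, applying \<open>P\<close> to the derivative of
  \<open>u\<close> gives the projection of \<open>z\<close> onto their span.\<close>

lemma galerkin_solution:
  assumes R: "R \<ge> 0" and T: "T \<ge> 0"
  shows "\<exists>u z. u 0 = u0 \<and> z 0 = z0 \<and> (\<forall>t\<in>{0..T}.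
     (u has_vector_derivative (\<Sum>j<n. m (z t) (P (\<eta> j)) *\<^sub>R \<eta> j)) (at t within {0..T}) \<and>
     (z has_vector_derivative (\<Sum>j<n. force R (u t) (z t) (\<eta> j) *\<^sub>R P (\<eta> j))) (at t within {0..T}))"
proof -
  define F where "F x = ((\<Sum>j<n. m (snd x) (P (\<eta> j)) *\<^sub>R \<eta> j), (\<Sum>j<n. force R (fst x) (snd x) (\<eta> j) *\<^sub>R P (\<eta> j)))" for x
  have "\<exists>L. L-lipschitz_on UNIV (\<lambda>x::'a\<times>'a. (\<Sum>j<n. m (snd x) (P (\<eta> j)) *\<^sub>R \<eta> j))"
    by (intro bounded_linear_lipschitz_ex bounded_linear_sum bounded_linear_scaleR_left[THEN bounded_linear_compose]
        bounded_linear_compose[OF bounded_linear_left bounded_linear_snd])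
  moreover have "\<exists>L. L-lipschitz_on UNIV (\<lambda>x. (\<Sum>j<n. force R (fst x) (snd x) (\<eta> j) *\<^sub>R P (\<eta> j)))"
    by (intro lipschitz_ex_sum lipschitz_ex_compose[OF bounded_linear_lipschitz_ex[OF bounded_linear_scaleR_left] force_lipschitz[OF R]])
  ultimately have "\<exists>L. L-lipschitz_on UNIV F"
    unfolding F_def using lipschitz_on_Pair by blast
  then obtain L where "L-lipschitz_on UNIV F" by blast
  then have "norm (F x - F y) \<le> L * norm (x - y)" for x y
    using lipschitz_onD by (fastforce simp: dist_norm)
  from picard_lindelof[of F, OF this T, of "(u0, z0)"] obtain x where
    x: "x 0 = (u0, z0)" "\<And>t. t \<in> {0..T} \<Longrightarrow> (x has_vector_derivative F (x t)) (at t within {0..T})"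
    by blast
  have "((\<lambda>t. fst (x t)) has_vector_derivative fst (F (x t))) (at t within {0..T})"
       "((\<lambda>t. snd (x t)) has_vector_derivative snd (F (x t))) (at t within {0..T})" if "t \<in> {0..T}" for t
    using x(2)[OF that] bounded_linear.has_vector_derivative bounded_linear_fst bounded_linear_snd by blast+
  then show ?thesis
    using x(1) by (intro exI[of _ "\<lambda>t. fst (x t)"] exI[of _ "\<lambda>t. snd (x t)"]) (auto simp: F_def)
qed

end

context beam_equation
begin

text \<open>\<open>C\<close> is quantified before \<open>R\<close>, so that the truncation level can
  be chosen from the bound afterwards. The function \<open>E\<close> below is the kinetic and
  elastic energy of the truncated problem, shifted by \<open>N\<close>.\<close>

lemma energy_bound:
  assumes T: "T \<ge> 0"
  shows "\<exists>C. \<forall>R u u' z z'. R \<ge> \<bar>b1\<bar> / b2 \<longrightarrow>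
    (\<forall>t\<in>{0..T}. (u has_vector_derivative u' t) (at t within {0..T}) \<and>
       (z has_vector_derivative z' t) (at t within {0..T}) \<and>
       P (u' t) = z t \<and> m (z t) (z' t) = force R (u t) (z t) (u' t)) \<longrightarrow>
    norm (u 0) \<le> M0 \<longrightarrow> norm (z 0) \<le> M0 \<longrightarrow> (\<forall>t\<in>{0..T}. norm (u t) \<le> C \<and> norm (z t) \<le> C)"
proof -
  obtain kK where kK: "kK \<ge> 0" "\<And>x. norm (K x) \<le> norm x * kK"
    using bounded_linear.nonneg_bounded[OF K] by auto
  obtain kp where kp: "kp \<ge> 0" "\<And>x. norm (p x) \<le> norm x * kp"
    using bounded_linear.nonneg_bounded[OF p] by auto
  obtain k1 where k1: "k1 \<ge> 0" "\<And>x y. norm (B1 x y) \<le> norm x * norm y * k1"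
    using bounded_bilinear.nonneg_bounded[OF B1] by auto
  obtain k2 where k2: "k2 \<ge> 0" "\<And>x y. norm (B2 x y) \<le> norm x * norm y * k2"
    using bounded_bilinear.nonneg_bounded[OF B2] by auto
  obtain km where km: "km \<ge> 0" "\<And>x y. norm (m x y) \<le> norm x * norm y * km"
    using nonneg_bounded by auto
  \<comment> \<open>The quotient lifts the potential above 0; the extra 1 reappears in
    \<open>lower\<close> and absorbs the load, whose power is only linear in the norm of
    \<open>z\<close>.\<close>
  define N where "N = b1\<^sup>2 / (4 * b2) + 1"
  define \<delta> where "\<delta> = min (\<kappa> / 2) (min (D / 2) 1)"
  have \<delta>: "\<delta> > 0" "\<delta> \<le> \<kappa> / 2" "\<delta> \<le> D / 2" "\<delta> \<le> 1" using \<kappa> D by (auto simp: \<delta>_def)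
  define A where "A = kp + k1 + k2"
  have A: "A \<ge> 0" using kp k1 k2 by (simp add: A_def)
  \<comment> \<open>Each summand bounds one part of \<open>E 0\<close>. The quartic one is free of
    \<open>R\<close> because \<open>trunc_primitive\<close> lies below
    \<open>s\<^sup>2 / 2\<close>.\<close>
  define M1 where "M1 = km * M0\<^sup>2 / 2 + D / 2 * M0\<^sup>2 + b2 / 2 * (((kK * M0)\<^sup>2)\<^sup>2 / 2) + \<bar>b1\<bar> / 2 * (kK * M0)\<^sup>2 + N"
  define C where "C = sqrt (M1 * exp (A / \<delta> * T) / \<delta>)"
  have "norm (u t) \<le> C \<and> norm (z t) \<le> C"
    if R: "R \<ge> \<bar>b1\<bar> / b2" and u: "\<And>t. t \<in> {0..T} \<Longrightarrow> (u has_vector_derivative u' t) (at t within {0..T})"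
      and z: "\<And>t. t \<in> {0..T} \<Longrightarrow> (z has_vector_derivative z' t) (at t within {0..T})"
      and Pu: "\<And>t. t \<in> {0..T} \<Longrightarrow> P (u' t) = z t"
      and mz: "\<And>t. t \<in> {0..T} \<Longrightarrow> m (z t) (z' t) = force R (u t) (z t) (u' t)"
      and i: "norm (u 0) \<le> M0" "norm (z 0) \<le> M0" and t: "t \<in> {0..T}" for R u u' z z' t
  proof -
    define s where "s t = K (u t) \<bullet> K (u t)" for t
    define E where "E t = m (z t) (z t) / 2 + D / 2 * (u t \<bullet> u t)
        + (b2 / 2 * trunc_primitive R (s t) - b1 / 2 * s t) + N" for t
    define E' where "E' t = p (z t) + B1 (z t) (z t) + B2 (u t) (z t)" for t
    have dE: "(E has_real_derivative E' t) (at t within {0..T})" if t: "t \<in> {0..T}" for t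
    proof -
      have 1: "((\<lambda>t. m (z t) (z t)) has_real_derivative (m (z t) (z' t) + m (z' t) (z t))) (at t within {0..T})"
        unfolding has_real_derivative_iff_has_vector_derivative
        by (rule has_vector_derivative[OF z[OF t] z[OF t]])
      have 2: "((\<lambda>t. u t \<bullet> u t) has_real_derivative (u t \<bullet> u' t + u' t \<bullet> u t)) (at t within {0..T})"
        unfolding has_real_derivative_iff_has_vector_derivative
        by (rule ip.has_vector_derivative[OF u[OF t] u[OF t]])
      have Ku: "((\<lambda>t. K (u t)) has_vector_derivative K (u' t)) (at t within {0..T})"
        by (rule bounded_linear.has_vector_derivative[OF K u[OF t]])
      have 3: "(s has_real_derivative (K (u t) \<bullet> K (u' t) + K (u' t) \<bullet> K (u t))) (at t within {0..T})"
        unfolding has_real_derivative_iff_has_vector_derivative s_def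
        by (rule ip.has_vector_derivative[OF Ku Ku])
      have 4: "((\<lambda>t. trunc_primitive R (s t)) has_real_derivative min (s t) R * (K (u t) \<bullet> K (u' t) + K (u' t) \<bullet> K (u t))) (at t within {0..T})"
        by (rule DERIV_chain2[OF trunc_primitive_has_derivative 3])
      have "(E has_real_derivative ((m (z t) (z' t) + m (z' t) (z t)) / 2 + D / 2 * (u t \<bullet> u' t + u' t \<bullet> u t)
         + (b2 / 2 * (min (s t) R * (K (u t) \<bullet> K (u' t) + K (u' t) \<bullet> K (u t))) - b1 / 2 * (K (u t) \<bullet> K (u' t) + K (u' t) \<bullet> K (u t))) + 0)) (at t within {0..T})"
        unfolding E_def by (intro DERIV_add DERIV_diff DERIV_cmult DERIV_cdivide DERIV_const 1 2 3 4)
      moreover have "(m (z t) (z' t) + m (z' t) (z t)) / 2 + D / 2 * (u t \<bullet> u' t + u' t \<bullet> u t)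
         + (b2 / 2 * (min (s t) R * (K (u t) \<bullet> K (u' t) + K (u' t) \<bullet> K (u t))) - b1 / 2 * (K (u t) \<bullet> K (u' t) + K (u' t) \<bullet> K (u t))) + 0 = E' t"
      proof -
        \<comment> \<open>The two stiffness terms of the force, tested with \<open>u'\<close>,
          cancel against the derivative of the elastic energy; by \<open>Pu\<close> only the power
          of the lower order terms remains.\<close>
        have "m (z t) (z' t) + D * (u t \<bullet> u' t) + (b2 * min (s t) R - b1) * (K (u t) \<bullet> K (u' t)) = E' t"
          unfolding mz[OF t] force_def E'_def Pu[OF t] s_def power2_norm_eq_inner by simp
        then show ?thesis
          by (simp add: sym[of "z' t"] inner_commute[of "u' t"] inner_commute[of "K (u' t)"] algebra_simps)
      qed
      ultimately show ?thesis by simp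
    qed
    have lower: "\<delta> * (1 + (norm (u t))\<^sup>2 + (norm (z t))\<^sup>2) \<le> E t" for t
    proof -
      have "- (b1\<^sup>2 / (4 * b2)) \<le> b2 / 2 * trunc_primitive R (s t) - b1 / 2 * s t"
        by (rule trunc_potential_lower[OF _ b2 R]) (simp add: s_def)
      moreover have "\<delta> * (norm (z t))\<^sup>2 \<le> m (z t) (z t) / 2"
        using coercive[of "z t"] mult_right_mono[OF \<delta>(2), of "(norm (z t))\<^sup>2"] by simp
      moreover have "\<delta> * (norm (u t))\<^sup>2 \<le> D / 2 * (u t \<bullet> u t)"
        using mult_right_mono[OF \<delta>(3), of "(norm (u t))\<^sup>2"] by (simp add: power2_norm_eq_inner)
      ultimately show ?thesis unfolding E_def N_def using \<delta>(4) by (simp add: algebra_simps)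
    qed
    have power: "E' t \<le> A / \<delta> * E t" for t
    proof -
      define a b where "a = norm (u t)" and "b = norm (z t)"
      have ab: "a \<ge> 0" "b \<ge> 0" by (auto simp: a_def b_def)
      have "E' t \<le> b * kp + b * b * k1 + a * b * k2"
        using kp(2)[of "z t"] k1(2)[of "z t" "z t"] k2(2)[of "u t" "z t"]
        unfolding E'_def a_def b_def by simp
      also have "\<dots> \<le> (1 + a\<^sup>2 + b\<^sup>2) * kp + (1 + a\<^sup>2 + b\<^sup>2) * k1 + (1 + a\<^sup>2 + b\<^sup>2) * k2"
      proof (intro add_mono mult_right_mono kp k1 k2)
        have "0 \<le> (b - 1)\<^sup>2 + b\<^sup>2 + 2 * a\<^sup>2 + 1" by simp
        then show "b \<le> 1 + a\<^sup>2 + b\<^sup>2" by (simp add: power2_eq_square algebra_simps)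
        show "b * b \<le> 1 + a\<^sup>2 + b\<^sup>2" by (simp add: power2_eq_square)
        have "0 \<le> (a - b)\<^sup>2 + a\<^sup>2 + b\<^sup>2 + 2" by simp
        then show "a * b \<le> 1 + a\<^sup>2 + b\<^sup>2" by (simp add: power2_eq_square algebra_simps)
      qed
      also have "\<dots> = A / \<delta> * (\<delta> * (1 + a\<^sup>2 + b\<^sup>2))" using \<delta> by (simp add: A_def field_simps)
      also have "\<dots> \<le> A / \<delta> * E t" using lower[of t] A \<delta> unfolding a_def b_def by (intro mult_left_mono) auto
      finally show ?thesis .
    qed
    have E0: "E 0 \<le> M1"
    proof -
      have M0: "M0 \<ge> 0" using i(1) norm_ge_zero order_trans by blast
      have "norm (z 0) * norm (z 0) * km \<le> M0 * M0 * km" using i km M0 by (intro mult_mono) auto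
      then have 1: "m (z 0) (z 0) / 2 \<le> km * M0\<^sup>2 / 2"
        using km(2)[of "z 0" "z 0"] by (simp add: power2_eq_square ac_simps)
      have 2: "D / 2 * (u 0 \<bullet> u 0) \<le> D / 2 * M0\<^sup>2"
        using power_mono[OF i(1), of 2] D by (simp add: power2_norm_eq_inner)
      have "norm (K (u 0)) \<le> kK * M0" using kK(2)[of "u 0"] mult_right_mono[OF i(1) kK(1)] by (simp add: ac_simps)
      then have s0: "0 \<le> s 0" "s 0 \<le> (kK * M0)\<^sup>2"
        unfolding s_def power2_norm_eq_inner[symmetric] by (auto intro!: power_mono)
      have 3: "b2 / 2 * trunc_primitive R (s 0) \<le> b2 / 2 * (((kK * M0)\<^sup>2)\<^sup>2 / 2)"
        using trunc_primitive_le[of R "s 0"] power_mono[OF s0(2,1), of 2] b2 by (intro mult_left_mono) auto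
      have "\<bar>b1 / 2 * s 0\<bar> \<le> \<bar>b1\<bar> / 2 * (kK * M0)\<^sup>2"
        using s0 by (simp add: abs_mult mult_left_mono)
      then have 4: "- (b1 / 2 * s 0) \<le> \<bar>b1\<bar> / 2 * (kK * M0)\<^sup>2" by linarith
      show ?thesis unfolding E_def M1_def using 1 2 3 4 by linarith
    qed
    have "E t \<le> E 0 * exp (A / \<delta> * t)"
      by (rule gronwall[OF dE _ t]) (use power in auto)
    also have "\<dots> \<le> M1 * exp (A / \<delta> * T)"
    proof (rule mult_mono)
      have "0 \<le> \<delta> * (1 + (norm (u 0))\<^sup>2 + (norm (z 0))\<^sup>2)" using \<delta> by auto
      then show "0 \<le> M1" using lower[of 0] E0 by linarith
      show "exp (A / \<delta> * t) \<le> exp (A / \<delta> * T)" using t A \<delta> by (auto intro!: divide_right_mono mult_left_mono)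
    qed (use E0 in auto)
    finally have "\<delta> * (1 + (norm (u t))\<^sup>2 + (norm (z t))\<^sup>2) \<le> M1 * exp (A / \<delta> * T)" using lower[of t] by linarith
    then have "1 + (norm (u t))\<^sup>2 + (norm (z t))\<^sup>2 \<le> M1 * exp (A / \<delta> * T) / \<delta>"
      using \<delta>(1) by (simp add: pos_le_divide_eq mult.commute)
    then have "(norm (u t))\<^sup>2 \<le> M1 * exp (A / \<delta> * T) / \<delta>" "(norm (z t))\<^sup>2 \<le> M1 * exp (A / \<delta> * T) / \<delta>"
      using zero_le_power2[of "norm (u t)"] zero_le_power2[of "norm (z t)"] by linarith+
    then show ?thesis unfolding C_def by (auto intro: real_le_rsqrt)
  qed
  then show ?thesis by (intro exI[of _ C]) blast
qed

text \<open>The derivative and the initial value of \<open>z\<close> lie in the span, on which the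
  projection is the identity; so \<open>z\<close> minus its projection is constant and starts at
  0.\<close>

lemma projection_invariant:
  assumes f: "orthonormal f"
    and z: "\<And>t. t \<in> {0..T} \<Longrightarrow> (z has_vector_derivative (\<Sum>j<n. a j t *\<^sub>R f j)) (at t within {0..T})"
    and z0: "z 0 = (\<Sum>j<n. c j *\<^sub>R f j)" and t: "t \<in> {0..T}"
  shows "(\<Sum>j<n. m (z t) (f j) *\<^sub>R f j) = z t"
proof -
  define pr where "pr x = (\<Sum>j<n. m x (f j) *\<^sub>R f j)" for x
  have blp: "bounded_linear pr"
    unfolding pr_def
    by (intro bounded_linear_sum bounded_linear_scaleR_left[THEN bounded_linear_compose] bounded_linear_left)
  interpret pr: bounded_linear pr by (rule blp)
  have pf: "pr (f i) = f i" if "i < n" for i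
  proof -
    have "pr (f i) = (\<Sum>j<n. if j = i then f i else 0)"
      unfolding pr_def
    proof (intro sum.cong refl)
      fix j show "m (f i) (f j) *\<^sub>R f j = (if j = i then f i else 0)"
        using f unfolding orthonormal_def by (cases "i = j"; cases "f i = 0") (auto simp: zero_left)
    qed
    then show ?thesis using that by simp
  qed
  have ps: "pr (\<Sum>j<n. d j *\<^sub>R f j) = (\<Sum>j<n. d j *\<^sub>R f j)" for d
    by (simp add: pr.sum pr.scaleR pf)
  have "((\<lambda>t. z t - pr (z t)) has_vector_derivative 0) (at t within {0..T})" if "t \<in> {0..T}" for t
    using has_vector_derivative_diff[OF z[OF that] pr.has_vector_derivative[OF z[OF that]]] by (simp add: ps)
  then obtain c' where c': "\<And>t. t \<in> {0..T} \<Longrightarrow> z t - pr (z t) = c'"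
    using has_vector_derivative_zero_constant[of "{0..T}" "\<lambda>t. z t - pr (z t)"] by auto
  have "c' = 0" using c'[of 0] t by (simp add: z0 ps)
  then show ?thesis using c'[OF t] unfolding pr_def by simp
qed

text \<open>What the limit passage needs of one Galerkin solution. Only \<open>P u\<close> is
  differentiated, as no bound on \<open>u'\<close> is uniform in \<open>n\<close>. For
  \<open>j \<ge> n\<close> the coefficient of \<open>z\<close> is constant, so one formula serves
  for all \<open>j\<close>.\<close>

definition galerkin_approximation ::
  "(nat \<Rightarrow> 'a) \<Rightarrow> real \<Rightarrow> real \<Rightarrow> real \<Rightarrow> 'a \<Rightarrow> 'a \<Rightarrow> nat \<Rightarrow> (real \<Rightarrow> 'a) \<Rightarrow> (real \<Rightarrow> 'a) \<Rightarrow> bool" where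
  "galerkin_approximation \<eta> T R C u0 z0 n u z \<longleftrightarrow>
     u 0 = u0 \<and> z 0 = (\<Sum>j<n. m z0 (P (\<eta> j)) *\<^sub>R P (\<eta> j)) \<and>
     (\<forall>t\<in>{0..T}. norm (u t) \<le> C \<and> norm (z t) \<le> C \<and> (norm (K (u t)))\<^sup>2 \<le> R \<and>
        ((\<lambda>t. P (u t)) has_vector_derivative z t) (at t within {0..T}) \<and>
        (\<forall>j. ((\<lambda>t. m (z t) (P (\<eta> j))) has_real_derivative
           (if j < n then force R (u t) (z t) (\<eta> j) else 0)) (at t within {0..T})))"

lemma galerkin_approximation_exists:
  assumes T: "T \<ge> 0" and f: "orthonormal (\<lambda>j. P (\<eta> j))"
  shows "\<exists>C R. R \<ge> 0 \<and> (\<forall>n. \<exists>u z. galerkin_approximation \<eta> T R C u0 z0 n u z)"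
proof -
  obtain kK where kK: "kK \<ge> 0" "\<And>x. norm (K x) \<le> norm x * kK"
    using bounded_linear.nonneg_bounded[OF K] by auto
  define iz where "iz n = (\<Sum>j<n. m z0 (P (\<eta> j)) *\<^sub>R P (\<eta> j))" for n
  \<comment> \<open>Bessel's inequality bounds the form on every truncated initial velocity by
    \<open>m z0 z0\<close>; coercivity turns this into a norm bound independent of
    \<open>n\<close>.\<close>
  define M0 where "M0 = max (norm u0) (sqrt (m z0 z0 / \<kappa>))"
  have iz: "norm (iz n) \<le> M0" for n
  proof -
    have "m (iz n) (iz n) = (\<Sum>j<n. (m z0 (P (\<eta> j)))\<^sup>2)"
      unfolding iz_def using m_sum_sum[OF f, where I = "{..<n}" and a = "\<lambda>j. m z0 (P (\<eta> j))" and c = "\<lambda>j. m z0 (P (\<eta> j))"]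
      by (simp add: zero_right power2_eq_square)
    then have "m (iz n) (iz n) \<le> m z0 z0" using bessel[OF f] by metis
    then have "sqrt (m (iz n) (iz n) / \<kappa>) \<le> sqrt (m z0 z0 / \<kappa>)" using \<kappa> by (simp add: divide_right_mono)
    then show ?thesis using norm_le[of "iz n"] unfolding M0_def by (meson max.coboundedI2 order_trans)
  qed
  obtain C where C: "\<And>R u u' z z'. R \<ge> \<bar>b1\<bar> / b2 \<Longrightarrow>
    (\<forall>t\<in>{0..T}. (u has_vector_derivative u' t) (at t within {0..T}) \<and>
       (z has_vector_derivative z' t) (at t within {0..T}) \<and>
       P (u' t) = z t \<and> m (z t) (z' t) = force R (u t) (z t) (u' t)) \<Longrightarrow>
    norm (u 0) \<le> M0 \<Longrightarrow> norm (z 0) \<le> M0 \<Longrightarrow> (\<forall>t\<in>{0..T}. norm (u t) \<le> C \<and> norm (z t) \<le> C)"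
    using energy_bound[OF T, of M0] by metis
  \<comment> \<open>The first entry is the threshold of the potential bound; the second dominates
    every value of \<open>(norm (K u))\<^sup>2\<close> that the energy bound admits.\<close>
  define R where "R = max (\<bar>b1\<bar> / b2) ((C * kK)\<^sup>2)"
  have R: "R \<ge> \<bar>b1\<bar> / b2" "R \<ge> 0" "R \<ge> (C * kK)\<^sup>2" by (auto simp: R_def le_max_iff_disj)
  have "\<exists>u z. galerkin_approximation \<eta> T R C u0 z0 n u z" for n
  proof -
    obtain u z where uz: "u 0 = u0" "z 0 = iz n"
      and du: "\<And>t. t\<in>{0..T} \<Longrightarrow> (u has_vector_derivative (\<Sum>j<n. m (z t) (P (\<eta> j)) *\<^sub>R \<eta> j)) (at t within {0..T})"
      and dz: "\<And>t. t\<in>{0..T} \<Longrightarrow> (z has_vector_derivative (\<Sum>j<n. force R (u t) (z t) (\<eta> j) *\<^sub>R P (\<eta> j))) (at t within {0..T})"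
      using galerkin_solution[OF R(2) T, where n = n and ?u0.0 = u0 and ?z0.0 = "iz n" and \<eta> = \<eta>] by blast
    define u' where "u' t = (\<Sum>j<n. m (z t) (P (\<eta> j)) *\<^sub>R \<eta> j)" for t
    define z' where "z' t = (\<Sum>j<n. force R (u t) (z t) (\<eta> j) *\<^sub>R P (\<eta> j))" for t
    have Pu: "P (u' t) = z t" if "t \<in> {0..T}" for t
    proof -
      have "P (u' t) = (\<Sum>j<n. m (z t) (P (\<eta> j)) *\<^sub>R P (\<eta> j))"
        unfolding u'_def by (simp add: linear_sum[OF bounded_linear.linear[OF P]] linear_scale[OF bounded_linear.linear[OF P]])
      also have "\<dots> = z t"
        by (rule projection_invariant[OF f dz uz(2)[unfolded iz_def] that])
      finally show ?thesis .
    qed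
    have mz: "m (z t) (z' t) = force R (u t) (z t) (u' t)" for t
      unfolding z'_def u'_def
      by (simp add: sum_right scaleR_right linear_sum[OF bounded_linear.linear[OF bounded_linear_force]]
          linear_scale[OF bounded_linear.linear[OF bounded_linear_force]] mult.commute)
    have bd: "norm (u t) \<le> C \<and> norm (z t) \<le> C" if "t \<in> {0..T}" for t
      using C[OF R(1), of u u' z z'] du dz Pu mz that uz iz[of n] by (auto simp: u'_def z'_def M0_def)
    have Kb: "(norm (K (u t)))\<^sup>2 \<le> R" if "t \<in> {0..T}" for t
    proof -
      have "norm (K (u t)) \<le> C * kK" using kK(2)[of "u t"] bd[OF that] mult_right_mono[OF _ kK(1), of "norm (u t)" C] by linarith
      then have "(norm (K (u t)))\<^sup>2 \<le> (C * kK)\<^sup>2" by (intro power_mono) auto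
      then show ?thesis using R(3) by linarith
    qed
    have dPu: "((\<lambda>t. P (u t)) has_vector_derivative z t) (at t within {0..T})" if "t \<in> {0..T}" for t
      using bounded_linear.has_vector_derivative[OF P du[OF that]] Pu[OF that] by (simp add: u'_def)
    have dmz: "((\<lambda>t. m (z t) (P (\<eta> j))) has_real_derivative (if j < n then force R (u t) (z t) (\<eta> j) else 0)) (at t within {0..T})"
      if t: "t \<in> {0..T}" for t j
    proof -
      \<comment> \<open>\<open>m_sum_single\<close> asks for zero coefficients at zero vectors:
        injectivity of \<open>P\<close> forces \<open>\<eta> i = 0\<close> there, and the force is
        linear in the test vector.\<close>
      have \<eta>0: "\<eta> i = 0" if "P (\<eta> i) = 0" for i using P_inj that by simp
      have fz: "force R (u t) (z t) 0 = 0"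
        using linear_0[OF bounded_linear.linear[OF bounded_linear_force]] .
      have "m (z' t) (P (\<eta> j)) = (if j < n then force R (u t) (z t) (\<eta> j) else 0)"
        unfolding z'_def
        by (subst m_sum_single[OF f, where a = "\<lambda>j. force R (u t) (z t) (\<eta> j)"]) (auto dest!: \<eta>0 simp: fz)
      then show ?thesis
        unfolding has_real_derivative_iff_has_vector_derivative
        using bounded_linear.has_vector_derivative[OF bounded_linear_left dz[OF t], of "P (\<eta> j)"] by (simp add: z'_def)
    qed
    have "galerkin_approximation \<eta> T R C u0 z0 n u z"
      unfolding galerkin_approximation_def using bd Kb dPu dmz uz unfolding iz_def by simp
    then show ?thesis by blast
  qed
  then show ?thesis using R(2) by blast
qed

end

section \<open>Passage to the limit\<close>

lemma lipschitz_from_derivative_bound: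
  fixes h :: "real \<Rightarrow> real"
  assumes "\<And>t. t \<in> {0..T} \<Longrightarrow> (h has_real_derivative h' t) (at t within {0..T})"
    and "\<And>t. t \<in> {0..T} \<Longrightarrow> \<bar>h' t\<bar> \<le> A" and "s \<in> {0..T}" "t \<in> {0..T}"
  shows "\<bar>h s - h t\<bar> \<le> A * \<bar>s - t\<bar>"
  using field_differentiable_bound[of "{0..T}" h h' A s t] assms by auto

lemma integral_form_has_derivative:
  fixes h :: "real \<Rightarrow> real"
  assumes h: "continuous_on {0..T} h" and H: "\<And>t. t \<in> {0..T} \<Longrightarrow> H t = c + integral {0..t} h"
    and t: "t \<in> {0..T}"
  shows "(H has_real_derivative h t) (at t within {0..T})"
proof -
  have "((\<lambda>t. c + integral {0..t} h) has_real_derivative h t) (at t within {0..T})"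
    using DERIV_add[OF DERIV_const integral_has_real_derivative[OF h t], of c] by simp
  then show ?thesis
    unfolding has_real_derivative_iff_has_vector_derivative
    by (rule has_vector_derivative_transform[OF t, rotated]) (use H in auto)
qed

lemma derivative_imp_integral_form:
  fixes h :: "real \<Rightarrow> real"
  assumes H: "\<And>t. t \<in> {0..T} \<Longrightarrow> (H has_real_derivative h t) (at t within {0..T})" and t: "t \<in> {0..T}"
  shows "(h has_integral (H t - H 0)) {0..t}"
proof (rule fundamental_theorem_of_calculus)
  fix s assume s: "s \<in> {0..t}"
  have "(H has_real_derivative h s) (at s within {0..t})"
    by (rule DERIV_subset[OF H]) (use s t in auto)
  then show "(H has_vector_derivative h s) (at s within {0..t})"
    by (simp add: has_real_derivative_iff_has_vector_derivative)
qed (use t in auto)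

lemma weak_limit_unique:
  fixes x y :: "'a::real_inner"
  assumes "\<And>l. bounded_linear l \<Longrightarrow> (l x :: real) = l y"
  shows "x = y"
proof -
  have "x \<bullet> (x - y) = y \<bullet> (x - y)" by (rule assms) (rule bounded_linear_inner_left)
  then have "(x - y) \<bullet> (x - y) = 0" by (simp add: inner_diff_left)
  then show ?thesis by simp
qed

text \<open>The three clauses feed the boundedness, weak continuity and strong measurability that
  the solution spaces demand; each survives a bounded linear map.\<close>

definition weak_path :: "real \<Rightarrow> real \<Rightarrow> (real \<Rightarrow> 'a::real_normed_vector) \<Rightarrow> bool" where
  "weak_path T C u \<longleftrightarrow> (\<forall>t\<in>{0..T}. norm (u t) \<le> C) \<and>
     (\<forall>l. bounded_linear l \<longrightarrow> continuous_on {0..T} (\<lambda>t. l (u t) :: real)) \<and>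
     (\<exists>s. (\<forall>n. simple_function (lebesgue_on {0<..<T}) (s n)) \<and> (\<forall>t\<in>{0<..<T}. (\<lambda>n. s n t) \<longlonglongrightarrow> u t))"

context beam_equation
begin

text \<open>The Galerkin equations pass to the limit in integrated form, by dominated convergence.
  As the limits are weakly continuous and \<open>K u\<close> is norm continuous, the integrands are
  continuous, and the identities can be differentiated again classically.\<close>

theorem solution_exists:
  assumes T: "T > 0"
  shows "\<exists>u z C. u 0 = u0 \<and> z 0 = z0 \<and> weak_path T C u \<and> weak_path T C z \<and>
    continuous_on {0..T} (\<lambda>t. K (u t)) \<and>
    (\<forall>l. bounded_linear l \<longrightarrow> (\<forall>t\<in>{0..T}. ((\<lambda>t. l (P (u t)) :: real) has_real_derivative l (z t)) (at t within {0..T}))) \<and>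
    (\<forall>\<eta>. \<forall>t\<in>{0..T}. ((\<lambda>t. m (z t) (P \<eta>)) has_real_derivative
        (- D * (u t \<bullet> \<eta>) - (b2 * (norm (K (u t)))\<^sup>2 - b1) * (K (u t) \<bullet> K \<eta>)
     + p (P \<eta>) + B1 (z t) (P \<eta>) + B2 (u t) (P \<eta>))) (at t within {0..T}))"
proof -
  have T0: "T \<ge> 0" using T by simp

  \<comment> \<open>Choice of the Galerkin vectors and of a system for the displacement\<close>
  note e0 = ip_gram_schmidt[of g, OF g_total]
  have ip_riesz: "\<exists>r. \<forall>x. l x = x \<bullet> r" if "bounded_linear l" for l :: "'a \<Rightarrow> real"
    by (rule ip.riesz[OF e0 that])
  interpret bP: bounded_linear P by (rule P)
  interpret bK: bounded_linear K by (rule K)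
  \<comment> \<open>Orthonormalising \<open>g\<close> in this pulled-back form makes the images
    under \<open>P\<close> orthonormal for \<open>m\<close>; the form is definite because
    \<open>P\<close> is injective.\<close>
  interpret mP: pos_form "\<lambda>x y. m (P x) (P y)"
  proof
    show "m (P x) (P x) > 0" if "x \<noteq> 0" for x
    proof -
      have "norm (P x) > 0" using P_inj that by auto
      then have "\<kappa> * (norm (P x))\<^sup>2 > 0" using \<kappa> by simp
      then show ?thesis using coercive[of "P x"] by linarith
    qed
  qed (auto simp: bP.add add_left bP.scaleR scaleR_left intro: sym)
  define \<eta> where "\<eta> = mP.gram_schmidt g"
  define f where "f = (\<lambda>j. P (\<eta> j))"
  have fj: "f j = P (\<eta> j)" for j by (simp add: f_def)
  have f_on: "orthonormal f"
    unfolding orthonormal_def f_def \<eta>_def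
    using mP.gram_schmidt_orthogonal mP.gram_schmidt_normed[of g] bP.zero by metis
  have g_span: "g j \<in> span (range \<eta>)" for j unfolding \<eta>_def by (rule mP.span_gram_schmidt_source)
  have f_tot: "total f"
    unfolding total_def
  proof (intro allI impI)
    fix x assume x: "\<forall>j. m x (f j) = 0"
    have sub: "subspace {y. m x (P y) = 0}"
      by (rule subspaceI) (auto simp: bP.zero bP.add bP.scaleR zero_right add_right scaleR_right)
    have "span (range \<eta>) \<subseteq> {y. m x (P y) = 0}"
      by (rule span_minimal[OF _ sub]) (use x in \<open>auto simp: f_def\<close>)
    then have xg: "m x (P (g j)) = 0" for j using g_span by blast
    \<comment> \<open>The functional vanishes on every \<open>g j\<close>, but
      \<open>g_total\<close> speaks of the inner product; the representing vector translates between
      the two.\<close>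
    obtain r where r: "\<And>y. m x (P y) = y \<bullet> r"
      using ip_riesz[OF bounded_linear_compose[OF bounded_linear_right P], of x] by auto
    have "r = 0" by (rule g_total) (use xg r inner_commute in metis)
    then show "x = 0" by (intro P_dense) (simp add: r)
  qed
  \<comment> \<open>A Lipschitz bound in time is available for \<open>P u\<close> only, hence for the pairings of \<open>u\<close> with the
    adjoint images \<open>h j\<close> of \<open>g j\<close>. These are total since \<open>P\<close> is injective.\<close>
  have "\<forall>i. \<exists>r. \<forall>x. P x \<bullet> g i = x \<bullet> r"
    using ip_riesz[OF bounded_linear_compose[OF bounded_linear_inner_left P]] by blast
  from choice[OF this] obtain h where h: "\<And>i x. P x \<bullet> g i = x \<bullet> h i" by blast
  define e where "e = ipg.gram_schmidt h"
  have h_tot: "x = 0" if "\<And>j. x \<bullet> h j = 0" for x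
    using that h P_inj[of x] g_total[of "P x"] by simp
  note e_on = ip_gram_schmidt(1)[of h, OF h_tot, folded e_def]
    and e_tot = ip_gram_schmidt(2)[of h, OF h_tot, folded e_def]
  have e1: "norm (e j) \<le> 1" for j
    using e_on unfolding ip.orthonormal_def by (metis norm_eq_1 norm_zero order_refl zero_le_one)

  \<comment> \<open>The Galerkin sequence and its uniform bounds\<close>
  obtain C R where R: "R \<ge> 0" and "\<forall>n. \<exists>u z. galerkin_approximation \<eta> T R C u0 z0 n u z"
    using galerkin_approximation_exists[OF T0 f_on[unfolded f_def]] by blast
  then obtain u z where apx: "\<And>n. galerkin_approximation \<eta> T R C u0 z0 n (u n) (z n)" by metis
  have u_init: "u n 0 = u0" and z_init: "z n 0 = (\<Sum>j<n. m z0 (f j) *\<^sub>R f j)" for n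
    using apx[of n] unfolding galerkin_approximation_def fj by blast+
  have u_bound: "norm (u n t) \<le> C" and z_bound: "norm (z n t) \<le> C" and Ku_bound: "(norm (K (u n t)))\<^sup>2 \<le> R"
    and dPu: "((\<lambda>t. P (u n t)) has_vector_derivative z n t) (at t within {0..T})"
    and dmz: "((\<lambda>t. m (z n t) (f j)) has_real_derivative
           (if j < n then force R (u n t) (z n t) (\<eta> j) else 0)) (at t within {0..T})"
    if "t \<in> {0..T}" for n t j
    using apx[of n] that unfolding galerkin_approximation_def fj by blast+
  have C: "C \<ge> 0" using order_trans[OF norm_ge_zero u_bound[of 0 0]] T0 by auto
  obtain km where km: "km \<ge> 0" "\<And>x y. \<bar>m x y\<bar> \<le> norm x * norm y * km"
    using nonneg_bounded by auto
  obtain A where A: "A \<ge> 0" "\<And>u z \<eta>. norm u \<le> C \<Longrightarrow> norm z \<le> C \<Longrightarrow> \<bar>force R u z \<eta>\<bar> \<le> A * norm \<eta>"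
    using force_bound[OF R, of C] by blast

  \<comment> \<open>Equicontinuity in time\<close>
  have lip_z: "\<bar>m (z n s) (f j) - m (z n t) (f j)\<bar> \<le> (A * norm (\<eta> j)) * \<bar>s - t\<bar>"
    if "s \<in> {0..T}" "t \<in> {0..T}" for n j s t
  proof (rule lipschitz_from_derivative_bound[OF dmz _ that])
    fix t assume "t \<in> {0..T}"
    then show "\<bar>if j < n then force R (u n t) (z n t) (\<eta> j) else 0\<bar> \<le> A * norm (\<eta> j)"
      using A(2)[of "u n t" "z n t" "\<eta> j"] A(1) u_bound z_bound by auto
  qed
  have lip_Pu: "\<exists>B. \<forall>n s t. s \<in> {0..T} \<longrightarrow> t \<in> {0..T} \<longrightarrow> \<bar>u n s \<bullet> h j - u n t \<bullet> h j\<bar> \<le> B * \<bar>s - t\<bar>" for j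
  proof (intro exI allI impI)
    fix n s t assume st: "s \<in> {0..T}" "t \<in> {0..T}"
    show "\<bar>u n s \<bullet> h j - u n t \<bullet> h j\<bar> \<le> (C * norm (g j)) * \<bar>s - t\<bar>"
    proof (rule lipschitz_from_derivative_bound[OF _ _ st])
      fix r assume r: "r \<in> {0..T}"
      show "((\<lambda>t. u n t \<bullet> h j) has_real_derivative z n r \<bullet> g j) (at r within {0..T})"
        unfolding h[symmetric] has_real_derivative_iff_has_vector_derivative
        by (rule bounded_linear.has_vector_derivative[OF bounded_linear_inner_left dPu[OF r]])
      show "\<bar>z n r \<bullet> g j\<bar> \<le> C * norm (g j)"
        using Cauchy_Schwarz_ineq2[of "z n r" "g j"] mult_right_mono[OF z_bound[OF r, of n], of "norm (g j)"] by simp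
    qed
  qed
  \<comment> \<open>The bound is known for the \<open>h j\<close>. The test vectors having it form a
    subspace, so it passes to the finite combinations \<open>e j\<close>, with a constant that
    depends on \<open>j\<close> but not on \<open>n\<close>.\<close>
  define SL where "SL = {y. \<exists>B. \<forall>n s t. s \<in> {0..T} \<longrightarrow> t \<in> {0..T} \<longrightarrow> \<bar>u n s \<bullet> y - u n t \<bullet> y\<bar> \<le> B * \<bar>s - t\<bar>}"
  have "subspace SL"
  proof (rule subspaceI)
    show "0 \<in> SL" unfolding SL_def by (auto intro!: exI[of _ 0])
    fix x y assume "x \<in> SL" "y \<in> SL"
    then obtain B B' where B: "\<And>n s t. s \<in> {0..T} \<Longrightarrow> t \<in> {0..T} \<Longrightarrow> \<bar>u n s \<bullet> x - u n t \<bullet> x\<bar> \<le> B * \<bar>s - t\<bar>"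
      and B': "\<And>n s t. s \<in> {0..T} \<Longrightarrow> t \<in> {0..T} \<Longrightarrow> \<bar>u n s \<bullet> y - u n t \<bullet> y\<bar> \<le> B' * \<bar>s - t\<bar>"
      unfolding SL_def by blast
    have "\<bar>u n s \<bullet> (x + y) - u n t \<bullet> (x + y)\<bar> \<le> (B + B') * \<bar>s - t\<bar>" if "s \<in> {0..T}" "t \<in> {0..T}" for n s t
      using B[OF that, of n] B'[OF that, of n] by (simp add: inner_add_right distrib_right)
    then show "x + y \<in> SL" unfolding SL_def by blast
  next
    fix c x assume "x \<in> SL"
    then obtain B where B: "\<And>n s t. s \<in> {0..T} \<Longrightarrow> t \<in> {0..T} \<Longrightarrow> \<bar>u n s \<bullet> x - u n t \<bullet> x\<bar> \<le> B * \<bar>s - t\<bar>"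
      unfolding SL_def by blast
    have "\<bar>u n s \<bullet> (c *\<^sub>R x) - u n t \<bullet> (c *\<^sub>R x)\<bar> \<le> (\<bar>c\<bar> * B) * \<bar>s - t\<bar>" if "s \<in> {0..T}" "t \<in> {0..T}" for n s t
      using mult_left_mono[OF B[OF that, of n], of "\<bar>c\<bar>"]
      by (simp add: abs_mult[symmetric] right_diff_distrib mult.assoc)
    then show "c *\<^sub>R x \<in> SL" unfolding SL_def by blast
  qed
  then have "span (range h) \<subseteq> SL"
    using lip_Pu unfolding SL_def by (intro span_minimal) auto
  then have "\<forall>j. \<exists>B. \<forall>n s t. s \<in> {0..T} \<longrightarrow> t \<in> {0..T} \<longrightarrow> \<bar>u n s \<bullet> e j - u n t \<bullet> e j\<bar> \<le> B * \<bar>s - t\<bar>"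
    using ipg.gram_schmidt_in_span[of h] unfolding e_def SL_def by blast
  from choice[OF this] obtain B where lip_u:
    "\<And>j n s t. s \<in> {0..T} \<Longrightarrow> t \<in> {0..T} \<Longrightarrow> \<bar>u n s \<bullet> e j - u n t \<bullet> e j\<bar> \<le> B j * \<bar>s - t\<bar>" by blast

  \<comment> \<open>Extraction of a weakly convergent subsequence\<close>
  define \<Phi> where "\<Phi> n x = (case x of (b, j, t) \<Rightarrow> if b then m (z n t) (f j) else u n t \<bullet> e j)" for n and x :: "bool \<times> nat \<times> real"
  \<comment> \<open>One countable index set for both coefficient families, told apart by the
    Boolean, at rational times: a single diagonal subsequence handles all of them.\<close>
  define Q where "Q = (UNIV :: bool set) \<times> (UNIV :: nat set) \<times> ({0..T} \<inter> \<rat>)"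
  have cQ: "countable Q" unfolding Q_def by (intro countable_SIGMA) (auto intro: countable_Int2 countable_rat)
  have bQ: "norm (\<Phi> n x) \<le> max (C * sqrt (1 / \<kappa>) * km) C" if "x \<in> Q" for n x
  proof -
    obtain b j t where x: "x = (b, j, t)" "t \<in> {0..T}" using \<open>x \<in> Q\<close> unfolding Q_def by auto
    have "m (f j) (f j) \<le> 1" using f_on unfolding orthonormal_def by (metis order_refl zero_left zero_le_one)
    then have "sqrt (m (f j) (f j) / \<kappa>) \<le> sqrt (1 / \<kappa>)" using \<kappa> by (simp add: divide_right_mono)
    then have "norm (f j) \<le> sqrt (1 / \<kappa>)" using norm_le[of "f j"] by linarith
    then have "norm (z n t) * norm (f j) * km \<le> C * sqrt (1 / \<kappa>) * km"
      using z_bound[OF x(2)] km(1) C \<kappa> by (intro mult_mono mult_nonneg_nonneg) auto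
    then have 1: "\<bar>m (z n t) (f j)\<bar> \<le> C * sqrt (1 / \<kappa>) * km" using km(2)[of "z n t" "f j"] by linarith
    have "norm (u n t) * norm (e j) \<le> C * 1" using u_bound[OF x(2)] e1 C by (intro mult_mono) auto
    then have 2: "\<bar>u n t \<bullet> e j\<bar> \<le> C" using Cauchy_Schwarz_ineq2[of "u n t" "e j"] by linarith
    show ?thesis using 1 2 unfolding \<Phi>_def x by auto
  qed
  obtain k where k: "strict_mono (k::nat\<Rightarrow>nat)" "\<And>x. x \<in> Q \<Longrightarrow> \<exists>l. (\<lambda>n. \<Phi> (k n) x) \<longlonglongrightarrow> l"
    using function_convergent_subsequence[OF cQ, of \<Phi>, OF bQ] by blast
  have conv_z: "convergent (\<lambda>n. m (z (k n) t) (f j))" if "t \<in> {0..T}" for t j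
  proof (rule equi_lipschitz_convergent[where f = "\<lambda>n t. m (z (k n) t) (f j)", OF lip_z _ T that])
    fix t assume "t \<in> {0..T} \<inter> \<rat>"
    then have "(True, j, t) \<in> Q" by (simp add: Q_def)
    from k(2)[OF this] show "convergent (\<lambda>n. m (z (k n) t) (f j))" by (simp add: \<Phi>_def convergent_def)
  qed
  have conv_u: "convergent (\<lambda>n. u (k n) t \<bullet> e j)" if "t \<in> {0..T}" for t j
  proof (rule equi_lipschitz_convergent[where f = "\<lambda>n t. u (k n) t \<bullet> e j", OF lip_u _ T that])
    fix t assume "t \<in> {0..T} \<inter> \<rat>"
    then have "(False, j, t) \<in> Q" by (simp add: Q_def)
    from k(2)[OF this] show "convergent (\<lambda>n. u (k n) t \<bullet> e j)" by (simp add: \<Phi>_def convergent_def)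
  qed
  have "\<forall>t\<in>{0..T}. \<exists>w. norm w \<le> C \<and> (\<forall>l. bounded_linear l \<longrightarrow> (\<lambda>n. l (z (k n) t) :: real) \<longlonglongrightarrow> l w)"
    using weak_limit[OF f_on f_tot z_bound conv_z] by blast
  from bchoice[OF this] obtain Z where Z: "\<And>t. t \<in> {0..T} \<Longrightarrow> norm (Z t) \<le> C"
    "\<And>t l. t \<in> {0..T} \<Longrightarrow> bounded_linear l \<Longrightarrow> (\<lambda>n. l (z (k n) t) :: real) \<longlonglongrightarrow> l (Z t)" by blast
  have "\<forall>t\<in>{0..T}. \<exists>w. norm w \<le> C \<and> (\<forall>l. bounded_linear l \<longrightarrow> (\<lambda>n. l (u (k n) t) :: real) \<longlonglongrightarrow> l w)"
    using ip.weak_limit[OF e_on e_tot u_bound conv_u] by blast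
  from bchoice[OF this] obtain W where W: "\<And>t. t \<in> {0..T} \<Longrightarrow> norm (W t) \<le> C"
    "\<And>t l. t \<in> {0..T} \<Longrightarrow> bounded_linear l \<Longrightarrow> (\<lambda>n. l (u (k n) t) :: real) \<longlonglongrightarrow> l (W t)" by blast

  \<comment> \<open>Initial values and convergence of the force\<close>
  have W0: "W 0 = u0"
  proof (rule weak_limit_unique)
    fix l :: "'a \<Rightarrow> real" assume "bounded_linear l"
    from W(2)[OF _ this, of 0] T0 show "l (W 0) = l u0" by (simp add: u_init LIMSEQ_const_iff)
  qed
  have Z0: "Z 0 = z0"
  proof (rule weak_limit_unique)
    fix l :: "'a \<Rightarrow> real" assume l: "bounded_linear l"
    have "(\<lambda>n. z n 0) \<longlonglongrightarrow> z0"
      using expansion[OF f_on f_tot, of z0] unfolding z_init sums_def .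
    from LIMSEQ_subseq_LIMSEQ[OF bounded_linear.tendsto[OF l this] k(1)]
    have "(\<lambda>n. l (z (k n) 0)) \<longlonglongrightarrow> l z0" by (simp add: o_def)
    with Z(2)[OF _ l, of 0] T0 show "l (Z 0) = l z0" using LIMSEQ_unique by auto
  qed
  have KW: "(\<lambda>n. K (u (k n) t)) \<longlonglongrightarrow> K (W t)" if "t \<in> {0..T}" for t
    by (rule K_compact[where v = "\<lambda>n. u (k n) t" and C = C]) (use u_bound[OF that] W(2)[OF that] in blast)+
  \<comment> \<open>The bound passes to the strong limit, so the truncation is inactive for the
    limit too and disappears from the final equation.\<close>
  have KWR: "(norm (K (W t)))\<^sup>2 \<le> R" if "t \<in> {0..T}" for t
    by (rule LIMSEQ_le_const2[OF tendsto_power[OF tendsto_norm[OF KW[OF that]], of 2]]) (use Ku_bound[OF that] in blast)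
  \<comment> \<open>In the cubic term the scalar factor and \<open>K u\<close> converge strongly;
    the other terms that vary are linear in \<open>u\<close> or \<open>z\<close>, where weak
    convergence suffices.\<close>
  have force_lim: "(\<lambda>n. force R (u (k n) t) (z (k n) t) y) \<longlonglongrightarrow> force R (W t) (Z t) y" if "t \<in> {0..T}" for t y
    unfolding force_def
    by (intro tendsto_add tendsto_diff tendsto_mult tendsto_const tendsto_min tendsto_power tendsto_norm
        KW[OF that] tendsto_inner W(2)[OF that bounded_linear_inner_left]
        W(2)[OF that bounded_bilinear.bounded_linear_left[OF B2]]
        Z(2)[OF that bounded_bilinear.bounded_linear_left[OF B1]])

  \<comment> \<open>Continuity of the limits in time\<close>
  have contZ: "continuous_on {0..T} (\<lambda>t. l (Z t) :: real)" if l: "bounded_linear l" for l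
  proof (rule weakly_continuous[OF f_on f_tot Z(1) _ l])
    fix j
    have "\<bar>m (Z s) (f j) - m (Z t) (f j)\<bar> \<le> (A * norm (\<eta> j)) * \<bar>s - t\<bar>" if "s \<in> {0..T}" "t \<in> {0..T}" for s t
      by (rule LIMSEQ_le_const2[OF tendsto_rabs[OF tendsto_diff[OF Z(2)[OF that(1) bounded_linear_left] Z(2)[OF that(2) bounded_linear_left]]]])
         (use lip_z[OF that] in blast)
    then have "(A * norm (\<eta> j))-lipschitz_on {0..T} (\<lambda>t. m (Z t) (f j))"
      using A(1) by (intro lipschitz_onI) (auto simp: dist_real_def)
    then show "continuous_on {0..T} (\<lambda>t. m (Z t) (f j))" by (rule lipschitz_on_continuous_on)
  qed
  have contW: "continuous_on {0..T} (\<lambda>t. l (W t) :: real)" if l: "bounded_linear l" for l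
  proof (rule ip.weakly_continuous[OF e_on e_tot W(1) _ l])
    fix j
    have "\<bar>W s \<bullet> e j - W t \<bullet> e j\<bar> \<le> \<bar>B j\<bar> * \<bar>s - t\<bar>" if "s \<in> {0..T}" "t \<in> {0..T}" for s t
    proof (rule LIMSEQ_le_const2[OF tendsto_rabs[OF tendsto_diff[OF W(2)[OF that(1) bounded_linear_inner_left] W(2)[OF that(2) bounded_linear_inner_left]]]])
      have "B j * \<bar>s - t\<bar> \<le> \<bar>B j\<bar> * \<bar>s - t\<bar>" by (rule mult_right_mono) auto
      then show "\<exists>N. \<forall>n\<ge>N. \<bar>u (k n) s \<bullet> e j - u (k n) t \<bullet> e j\<bar> \<le> \<bar>B j\<bar> * \<bar>s - t\<bar>"
        using lip_u[OF that] order_trans by blast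
    qed
    then have "\<bar>B j\<bar>-lipschitz_on {0..T} (\<lambda>t. W t \<bullet> e j)"
      by (intro lipschitz_onI) (auto simp: dist_real_def)
    then show "continuous_on {0..T} (\<lambda>t. W t \<bullet> e j)" by (rule lipschitz_on_continuous_on)
  qed
  have contKW: "continuous_on {0..T} (\<lambda>t. K (W t))"
    unfolding continuous_on_sequentially o_def
  proof (intro allI ballI impI, elim conjE)
    fix x :: "nat \<Rightarrow> real" and a assume a: "a \<in> {0..T}" and x: "\<forall>n. x n \<in> {0..T}" "x \<longlonglongrightarrow> a"
    show "(\<lambda>n. K (W (x n))) \<longlonglongrightarrow> K (W a)"
    proof (rule K_compact)
      show "norm (W (x n)) \<le> C" for n using W(1) x by blast
      show "(\<lambda>n. l (W (x n))) \<longlonglongrightarrow> l (W a)" if "bounded_linear l" for l :: "'a \<Rightarrow> real"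
        using contW[OF that] a x unfolding continuous_on_sequentially o_def by blast
    qed
  qed
  have contF: "continuous_on {0..T} (\<lambda>t. force R (W t) (Z t) y)" for y
    unfolding force_def
    by (intro continuous_intros contKW contW[OF bounded_linear_inner_left]
        contW[OF bounded_bilinear.bounded_linear_left[OF B2]]
        contZ[OF bounded_bilinear.bounded_linear_left[OF B1]])
  have intF: "(\<lambda>s. force R (W s) (Z s) y) integrable_on {0..t}" if "t \<in> {0..T}" for t y
    by (rule integrable_continuous_real, rule continuous_on_subset[OF contF]) (use that in auto)

  \<comment> \<open>The limit equations\<close>
  have eq_f: "m (Z t) (f j) = m z0 (f j) + integral {0..t} (\<lambda>s. force R (W s) (Z s) (\<eta> j))" if t: "t \<in> {0..T}" for t j
  proof -
    \<comment> \<open>The equation for coefficient \<open>j\<close> holds only in dimensions larger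
      than \<open>j\<close>; as \<open>k i \<ge> i\<close>, the shift by \<open>Suc j\<close>
      ensures this for every \<open>n\<close>.\<close>
    define q where "q n = k (n + Suc j)" for n
    have qj: "q n > j" for n using strict_mono_imp_increasing[OF k(1), of "n + Suc j"] by (simp add: q_def)
    have hi: "((\<lambda>s. force R (u (q n) s) (z (q n) s) (\<eta> j)) has_integral (m (z (q n) t) (f j) - m (z (q n) 0) (f j))) {0..t}" for n
      by (rule derivative_imp_integral_form[where T = T, OF _ t]) (use dmz[of _ "q n" j] qj in simp)
    have "(\<lambda>n. integral {0..t} (\<lambda>s. force R (u (q n) s) (z (q n) s) (\<eta> j))) \<longlonglongrightarrow> integral {0..t} (\<lambda>s. force R (W s) (Z s) (\<eta> j))"
    proof (rule dominated_convergence(2)[where h = "\<lambda>s. A * norm (\<eta> j)"])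
      show "(\<lambda>s. force R (u (q n) s) (z (q n) s) (\<eta> j)) integrable_on {0..t}" for n using hi by blast
      show "norm (force R (u (q n) s) (z (q n) s) (\<eta> j)) \<le> A * norm (\<eta> j)" if "s \<in> {0..t}" for n s
        using A(2) u_bound z_bound that t by auto
      show "(\<lambda>n. force R (u (q n) s) (z (q n) s) (\<eta> j)) \<longlonglongrightarrow> force R (W s) (Z s) (\<eta> j)" if "s \<in> {0..t}" for s
        unfolding q_def using LIMSEQ_ignore_initial_segment[OF force_lim[of s "\<eta> j"], of "Suc j"] that t by simp
    qed (auto intro: integrable_const_ivl)
    moreover have "integral {0..t} (\<lambda>s. force R (u (q n) s) (z (q n) s) (\<eta> j)) = m (z (q n) t) (f j) - m (z (q n) 0) (f j)" for n
      using hi by (rule integral_unique)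
    moreover have "(\<lambda>n. m (z (q n) t) (f j) - m (z (q n) 0) (f j)) \<longlonglongrightarrow> m (Z t) (f j) - m (Z 0) (f j)"
      unfolding q_def using t T0
      by (intro tendsto_diff LIMSEQ_ignore_initial_segment[where f = "\<lambda>n. m (z (k n) _) (f j)"] Z(2) bounded_linear_left) auto
    ultimately have "integral {0..t} (\<lambda>s. force R (W s) (Z s) (\<eta> j)) = m (Z t) (f j) - m (Z 0) (f j)"
      using LIMSEQ_unique by simp
    then show ?thesis by (simp add: Z0)
  qed
  \<comment> \<open>From the Galerkin vectors to all test vectors: the span of \<open>\<eta>\<close>
    contains \<open>g\<close>, hence the orthonormalised \<open>g\<close>, which is total, and the
    identity survives norm limits of the test vector.\<close>
  define S where "S = {y. \<forall>t\<in>{0..T}. m (Z t) (P y) = m z0 (P y) + integral {0..t} (\<lambda>s. force R (W s) (Z s) y)}"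
  have eq: "y \<in> S" for y
  proof (rule ip.total_induct[OF e0])
    show sS: "subspace S"
    proof (rule subspaceI)
      show "0 \<in> S" unfolding S_def
        by (simp add: bP.zero zero_right linear_0[OF bounded_linear.linear[OF bounded_linear_force]])
      show "x + y \<in> S" if "x \<in> S" "y \<in> S" for x y
        using that unfolding S_def
        by (auto simp: bP.add add_right linear_add[OF bounded_linear.linear[OF bounded_linear_force]] integral_add[OF intF intF])
      show "c *\<^sub>R x \<in> S" if "x \<in> S" for c x
        using that unfolding S_def
        by (auto simp: bP.scaleR scaleR_right linear_scale[OF bounded_linear.linear[OF bounded_linear_force]] distrib_left)
    qed
    show "closed S"
    proof (unfold closed_sequential_limits, intro allI impI)
      fix x y assume xy: "(\<forall>n. x n \<in> S) \<and> x \<longlonglongrightarrow> y"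
      then obtain M where M: "\<And>n. norm (x n) \<le> M"
        using convergent_imp_Bseq[of x] unfolding convergent_def Bseq_def by blast
      show "y \<in> S" unfolding S_def
      proof (intro CollectI ballI)
        fix t assume t: "t \<in> {0..T}"
        have "(\<lambda>n. integral {0..t} (\<lambda>s. force R (W s) (Z s) (x n))) \<longlonglongrightarrow> integral {0..t} (\<lambda>s. force R (W s) (Z s) y)"
        proof (rule dominated_convergence(2)[where h = "\<lambda>s. A * M"])
          show "norm (force R (W s) (Z s) (x n)) \<le> A * M" if "s \<in> {0..t}" for n s
            using order_trans[OF A(2)[of "W s" "Z s" "x n"] mult_left_mono[OF M A(1)]] W(1)[of s] Z(1)[of s] that t by auto
          show "(\<lambda>n. force R (W s) (Z s) (x n)) \<longlonglongrightarrow> force R (W s) (Z s) y" for s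
            using bounded_linear.tendsto[OF bounded_linear_force] xy by blast
        qed (auto intro: integrable_const_ivl intF[OF t])
        then have "(\<lambda>n. m z0 (P (x n)) + integral {0..t} (\<lambda>s. force R (W s) (Z s) (x n)))
            \<longlonglongrightarrow> m z0 (P y) + integral {0..t} (\<lambda>s. force R (W s) (Z s) y)"
          using xy by (intro tendsto_add tendsto tendsto_const bP.tendsto) auto
        moreover have "(\<lambda>n. m (Z t) (P (x n))) \<longlonglongrightarrow> m (Z t) (P y)"
          using xy by (intro tendsto tendsto_const bP.tendsto) auto
        moreover have "m z0 (P (x n)) + integral {0..t} (\<lambda>s. force R (W s) (Z s) (x n)) = m (Z t) (P (x n))" for n
          using xy t unfolding S_def by simp
        ultimately show "m (Z t) (P y) = m z0 (P y) + integral {0..t} (\<lambda>s. force R (W s) (Z s) y)"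
          using LIMSEQ_unique by simp
      qed
    qed
    have "\<eta> j \<in> S" for j unfolding S_def using eq_f unfolding f_def by simp
    then have "span (range \<eta>) \<subseteq> S" using sS by (intro span_minimal) auto
    then have "span (range g) \<subseteq> S" using g_span sS by (intro span_minimal) auto
    then show "ipg.gram_schmidt g j \<in> S" for j using ipg.gram_schmidt_in_span[of g j] by blast
  qed
  have eq_P: "l (P (W t)) = l (P u0) + integral {0..t} (\<lambda>s. l (Z s))" if t: "t \<in> {0..T}" and l: "bounded_linear l"
    for t and l :: "'a \<Rightarrow> real"
  proof -
    obtain kl where kl: "kl \<ge> 0" "\<And>x. norm (l x) \<le> norm x * kl" using bounded_linear.nonneg_bounded[OF l] by auto
    have hi: "((\<lambda>s. l (z (k n) s)) has_integral (l (P (u (k n) t)) - l (P (u (k n) 0)))) {0..t}" for n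
    proof (rule derivative_imp_integral_form[where T = T, OF _ t])
      show "((\<lambda>s. l (P (u (k n) s))) has_real_derivative l (z (k n) s)) (at s within {0..T})" if "s \<in> {0..T}" for s
        unfolding has_real_derivative_iff_has_vector_derivative
        by (rule bounded_linear.has_vector_derivative[OF l dPu[OF that]])
    qed
    have "(\<lambda>n. integral {0..t} (\<lambda>s. l (z (k n) s))) \<longlonglongrightarrow> integral {0..t} (\<lambda>s. l (Z s))"
    proof (rule dominated_convergence(2)[where h = "\<lambda>s. C * kl"])
      show "(\<lambda>s. l (z (k n) s)) integrable_on {0..t}" for n using hi by blast
      show "norm (l (z (k n) s)) \<le> C * kl" if "s \<in> {0..t}" for n s
        using order_trans[OF kl(2)[of "z (k n) s"] mult_right_mono[OF z_bound kl(1)]] that t by auto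
      show "(\<lambda>n. l (z (k n) s)) \<longlonglongrightarrow> l (Z s)" if "s \<in> {0..t}" for s using Z(2)[OF _ l] that t by auto
    qed (auto intro: integrable_const_ivl)
    moreover have "integral {0..t} (\<lambda>s. l (z (k n) s)) = l (P (u (k n) t)) - l (P u0)" for n
      using integral_unique[OF hi] by (simp add: u_init)
    moreover have "(\<lambda>n. l (P (u (k n) t)) - l (P u0)) \<longlonglongrightarrow> l (P (W t)) - l (P u0)"
      by (intro tendsto_diff tendsto_const W(2)[OF t bounded_linear_compose[OF l P]])
    ultimately show ?thesis using LIMSEQ_unique by fastforce
  qed
  have "((\<lambda>t. l (P (W t))) has_real_derivative l (Z t)) (at t within {0..T})" if "bounded_linear l" "t \<in> {0..T}"
    for l :: "'a \<Rightarrow> real" and t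
    by (rule integral_form_has_derivative[OF contZ[OF that(1)] eq_P[OF _ that(1)] that(2)])
  moreover have "((\<lambda>t. m (Z t) (P y)) has_real_derivative
        (- D * (W t \<bullet> y) - (b2 * (norm (K (W t)))\<^sup>2 - b1) * (K (W t) \<bullet> K y)
     + p (P y) + B1 (Z t) (P y) + B2 (W t) (P y))) (at t within {0..T})" if t: "t \<in> {0..T}" for t y
  proof -
    have "((\<lambda>t. m (Z t) (P y)) has_real_derivative force R (W t) (Z t) y) (at t within {0..T})"
      by (rule integral_form_has_derivative[OF contF _ t]) (use eq[of y] in \<open>auto simp: S_def\<close>)
    then show ?thesis unfolding force_def using KWR[OF t] by (simp add: min_absorb1)
  qed
  moreover have "weak_path T C W"
    unfolding weak_path_def
    using W(1) contW ip.weakly_continuous_simple_approximation[OF e_on e_tot contW[OF bounded_linear_inner_left]] by blast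
  moreover have "weak_path T C Z"
    unfolding weak_path_def
    using Z(1) contZ weakly_continuous_simple_approximation[OF f_on f_tot contZ[OF bounded_linear_left]] by blast
  ultimately show ?thesis
    using W0 Z0 contKW by (intro exI[of _ W] exI[of _ Z] exI[of _ C]) blast
qed

end

section \<open>Square integrable functions as a Hilbert space\<close>

lemma L2_measurable [measurable_dest]: "f \<in> L2 a b \<Longrightarrow> f \<in> borel_measurable (lebesgue_on {a<..<b})"
  by (simp add: L2_def)

lemma L2_square: "f \<in> L2 a b \<Longrightarrow> integrable (lebesgue_on {a<..<b}) (\<lambda>x. (f x)\<^sup>2)"
  by (simp add: L2_def)

lemma L2_mult:
  assumes f: "f \<in> L2 a b" and g: "g \<in> L2 a b"
  shows "integrable (lebesgue_on {a<..<b}) (\<lambda>x. f x * g x)"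
proof (rule Bochner_Integration.integrable_bound)
  show "integrable (lebesgue_on {a<..<b}) (\<lambda>x. (f x)\<^sup>2 + (g x)\<^sup>2)"
    using L2_square f g by (intro Bochner_Integration.integrable_add) auto
  show "(\<lambda>x. f x * g x) \<in> borel_measurable (lebesgue_on {a<..<b})"
    using f g L2_measurable by (intro borel_measurable_times) auto
  have "\<bar>x * y\<bar> \<le> x\<^sup>2 + y\<^sup>2" for x y :: real
  proof -
    have "0 \<le> (\<bar>x\<bar> - \<bar>y\<bar>)\<^sup>2 + x\<^sup>2 + y\<^sup>2" by simp
    then show ?thesis by (simp add: power2_eq_square algebra_simps abs_mult)
  qed
  then show "AE x in lebesgue_on {a<..<b}. norm (f x * g x) \<le> norm ((f x)\<^sup>2 + (g x)\<^sup>2)"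
    by auto
qed

lemma finite_measure_interval: "finite_measure (lebesgue_on {a<..<b::real})"
  by (rule finite_measure_lebesgue_on) simp

lemma L2_add: "f \<in> L2 a b \<Longrightarrow> g \<in> L2 a b \<Longrightarrow> (\<lambda>x. f x + g x) \<in> L2 a b"
proof -
  assume f: "f \<in> L2 a b" and g: "g \<in> L2 a b"
  have "integrable (lebesgue_on {a<..<b}) (\<lambda>x. (f x)\<^sup>2 + 2 * (f x * g x) + (g x)\<^sup>2)"
    using f g L2_square L2_mult by (intro Bochner_Integration.integrable_add integrable_mult_right) auto
  then show ?thesis
    using f g by (simp add: L2_def borel_measurable_add power2_sum algebra_simps)
qed

lemma L2_scale: "f \<in> L2 a b \<Longrightarrow> (\<lambda>x. c * f x) \<in> L2 a b"
  by (auto simp: L2_def power_mult_distrib intro!: integrable_mult_right borel_measurable_times)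

lemma L2_lincomb: "f \<in> L2 a b \<Longrightarrow> g \<in> L2 a b \<Longrightarrow> (\<lambda>x. c * f x + d * g x) \<in> L2 a b"
  by (intro L2_add L2_scale)

lemma L2_diff: "f \<in> L2 a b \<Longrightarrow> g \<in> L2 a b \<Longrightarrow> (\<lambda>x. f x - g x) \<in> L2 a b"
  using L2_lincomb[of f a b g 1 "-1"] by simp

lemma L2_uminus: "f \<in> L2 a b \<Longrightarrow> (\<lambda>x. - f x) \<in> L2 a b"
  using L2_scale[of f a b "-1"] by simp

lemma L2_bounded:
  assumes m: "f \<in> borel_measurable (lebesgue_on {a<..<b})" and B: "\<And>x. x \<in> {a<..<b} \<Longrightarrow> \<bar>f x\<bar> \<le> B"
  shows "f \<in> L2 a b"
proof -
  interpret finite_measure "lebesgue_on {a<..<b}" by (rule finite_measure_interval)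
  have "integrable (lebesgue_on {a<..<b}) (\<lambda>x. (f x)\<^sup>2)"
  proof (rule integrable_const_bound[where B = "B\<^sup>2"])
    show "AE x in lebesgue_on {a<..<b}. norm ((f x)\<^sup>2) \<le> B\<^sup>2"
    proof (rule AE_I2)
      fix x assume "x \<in> space (lebesgue_on {a<..<b})"
      then have "\<bar>f x\<bar> \<le> B" using B by simp
      then have "\<bar>f x\<bar>\<^sup>2 \<le> B\<^sup>2" by (intro power_mono) auto
      then show "norm ((f x)\<^sup>2) \<le> B\<^sup>2" by simp
    qed
  qed (use m in measurable)
  then show ?thesis using m by (simp add: L2_def)
qed

lemma L2_continuous:
  assumes "continuous_on {a..b} f"
  shows "f \<in> L2 a b"
proof -
  have "bounded (f ` {a..b})" by (intro compact_imp_bounded compact_continuous_image assms) auto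
  then obtain B where "\<forall>x\<in>{a..b}. norm (f x) \<le> B" unfolding bounded_iff by auto
  then show ?thesis
    by (intro L2_bounded[of _ _ _ B] continuous_imp_measurable_on_sets_lebesgue continuous_on_subset[OF assms]) auto
qed

lemma L2_const: "(\<lambda>x. c) \<in> L2 a b"
  by (rule L2_continuous) auto

lemma L2_integrable: "f \<in> L2 a b \<Longrightarrow> integrable (lebesgue_on {a<..<b}) f"
  using L2_mult[of f a b "\<lambda>x. 1"] L2_const by simp

lemma L2_inner_commute: "L2_inner a b f g = L2_inner a b g f"
  by (simp add: L2_inner_def mult.commute)

lemma L2_inner_add_left:
  "f \<in> L2 a b \<Longrightarrow> g \<in> L2 a b \<Longrightarrow> h \<in> L2 a b \<Longrightarrow>
    L2_inner a b (\<lambda>x. f x + g x) h = L2_inner a b f h + L2_inner a b g h"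
  by (simp add: L2_inner_def distrib_right L2_mult)

lemma L2_inner_scale_left: "L2_inner a b (\<lambda>x. c * f x) h = c * L2_inner a b f h"
  by (simp add: L2_inner_def mult.assoc)

lemma L2_inner_cong:
  assumes "f \<in> L2 a b" "f' \<in> L2 a b" "g \<in> L2 a b" "g' \<in> L2 a b"
    and "AE x in lebesgue_on {a<..<b}. f x = f' x" "AE x in lebesgue_on {a<..<b}. g x = g' x"
  shows "L2_inner a b f g = L2_inner a b f' g'"
  unfolding L2_inner_def
proof (rule integral_cong_AE)
  show "AE x in lebesgue_on {a<..<b}. f x * g x = f' x * g' x" using assms(5,6) by eventually_elim simp
qed (use assms in \<open>auto intro!: borel_measurable_times L2_measurable\<close>)

lemma L2_inner_nonneg: "L2_inner a b f f \<ge> 0"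
  by (simp add: L2_inner_def)

lemma L2_inner_eq_0_iff:
  assumes "f \<in> L2 a b"
  shows "L2_inner a b f f = 0 \<longleftrightarrow> (AE x in lebesgue_on {a<..<b}. f x = 0)"
  unfolding L2_inner_def using integral_nonneg_eq_0_iff_AE[OF L2_mult[OF assms assms]] by simp

lemma L2_norm_square: "(L2_norm a b f)\<^sup>2 = L2_inner a b f f"
  by (simp add: L2_norm_def L2_inner_nonneg)

lemma nn_integral_square:
  assumes "f \<in> L2 a b"
  shows "(\<integral>\<^sup>+x. ennreal ((f x)\<^sup>2) \<partial>lebesgue_on {a<..<b}) = ennreal ((L2_norm a b f)\<^sup>2)"
  unfolding L2_norm_square L2_inner_def power2_eq_square[symmetric]
  by (rule nn_integral_eq_integral[OF L2_square[OF assms]]) simp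

text \<open>Cauchy-Schwarz against the constant 1, obtained from the nonnegative variance of the
  absolute value of \<open>f\<close> about its mean \<open>I / (b - a)\<close>.\<close>

lemma L1_le_L2:
  assumes f: "f \<in> L2 a b" and ab: "a < b"
  shows "(LINT x|lebesgue_on {a<..<b}. \<bar>f x\<bar>) \<le> sqrt (b - a) * L2_norm a b f"
proof -
  define I where "I = (LINT x|lebesgue_on {a<..<b}. \<bar>f x\<bar>)"
  define Q where "Q = (LINT x|lebesgue_on {a<..<b}. (f x)\<^sup>2)"
  have Q: "(L2_norm a b f)\<^sup>2 = Q" unfolding L2_norm_square L2_inner_def Q_def by (simp add: power2_eq_square)
  have af: "integrable (lebesgue_on {a<..<b}) (\<lambda>x. \<bar>f x\<bar>)" using L2_integrable[OF f] by simp
  have c: "(LINT x|lebesgue_on {a<..<b}. 1) = b - a" using ab by (simp add: measure_restrict_space)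
  have q: "integrable (lebesgue_on {a<..<b}) (\<lambda>x. (f x)\<^sup>2)" by (rule L2_square[OF f])
  have i1: "integrable (lebesgue_on {a<..<b}) (\<lambda>x. 1::real)" by (rule L2_integrable[OF L2_const])
  have "0 \<le> (LINT x|lebesgue_on {a<..<b}. (\<bar>f x\<bar> - I / (b - a))\<^sup>2)" by simp
  also have "\<dots> = (LINT x|lebesgue_on {a<..<b}. (f x)\<^sup>2 - 2 * (I / (b - a)) * \<bar>f x\<bar> + (I / (b - a))\<^sup>2 * 1)"
    by (rule Bochner_Integration.integral_cong) (auto simp: power2_diff)
  also have "\<dots> = Q - 2 * (I / (b - a)) * I + (I / (b - a))\<^sup>2 * (b - a)"
    unfolding Q_def
    by (subst Bochner_Integration.integral_add, intro Bochner_Integration.integrable_diff q integrable_mult_right af,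
        intro integrable_mult_right i1, subst Bochner_Integration.integral_diff, rule q, intro integrable_mult_right af)
       (simp add: c[symmetric] I_def)
  also have "\<dots> = Q - I\<^sup>2 / (b - a)"
  proof -
    have "Q - 2 * (I / h) * I + (I / h)\<^sup>2 * h = Q - I\<^sup>2 / h" if "h > 0" for h
      using that by (simp add: power2_eq_square field_simps)
    then show ?thesis using ab by simp
  qed
  finally have "I\<^sup>2 \<le> (b - a) * Q" using ab by (simp add: field_simps)
  also have "\<dots> = (sqrt (b - a) * L2_norm a b f)\<^sup>2" using ab by (simp add: power_mult_distrib Q)
  finally show ?thesis unfolding I_def[symmetric]
    by (rule power2_le_imp_le) (use ab L2_inner_nonneg in \<open>simp add: L2_norm_def\<close>)
qed

text \<open>The L1 norms of the increments are summable, so the sequence converges almost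
  everywhere; Fatou's lemma then carries the distance bounds over to the limit.\<close>

lemma L2_complete:
  assumes f: "\<And>n. f n \<in> L2 a b" and ab: "a < b"
    and C: "\<And>m n. m \<ge> n \<Longrightarrow> L2_norm a b (\<lambda>x. f n x - f m x) \<le> \<epsilon> n"
    and \<epsilon>: "summable \<epsilon>"
  shows "\<exists>g. g \<in> L2 a b \<and> (\<forall>n. L2_norm a b (\<lambda>x. f n x - g x) \<le> \<epsilon> n)"
proof -
  let ?M = "lebesgue_on {a<..<b}"
  have \<epsilon>0: "\<epsilon> n \<ge> 0" for n
    using order_trans[OF _ C[of n n]] by (simp add: L2_norm_def L2_inner_nonneg)
  define d where "d n x = \<bar>f n x - f (Suc n) x\<bar>" for n x
  have fd: "(\<lambda>x. f n x - f k x) \<in> L2 a b" for n k using f by (intro L2_diff)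
  have dm [measurable]: "d n \<in> borel_measurable ?M" for n
    unfolding d_def using L2_measurable[OF fd] by (intro borel_measurable_abs)
  have "(\<integral>\<^sup>+x. ennreal (d n x) \<partial>?M) \<le> ennreal (sqrt (b - a) * \<epsilon> n)" for n
  proof -
    have "(\<integral>\<^sup>+x. ennreal (d n x) \<partial>?M) = ennreal (LINT x|?M. d n x)"
      unfolding d_def by (rule nn_integral_eq_integral) (use L2_integrable[OF fd] in auto)
    also have "\<dots> \<le> ennreal (sqrt (b - a) * \<epsilon> n)"
    proof (rule ennreal_leI)
      have "(LINT x|?M. d n x) \<le> sqrt (b - a) * L2_norm a b (\<lambda>x. f n x - f (Suc n) x)"
        unfolding d_def by (rule L1_le_L2[OF fd ab])
      also have "\<dots> \<le> sqrt (b - a) * \<epsilon> n" using C[of n "Suc n"] ab by (intro mult_left_mono) auto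
      finally show "(LINT x|?M. d n x) \<le> sqrt (b - a) * \<epsilon> n" .
    qed
    finally show ?thesis .
  qed
  then have "(\<integral>\<^sup>+x. (\<Sum>n. ennreal (d n x)) \<partial>?M) \<le> (\<Sum>n. ennreal (sqrt (b - a) * \<epsilon> n))"
    by (subst nn_integral_suminf) (auto intro!: suminf_le)
  also have "\<dots> < \<infinity>"
    using \<epsilon> \<epsilon>0 ab by (subst suminf_ennreal2) (auto intro!: summable_mult)
  finally have "AE x in ?M. (\<Sum>n. ennreal (d n x)) \<noteq> \<infinity>"
    by (intro nn_integral_PInf_AE) (auto simp: less_top)
  then have conv: "AE x in ?M. convergent (\<lambda>n. f n x)"
  proof eventually_elim
    case (elim x)
    have "summable (\<lambda>n. d n x)"
      by (rule summable_suminf_not_top) (use elim in \<open>auto simp: d_def\<close>)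
    then have "summable (\<lambda>n. \<bar>f (Suc n) x - f n x\<bar>)"
      unfolding d_def by (subst abs_minus_commute)
    then have "summable (\<lambda>n. f (Suc n) x - f n x)" by (rule summable_rabs_cancel)
    then have "convergent (\<lambda>n. \<Sum>i<n. f (Suc i) x - f i x)" by (simp add: summable_iff_convergent)
    then have "convergent (\<lambda>n. f n x - f 0 x)" by (simp add: sum_lessThan_telescope[of "\<lambda>i. f i x"])
    then show ?case using convergent_add[OF _ convergent_const[of "f 0 x"], of "\<lambda>n. f n x - f 0 x"] by simp
  qed
  \<comment> \<open>Where the sequence diverges, \<open>lim\<close> is an unspecified value; this
    happens on a null set, and \<open>g\<close> is measurable all the same.\<close>
  define g where "g x = lim (\<lambda>n. f n x)" for x
  have gm [measurable]: "g \<in> borel_measurable ?M"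
    unfolding g_def by (rule borel_measurable_lim_metric) (use f L2_measurable in auto)
  have fm [measurable]: "f n \<in> borel_measurable ?M" for n using f by (rule L2_measurable)
  have bound: "(\<integral>\<^sup>+x. ennreal ((f n x - g x)\<^sup>2) \<partial>?M) \<le> ennreal ((\<epsilon> n)\<^sup>2)" for n
  proof -
    have "(\<integral>\<^sup>+x. ennreal ((f n x - g x)\<^sup>2) \<partial>?M) = (\<integral>\<^sup>+x. liminf (\<lambda>k. ennreal ((f n x - f k x)\<^sup>2)) \<partial>?M)"
    proof (rule nn_integral_cong_AE)
      show "AE x in ?M. ennreal ((f n x - g x)\<^sup>2) = liminf (\<lambda>k. ennreal ((f n x - f k x)\<^sup>2))"
        using conv
      proof eventually_elim
        case (elim x)
        then have "(\<lambda>k. f k x) \<longlonglongrightarrow> g x" unfolding g_def by (simp add: convergent_LIMSEQ_iff)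
        then have "(\<lambda>k. ennreal ((f n x - f k x)\<^sup>2)) \<longlonglongrightarrow> ennreal ((f n x - g x)\<^sup>2)"
          by (intro tendsto_ennrealI tendsto_intros)
        then show ?case by (intro lim_imp_Liminf[symmetric]) auto
      qed
    qed
    also have "\<dots> \<le> liminf (\<lambda>k. \<integral>\<^sup>+x. ennreal ((f n x - f k x)\<^sup>2) \<partial>?M)"
      by (rule nn_integral_liminf) measurable
    also have "\<dots> \<le> ennreal ((\<epsilon> n)\<^sup>2)"
    proof -
      have "\<forall>\<^sub>F k in sequentially. (\<integral>\<^sup>+x. ennreal ((f n x - f k x)\<^sup>2) \<partial>?M) \<le> ennreal ((\<epsilon> n)\<^sup>2)"
        using eventually_ge_at_top[of n]
      proof eventually_elim
        case (elim k)
        have "(\<integral>\<^sup>+x. ennreal ((f n x - f k x)\<^sup>2) \<partial>?M) = ennreal ((L2_norm a b (\<lambda>x. f n x - f k x))\<^sup>2)"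
          by (rule nn_integral_square[OF fd])
        also have "\<dots> \<le> ennreal ((\<epsilon> n)\<^sup>2)"
          using C[OF elim] by (intro ennreal_leI power_mono) (auto simp: L2_norm_def L2_inner_nonneg)
        finally show ?case .
      qed
      then have "liminf (\<lambda>k. \<integral>\<^sup>+x. ennreal ((f n x - f k x)\<^sup>2) \<partial>?M) \<le> liminf (\<lambda>k::nat. ennreal ((\<epsilon> n)\<^sup>2))"
        by (rule Liminf_mono)
      then show ?thesis by (simp add: Liminf_const)
    qed
    finally show ?thesis .
  qed
  have fg: "(\<lambda>x. f n x - g x) \<in> L2 a b" for n
  proof -
    have "integrable ?M (\<lambda>x. (f n x - g x)\<^sup>2)"
      by (rule integrableI_nonneg) (use bound[of n] in \<open>auto intro: le_less_trans\<close>)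
    then show ?thesis by (simp add: L2_def)
  qed
  have "g \<in> L2 a b" using L2_diff[OF f[of 0] fg[of 0]] by simp
  moreover have "L2_norm a b (\<lambda>x. f n x - g x) \<le> \<epsilon> n" for n
  proof -
    have "ennreal ((L2_norm a b (\<lambda>x. f n x - g x))\<^sup>2) \<le> ennreal ((\<epsilon> n)\<^sup>2)"
      using bound[of n] nn_integral_square[OF fg] by simp
    then have "(L2_norm a b (\<lambda>x. f n x - g x))\<^sup>2 \<le> (\<epsilon> n)\<^sup>2" by (simp add: ennreal_le_iff)
    then show ?thesis using \<epsilon>0 by (rule power2_le_imp_le)
  qed
  ultimately show ?thesis by blast
qed

section \<open>The quotient Hilbert space over the unit interval\<close>

definition l2_rel :: "(real \<Rightarrow> real) \<Rightarrow> (real \<Rightarrow> real) \<Rightarrow> bool" where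
  "l2_rel f g \<longleftrightarrow> f \<in> L2 0 1 \<and> g \<in> L2 0 1 \<and> (AE x in lebesgue_on {0<..<1}. f x = g x)"

\<comment> \<open>The quotient is partial: functions that are not square integrable are unrelated
  even to themselves, so that the type contains classes of L2 functions only.\<close>
quotient_type l2 = "real \<Rightarrow> real" / partial: l2_rel
proof (rule part_equivpI)
  show "\<exists>x. l2_rel x x" using L2_const[of 0 0 1] by (auto simp: l2_rel_def)
  show "symp l2_rel" by (rule sympI) (auto simp: l2_rel_def elim: eventually_mono)
  show "transp l2_rel" by (rule transpI) (auto simp: l2_rel_def elim: eventually_elim2)
qed

instantiation l2 :: real_vector
begin

lift_definition zero_l2 :: l2 is "\<lambda>x. 0" by (simp add: l2_rel_def L2_const)

lift_definition plus_l2 :: "l2 \<Rightarrow> l2 \<Rightarrow> l2" is "\<lambda>f g x. f x + g x"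
  by (auto simp: l2_rel_def L2_add elim: eventually_elim2)

lift_definition minus_l2 :: "l2 \<Rightarrow> l2 \<Rightarrow> l2" is "\<lambda>f g x. f x - g x"
  by (auto simp: l2_rel_def L2_diff elim: eventually_elim2)

lift_definition uminus_l2 :: "l2 \<Rightarrow> l2" is "\<lambda>f x. - f x"
  by (auto simp: l2_rel_def L2_uminus)

lift_definition scaleR_l2 :: "real \<Rightarrow> l2 \<Rightarrow> l2" is "\<lambda>c f x. c * f x"
  by (auto simp: l2_rel_def L2_scale elim: eventually_mono)

instance
proof
  fix a b c :: l2 and r s :: real
  show "a + b + c = a + (b + c)"
    by transfer (simp add: l2_rel_def L2_add add.assoc)
  show "a + b = b + a" by transfer (simp add: l2_rel_def L2_add add.commute)
  show "0 + a = a" by transfer (simp add: l2_rel_def)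
  show "- a + a = 0" by transfer (simp add: l2_rel_def L2_const)
  show "a - b = a + - b" by transfer (simp add: l2_rel_def L2_diff)
  show "r *\<^sub>R (a + b) = r *\<^sub>R a + r *\<^sub>R b"
    by transfer (simp add: l2_rel_def L2_add L2_scale distrib_left)
  show "(r + s) *\<^sub>R a = r *\<^sub>R a + s *\<^sub>R a"
    by transfer (simp add: l2_rel_def L2_add L2_scale distrib_right)
  show "r *\<^sub>R s *\<^sub>R a = (r * s) *\<^sub>R a"
    by transfer (simp add: l2_rel_def L2_scale mult.assoc)
  show "1 *\<^sub>R a = a" by transfer (simp add: l2_rel_def)
qed

end

instantiation l2 :: real_inner
begin

lift_definition inner_l2 :: "l2 \<Rightarrow> l2 \<Rightarrow> real" is "L2_inner 0 1"
  by (auto simp: l2_rel_def intro: L2_inner_cong)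

definition norm_l2 :: "l2 \<Rightarrow> real" where "norm_l2 a = sqrt (inner a a)"
definition sgn_l2 :: "l2 \<Rightarrow> l2" where "sgn_l2 a = scaleR (inverse (norm a)) a"
definition dist_l2 :: "l2 \<Rightarrow> l2 \<Rightarrow> real" where "dist_l2 a b = norm (a - b)"
definition uniformity_l2 :: "(l2 \<times> l2) filter" where
  "uniformity_l2 = (INF e\<in>{0<..}. principal {(x, y). dist x y < e})"
definition open_l2 :: "l2 set \<Rightarrow> bool" where
  "open_l2 U \<longleftrightarrow> (\<forall>x\<in>U. eventually (\<lambda>(x', y). x' = x \<longrightarrow> y \<in> U) uniformity)"

instance
proof
  fix a b c :: l2 and r s :: real
  show "dist a b = norm (a - b)" by (rule dist_l2_def)
  show "sgn a = a /\<^sub>R norm a" by (rule sgn_l2_def)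
  show "uniformity = (INF e\<in>{0<..}. principal {(x, y :: l2). dist x y < e})" by (rule uniformity_l2_def)
  show "open U = (\<forall>x\<in>U. \<forall>\<^sub>F (x', y) in uniformity. x' = x \<longrightarrow> y \<in> U)" for U :: "l2 set" by (rule open_l2_def)
  show "inner a b = inner b a" by transfer (rule L2_inner_commute)
  show "inner (a + b) c = inner a c + inner b c"
    by transfer (simp add: l2_rel_def L2_inner_add_left)
  show "inner (r *\<^sub>R a) b = r * inner a b" by transfer (rule L2_inner_scale_left)
  show "0 \<le> inner a a" by transfer (rule L2_inner_nonneg)
  show "(inner a a = 0) = (a = 0)" by transfer (simp add: l2_rel_def L2_inner_eq_0_iff L2_const)
  show "norm a = sqrt (inner a a)" by (rule norm_l2_def)
qed

end

lemma rep_l2_L2: "rep_l2 a \<in> L2 0 1"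
  using Quotient3_rel_rep[OF Quotient3_l2, of a a] by (simp add: l2_rel_def)

lemma abs_rep_l2: "abs_l2 (rep_l2 a) = a"
  by (rule Quotient3_abs_rep[OF Quotient3_l2])

lemma rep_abs_l2: "f \<in> L2 0 1 \<Longrightarrow> AE x in lebesgue_on {0<..<1}. rep_l2 (abs_l2 f) x = f x"
  using Quotient3_rep_abs[OF Quotient3_l2, of f] by (simp add: l2_rel_def)

lemma l2_norm_rep_diff: "norm (a - b) = L2_norm 0 1 (\<lambda>x. rep_l2 a x - rep_l2 b x)"
proof -
  have e: "a - b = abs_l2 (\<lambda>x. rep_l2 a x - rep_l2 b x)"
    using minus_l2.abs_eq[of "rep_l2 a" "rep_l2 b"] rep_l2_L2 by (simp add: l2_rel_def abs_rep_l2)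
  show ?thesis unfolding norm_l2_def L2_norm_def e
    by (subst inner_l2.abs_eq) (simp_all add: l2_rel_def L2_diff rep_l2_L2)
qed

instance l2 :: banach
proof
  fix X :: "nat \<Rightarrow> l2" assume X: "Cauchy X"
  have "\<forall>n. \<exists>N. \<forall>p\<ge>N. \<forall>q\<ge>N. dist (X p) (X q) < (1/2)^n"
    using X unfolding Cauchy_def by simp
  from choice[OF this] obtain N where N: "\<And>n p q. p \<ge> N n \<Longrightarrow> q \<ge> N n \<Longrightarrow> dist (X p) (X q) < (1/2)^n" by blast
  \<comment> \<open>A subsequence with geometric distances, as \<open>L2_complete\<close> wants
    summable bounds. The sum of thresholds makes \<open>r n\<close> at least \<open>N k\<close> for
    every \<open>k \<le> n\<close>, and the summand \<open>n\<close> makes it strictly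
    increasing.\<close>
  define r where "r n = n + (\<Sum>i\<le>n. N i)" for n
  have r: "r n \<ge> N k" if "k \<le> n" for k n
    using member_le_sum[of k "{..n}" N] that by (simp add: r_def)
  have sr: "strict_mono r" unfolding strict_mono_Suc_iff r_def by simp
  have "\<exists>g. g \<in> L2 0 1 \<and> (\<forall>n. L2_norm 0 1 (\<lambda>x. rep_l2 (X (r n)) x - g x) \<le> (1/2)^n)"
  proof (rule L2_complete)
    show "L2_norm 0 1 (\<lambda>x. rep_l2 (X (r n)) x - rep_l2 (X (r k)) x) \<le> (1/2)^n" if "n \<le> k" for n k
      using N[OF r[of n n] r[OF that]] unfolding dist_norm l2_norm_rep_diff by simp
  qed (auto simp: rep_l2_L2)
  then obtain g where g: "g \<in> L2 0 1" "\<And>n. L2_norm 0 1 (\<lambda>x. rep_l2 (X (r n)) x - g x) \<le> (1/2)^n" by blast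
  have "dist (X (r n)) (abs_l2 g) \<le> (1/2)^n" for n
  proof -
    have "L2_norm 0 1 (\<lambda>x. rep_l2 (X (r n)) x - rep_l2 (abs_l2 g) x) = L2_norm 0 1 (\<lambda>x. rep_l2 (X (r n)) x - g x)"
      unfolding L2_norm_def
      by (rule arg_cong[where f = sqrt], rule L2_inner_cong)
         (use rep_abs_l2[OF g(1)] in \<open>auto intro!: L2_diff rep_l2_L2 g(1) elim: eventually_mono\<close>)
    then show ?thesis using g(2)[of n] unfolding dist_norm l2_norm_rep_diff by simp
  qed
  then have "(\<lambda>n. dist (X (r n)) (abs_l2 g)) \<longlonglongrightarrow> 0"
    by (intro tendsto_sandwich[OF _ _ tendsto_const LIMSEQ_realpow_zero[of "1/2"]]) auto
  then have "(X \<circ> r) \<longlonglongrightarrow> abs_l2 g" by (subst tendsto_dist_iff) (simp add: o_def)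
  then show "convergent X"
    using X sr Cauchy_converges_subseq convergent_def by blast
qed

section \<open>Functions with vanishing integrals\<close>

lemma integrable_on_interval_iff:
  "integrable (lebesgue_on {a<..<b::real}) h \<longleftrightarrow> integrable lebesgue (\<lambda>x. indicator {a<..<b} x * h x)"
  for h :: "real \<Rightarrow> real"
  by (subst integrable_restrict_space) auto

lemma integral_on_interval:
  "integral\<^sup>L (lebesgue_on {a<..<b::real}) h = integral\<^sup>L lebesgue (\<lambda>x. indicator {a<..<b} x * h x)"
  for h :: "real \<Rightarrow> real"
  by (subst integral_restrict_space) auto

lemma measurable_on_interval_iff:
  "h \<in> borel_measurable (lebesgue_on {a<..<b::real}) \<longleftrightarrow> (\<lambda>x. indicator {a<..<b} x * h x) \<in> borel_measurable lebesgue"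
  for h :: "real \<Rightarrow> real"
  by (subst borel_measurable_restrict_space_iff) auto

lemma AE_on_interval_iff:
  "(AE x in lebesgue_on {a<..<b::real}. Q x) \<longleftrightarrow> (AE x in lebesgue. a < x \<and> x < b \<longrightarrow> Q x)"
  by (subst AE_restrict_space_iff) auto

lemma measurable_cong_AE_interval:
  fixes f g :: "real \<Rightarrow> real"
  assumes f: "f \<in> borel_measurable (lebesgue_on {a<..<b})" and e: "AE x in lebesgue_on {a<..<b}. f x = g x"
  shows "g \<in> borel_measurable (lebesgue_on {a<..<b})"
  unfolding measurable_on_interval_iff
proof (rule borel_measurable_AE)
  show "(\<lambda>x. indicator {a<..<b} x * f x) \<in> borel_measurable lebesgue"
    using f measurable_on_interval_iff by blast
  show "AE x in lebesgue. indicator {a<..<b} x * f x = indicator {a<..<b} x * g x"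
    using e unfolding AE_on_interval_iff by eventually_elim (auto simp: indicator_def)
qed

lemma L2_cong_AE:
  assumes f: "f \<in> L2 a b" and e: "AE x in lebesgue_on {a<..<b}. f x = g x"
  shows "g \<in> L2 a b"
proof -
  have g: "g \<in> borel_measurable (lebesgue_on {a<..<b})"
    by (rule measurable_cong_AE_interval[OF L2_measurable[OF f] e])
  have "integrable (lebesgue_on {a<..<b}) (\<lambda>x. (g x)\<^sup>2) \<longleftrightarrow> integrable (lebesgue_on {a<..<b}) (\<lambda>x. (f x)\<^sup>2)"
    by (rule integrable_cong_AE) (use f g L2_measurable e in \<open>auto elim: eventually_mono\<close>)
  then show ?thesis using g L2_square[OF f] by (simp add: L2_def)
qed

text \<open>The Borel sets over which \<open>f\<close> has integral 0 include the closed intervals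
  and form a Dynkin class, where \<open>total\<close> serves the complements. As the argument lives
  on Borel sets, \<open>f\<close> is first replaced by a Borel measurable representative.\<close>

lemma AE_zero_if_integrals_zero:
  fixes f :: "real \<Rightarrow> real"
  assumes f: "integrable lebesgue f" and z: "\<And>a b. a \<le> b \<Longrightarrow> (LINT x|lebesgue. indicator {a..b} x * f x) = 0"
    and total: "(LINT x|lebesgue. f x) = 0"
  shows "AE x in lebesgue. f x = 0"
proof -
  obtain f' where f': "f' \<in> borel_measurable lborel" "AE x in lborel. f x = f' x"
    using completion_ex_borel_measurable_real[OF borel_measurable_integrable[OF f]] by auto
  have ae: "AE x in lebesgue. f x = f' x" using f'(2) by (rule AE_completion)
  have fl: "f \<in> borel_measurable lebesgue" using f by (rule borel_measurable_integrable)
  have fl': "f' \<in> borel_measurable lebesgue" using f'(1) by (rule measurable_completion)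
  have "integrable lebesgue f' \<longleftrightarrow> integrable lebesgue f"
    by (rule integrable_cong_AE[OF fl' fl]) (use ae in \<open>auto elim: eventually_mono\<close>)
  then have if': "integrable lborel f'" using f f'(1) integrable_completion by blast
  have si: "integrable lborel (\<lambda>x. indicator A x * f' x)" if "A \<in> sets borel" for A
    using integrable_mult_indicator[OF _ if', of A] that by simp
  have e: "(LINT x|lborel. indicator A x * f' x) = (LINT x|lebesgue. indicator A x * f x)" if "A \<in> sets borel" for A
  proof -
    have "(LINT x|lborel. indicator A x * f' x) = (LINT x|lebesgue. indicator A x * f' x)"
      by (rule integral_completion[symmetric]) (use f'(1) that in auto)
    also have "\<dots> = (LINT x|lebesgue. indicator A x * f x)"
      by (rule integral_cong_AE)
         (use fl fl' ae that in \<open>auto elim!: eventually_mono intro!: borel_measurable_times borel_measurable_indicator\<close>)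
    finally show ?thesis .
  qed
  have S: "(LINT x|lborel. indicator A x * f' x) = 0" if "A \<in> sets borel" for A
    using that
  proof (induction A rule: borel_set_induct)
    case (interval a b)
    then show ?case using z[of a b] e[of "{a..b}"] by simp
  next
    case (compl A)
    have "(LINT x|lborel. indicator (- A) x * f' x) = (LINT x|lborel. f' x - indicator A x * f' x)"
      by (rule Bochner_Integration.integral_cong) (auto simp: indicator_def)
    also have "\<dots> = (LINT x|lborel. f' x) - 0"
      using if' si compl by (subst Bochner_Integration.integral_diff) auto
    also have "\<dots> = 0" using e[of UNIV] total by simp
    finally show ?case .
  next
    case (union A)
    have "(LINT x:(\<Union>i. A i)|lborel. f' x) = (\<Sum>i. LINT x:A i|lborel. f' x)"
    proof (rule lebesgue_integral_countable_add)
      show "A i \<inter> A j = {}" if "i \<noteq> j" for i j using union(1) that unfolding disjoint_family_on_def by auto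
      show "set_integrable lborel (\<Union>i. A i) f'" unfolding set_integrable_def using si[of "\<Union>i. A i"] union by simp
    qed (use union in auto)
    then show ?case unfolding set_lebesgue_integral_def using union by simp
  qed simp
  have "AE x in lborel. f' x = 0"
    by (rule sigma_finite_measure.density_zero[OF sigma_finite_lborel if']) (use S in \<open>simp add: set_lebesgue_integral_def\<close>)
  then have "AE x in lebesgue. f' x = 0" by (rule AE_completion)
  with ae show ?thesis by eventually_elim simp
qed

text \<open>The primitive of \<open>h\<close> takes one value at all rational points; continuity
  makes it constant, so all interval integrals vanish. Rational endpoints keep the later system of
  bumps countable.\<close>

lemma rational_integrals_zero_imp_AE_zero:
  fixes h :: "real \<Rightarrow> real"
  assumes h: "integrable (lebesgue_on {a<..<b}) h"
    and z: "\<And>p q. p \<in> \<rat> \<Longrightarrow> q \<in> \<rat> \<Longrightarrow> a < p \<Longrightarrow> p < q \<Longrightarrow> q < b \<Longrightarrow> (LINT x|lebesgue_on {p<..<q}. h x) = 0"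
  shows "AE x in lebesgue_on {a<..<b}. h x = 0"
proof (cases "a < b")
  case ab: True
  define f where "f x = indicator {a<..<b} x * h x" for x
  have f: "integrable lebesgue f" using h unfolding f_def integrable_on_interval_iff .
  have fm [measurable]: "f \<in> borel_measurable lebesgue" using f by (rule borel_measurable_integrable)
  have fi: "integrable (lebesgue_on {c<..<d}) f" for c d
    unfolding integrable_on_interval_iff using integrable_mult_indicator[OF _ f, of "{c<..<d}"] by simp
  have Lf: "(LINT x|lebesgue. indicator {c<..<d} x * f x) = integral {c..d} f" for c d
    using lebesgue_integral_eq_integral[OF fi, of c d]
    by (simp add: integral_on_interval integral_open_interval_real)
  have fo: "f integrable_on {c..d}" for c d
    using integrable_on_lebesgue_on[OF fi, of c d] by (simp add: integrable_on_open_interval_real)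
  define F where "F x = integral {a..x} f" for x
  have F: "integral {c..d} f = F d - F c" if "a \<le> c" "c \<le> d" for c d
    unfolding F_def using Henstock_Kurzweil_Integration.integral_combine[OF that fo] by linarith
  have Fc: "continuous_on {a..b} F"
    unfolding F_def by (rule indefinite_integral_continuous_1[OF fo])
  have Fr: "F p = F q" if "p \<in> {a<..<b} \<inter> \<rat>" "q \<in> {a<..<b} \<inter> \<rat>" "p < q" for p q
  proof -
    have "(LINT x|lebesgue. indicator {p<..<q} x * f x) = (LINT x|lebesgue_on {p<..<q}. h x)"
      unfolding integral_on_interval f_def using that
      by (intro Bochner_Integration.integral_cong) (auto simp: indicator_def)
    then show ?thesis using z[of p q] that F[of p q] Lf[of p q] by auto
  qed
  obtain r where r: "r \<in> {a<..<b} \<inter> \<rat>" using Rats_dense_in_real[OF ab] by auto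
  have cl: "closure ({a<..<b} \<inter> \<rat>) = {a..b}"
    using closure_open_Int_superset[of "{a<..<b}" "\<rat> :: real set"] ab by (simp add: Rats_closure_real)
  have Fconst: "F x = F r" if "x \<in> {a..b}" for x
  proof (rule continuous_constant_on_closure[where S = "{a<..<b} \<inter> \<rat>" and f = F])
    show "F y = F r" if "y \<in> {a<..<b} \<inter> \<rat>" for y
    proof (cases y r rule: linorder_cases)
      case less
      show ?thesis by (rule Fr[OF that r less])
    next
      case greater
      show ?thesis by (rule Fr[OF r that greater, symmetric])
    qed simp
  qed (use that Fc cl in auto)
  have sub: "(LINT x|lebesgue. indicator {c<..<d} x * f x) = 0" if "a \<le> c" "c < d" "d \<le> b" for c d
    using Lf[of c d] F[of c d] Fconst[of c] Fconst[of d] that by simp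
  have "AE x in lebesgue. f x = 0"
  proof (rule AE_zero_if_integrals_zero[OF f])
    fix x y :: real
    define c d where "c = max a x" and "d = min b y"
    have "AE t in lebesgue. t \<noteq> x" "AE t in lebesgue. t \<noteq> y"
      by (auto intro!: AE_completion AE_lborel_singleton)
    then have ae: "AE t in lebesgue. indicator {x..y} t * f t = indicator {c<..<d} t * f t"
      by eventually_elim (auto simp: f_def indicator_def c_def d_def)
    have "(LINT t|lebesgue. indicator {x..y} t * f t) = (LINT t|lebesgue. indicator {c<..<d} t * f t)"
      by (rule integral_cong_AE[OF _ _ ae]) (auto intro!: borel_measurable_times borel_measurable_indicator)
    also have "\<dots> = 0"
    proof (cases "c < d")
      case True then show ?thesis by (intro sub) (auto simp: c_def d_def)
    qed simp
    finally show "(LINT t|lebesgue. indicator {x..y} t * f t) = 0" .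
  next
    have "(LINT x|lebesgue. f x) = (LINT x|lebesgue. indicator {a<..<b} x * f x)"
      unfolding f_def by (rule Bochner_Integration.integral_cong) (auto simp: indicator_def)
    also have "\<dots> = 0" using ab by (intro sub) auto
    finally show "(LINT x|lebesgue. f x) = 0" .
  qed
  then show ?thesis unfolding AE_on_interval_iff f_def by eventually_elim (auto simp: indicator_def split: if_splits)
next
  case False
  then show ?thesis unfolding AE_on_interval_iff by auto
qed

section \<open>Rescaling between (0,L) and the unit interval\<close>

lemma measurable_scale:
  fixes f :: "real \<Rightarrow> real"
  assumes f: "f \<in> borel_measurable (lebesgue_on {0<..<c * b})" and c: "c > 0"
  shows "(\<lambda>x. f (c * x)) \<in> borel_measurable (lebesgue_on {0<..<b})"
proof -
  have "(\<lambda>x::real. 0 + c * x) \<in> lebesgue \<rightarrow>\<^sub>M lebesgue"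
    using lebesgue_affine_measurable[of "\<lambda>_::real. c" 0] c by simp
  moreover have "(\<lambda>x. indicator {0<..<c * b} x * f x) \<in> borel_measurable lebesgue"
    using f unfolding measurable_on_interval_iff .
  ultimately have m: "(\<lambda>x. indicator {0<..<c * b} (0 + c * x) * f (0 + c * x)) \<in> borel_measurable lebesgue"
    by (rule measurable_compose)
  have e: "indicator {0<..<c * b} (0 + c * x) * f (0 + c * x) = indicator {0<..<b} x * f (c * x)" for x
    using c by (auto simp: indicator_def zero_less_mult_iff)
  show ?thesis using m unfolding measurable_on_interval_iff e .
qed

lemma integral_scale:
  fixes f :: "real \<Rightarrow> real"
  assumes c: "c > 0"
  shows "integrable (lebesgue_on {0<..<b}) (\<lambda>x. f (c * x)) \<longleftrightarrow> integrable (lebesgue_on {0<..<c * b}) f"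
    and "integral\<^sup>L (lebesgue_on {0<..<c * b}) f = c * integral\<^sup>L (lebesgue_on {0<..<b}) (\<lambda>x. f (c * x))"
proof -
  have e: "indicator {0<..<c * b} (0 + c * x) * f (0 + c * x) = indicator {0<..<b} x * f (c * x)" for x
    using c by (auto simp: indicator_def zero_less_mult_iff)
  show "integrable (lebesgue_on {0<..<b}) (\<lambda>x. f (c * x)) \<longleftrightarrow> integrable (lebesgue_on {0<..<c * b}) f"
    using lebesgue_integrable_real_affine_iff[of c "\<lambda>x. indicator {0<..<c * b} x * f x" 0] c
    unfolding integrable_on_interval_iff e by simp
  show "integral\<^sup>L (lebesgue_on {0<..<c * b}) f = c * integral\<^sup>L (lebesgue_on {0<..<b}) (\<lambda>x. f (c * x))"
    using lebesgue_integral_real_affine[of c "\<lambda>x. indicator {0<..<c * b} x * f x" 0] c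
    unfolding integral_on_interval e by simp
qed

text \<open>A type cannot depend on \<open>L\<close>, so \<open>l2\<close> is the space over \<open>(0,1)\<close>; the rescalings \<open>emb\<close> and \<open>cls\<close>
  identify it isometrically with \<open>L\<^sup>2(0,L)\<close>.\<close>

definition emb :: "real \<Rightarrow> l2 \<Rightarrow> real \<Rightarrow> real" where
  "emb L a = (\<lambda>x. rep_l2 a (x / L) / sqrt L)"

definition cls :: "real \<Rightarrow> (real \<Rightarrow> real) \<Rightarrow> l2" where
  "cls L f = abs_l2 (\<lambda>x. sqrt L * f (L * x))"

lemma scale_L2:
  assumes f: "f \<in> L2 0 L" and L: "L > 0"
  shows "(\<lambda>x. sqrt L * f (L * x)) \<in> L2 0 1"
proof -
  have "f \<in> borel_measurable (lebesgue_on {0<..<L * 1})" using L2_measurable[OF f] by simp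
  then have "(\<lambda>x. f (L * x)) \<in> borel_measurable (lebesgue_on {0<..<1})" by (rule measurable_scale[OF _ L])
  moreover have "integrable (lebesgue_on {0<..<1}) (\<lambda>x. (f (L * x))\<^sup>2)"
    using integral_scale(1)[OF L, of 1 "\<lambda>x. (f x)\<^sup>2"] L2_square[OF f] by simp
  ultimately have "(\<lambda>x. f (L * x)) \<in> L2 0 1" by (simp add: L2_def)
  then show ?thesis by (rule L2_scale)
qed

lemma scale_inner:
  assumes L: "L > 0"
  shows "L2_inner 0 1 (\<lambda>x. sqrt L * f (L * x)) (\<lambda>x. sqrt L * g (L * x)) = L2_inner 0 L f g"
proof -
  have e: "(sqrt L * f (L * x)) * (sqrt L * g (L * x)) = L * (f (L * x) * g (L * x))" for x
  proof -
    have "(sqrt L * f (L * x)) * (sqrt L * g (L * x)) = (sqrt L * sqrt L) * (f (L * x) * g (L * x))"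
      by (simp only: ac_simps)
    then show ?thesis using L by simp
  qed
  then show ?thesis
    using integral_scale(2)[OF L, of 1 "\<lambda>x. f x * g x"] unfolding L2_inner_def e by simp
qed

lemma scale_emb: "L > 0 \<Longrightarrow> (\<lambda>x. sqrt L * emb L a (L * x)) = rep_l2 a"
  by (simp add: emb_def fun_eq_iff)

lemma emb_L2:
  assumes L: "L > 0"
  shows "emb L a \<in> L2 0 L"
proof -
  have c: "1 / L > 0" using L by simp
  have r: "rep_l2 a \<in> L2 0 1" by (rule rep_l2_L2)
  have "rep_l2 a \<in> borel_measurable (lebesgue_on {0<..<(1 / L) * L})" using L2_measurable[OF r] L by simp
  then have "(\<lambda>x. rep_l2 a (1 / L * x)) \<in> borel_measurable (lebesgue_on {0<..<L})" by (rule measurable_scale[OF _ c])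
  moreover have "integrable (lebesgue_on {0<..<L}) (\<lambda>x. (rep_l2 a (1 / L * x))\<^sup>2)"
    using integral_scale(1)[OF c, of L "\<lambda>x. (rep_l2 a x)\<^sup>2"] L2_square[OF r] L by simp
  ultimately have "(\<lambda>x. rep_l2 a (1 / L * x)) \<in> L2 0 L" by (simp add: L2_def)
  from L2_scale[OF this, of "1 / sqrt L"] show ?thesis by (simp add: emb_def)
qed

lemma cls_emb: "L > 0 \<Longrightarrow> cls L (emb L a) = a"
  by (simp add: cls_def scale_emb abs_rep_l2)

lemma inner_cls:
  assumes "L > 0" "f \<in> L2 0 L" "g \<in> L2 0 L"
  shows "cls L f \<bullet> cls L g = L2_inner 0 L f g"
  unfolding cls_def
  by (subst inner_l2.abs_eq) (use assms in \<open>simp_all add: l2_rel_def scale_L2 scale_inner\<close>)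

lemma inner_emb: "L > 0 \<Longrightarrow> L2_inner 0 L (emb L a) (emb L b) = a \<bullet> b"
  using inner_cls[of L "emb L a" "emb L b"] by (simp add: emb_L2 cls_emb)

lemma cls_lincomb:
  assumes "L > 0" "f \<in> L2 0 L" "g \<in> L2 0 L"
  shows "cls L (\<lambda>x. c * f x + d * g x) = c *\<^sub>R cls L f + d *\<^sub>R cls L g"
proof -
  have f: "l2_rel (\<lambda>x. sqrt L * f (L * x)) (\<lambda>x. sqrt L * f (L * x))"
    and g: "l2_rel (\<lambda>x. sqrt L * g (L * x)) (\<lambda>x. sqrt L * g (L * x))"
    using assms by (auto simp: l2_rel_def scale_L2)
  have "c *\<^sub>R cls L f + d *\<^sub>R cls L g = abs_l2 (\<lambda>x. c * (sqrt L * f (L * x)) + d * (sqrt L * g (L * x)))"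
    unfolding cls_def using f g
    by (subst scaleR_l2.abs_eq[OF f], subst scaleR_l2.abs_eq[OF g], subst plus_l2.abs_eq)
       (auto simp: l2_rel_def intro: L2_scale)
  then show ?thesis by (simp add: cls_def algebra_simps)
qed

lemma norm_cls_diff:
  assumes "L > 0" "f \<in> L2 0 L" "g \<in> L2 0 L"
  shows "norm (cls L f - cls L g) = L2_norm 0 L (\<lambda>x. f x - g x)"
proof -
  have "cls L f - cls L g = cls L (\<lambda>x. f x - g x)"
    using cls_lincomb[OF assms, of 1 "-1"] by simp
  then show ?thesis
    using inner_cls[OF assms(1) L2_diff[OF assms(2,3)] L2_diff[OF assms(2,3)]]
    by (simp add: norm_eq_sqrt_inner L2_norm_def)
qed

lemma cls_eq_iff:
  assumes L: "L > 0" and f: "f \<in> L2 0 L" and g: "g \<in> L2 0 L"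
  shows "cls L f = cls L g \<longleftrightarrow> (AE x in lebesgue_on {0<..<L}. f x = g x)"
proof -
  have "cls L f = cls L g \<longleftrightarrow> norm (cls L f - cls L g) = 0" by simp
  also have "\<dots> \<longleftrightarrow> L2_inner 0 L (\<lambda>x. f x - g x) (\<lambda>x. f x - g x) = 0"
    unfolding norm_cls_diff[OF assms] L2_norm_def by simp
  also have "\<dots> \<longleftrightarrow> (AE x in lebesgue_on {0<..<L}. f x = g x)"
    using L2_inner_eq_0_iff[OF L2_diff[OF f g]] by simp
  finally show ?thesis .
qed

lemma emb_cls:
  assumes L: "L > 0" and f: "f \<in> L2 0 L"
  shows "AE x in lebesgue_on {0<..<L}. emb L (cls L f) x = f x"
  by (subst cls_eq_iff[OF L emb_L2[OF L] f, symmetric]) (simp add: cls_emb[OF L])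

lemma norm_cls: "L > 0 \<Longrightarrow> f \<in> L2 0 L \<Longrightarrow> norm (cls L f) = L2_norm 0 L f"
  using inner_cls[of L f f] by (simp add: norm_eq_sqrt_inner L2_norm_def)

section \<open>Test functions and weak derivatives\<close>

text \<open>The classical smooth function that vanishes to infinite order at 0, with a polynomial
  factor so that the family is closed under differentiation; for \<open>r = 1\<close> and positive
  \<open>y\<close> it is exp(-1/y).\<close>

definition flat :: "real poly \<Rightarrow> real \<Rightarrow> real" where
  "flat r y = (if y > 0 then poly r (inverse y) * exp (- inverse y) else 0)"

lemma poly_times_exp_tendsto_0: "((\<lambda>z. poly r z * exp (- z)) \<longlongrightarrow> (0::real)) at_top"
proof -
  have e: "poly r z * exp (- z) = (\<Sum>i\<le>degree r. coeff r i * (z ^ i / exp z))" for z :: real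
    by (simp add: poly_altdef sum_distrib_right exp_minus divide_inverse mult.assoc)
  show ?thesis unfolding e
    by (intro tendsto_null_sum tendsto_mult_right_zero tendsto_power_div_exp_0)
qed

text \<open>With s = 1/y, the derivative of r(s) exp(-s) in y is (r - r')(s) s^2 exp(-s); the factor
  \<open>[:0, 0, 1:]\<close> is the polynomial s^2.\<close>

lemma flat_has_derivative:
  "(flat r has_real_derivative flat ((r - pderiv r) * [:0, 0, 1:]) y) (at y)"
proof -
  consider "y > 0" | "y < 0" | "y = 0" by linarith
  then show ?thesis
  proof cases
    case 1
    have i: "(inverse has_real_derivative - (inverse y * inverse y)) (at y)"
      using DERIV_inverse[of y] 1 by (simp add: power2_eq_square)
    have "((\<lambda>y. poly r (inverse y) * exp (- inverse y)) has_real_derivative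
        (poly (pderiv r) (inverse y) * - (inverse y * inverse y)) * exp (- inverse y)
         + (exp (- inverse y) * - (- (inverse y * inverse y))) * poly r (inverse y)) (at y)"
      by (intro DERIV_mult DERIV_chain2[OF poly_DERIV i] DERIV_chain2[OF DERIV_exp] DERIV_minus i)
    also have "(poly (pderiv r) (inverse y) * - (inverse y * inverse y)) * exp (- inverse y)
         + (exp (- inverse y) * - (- (inverse y * inverse y))) * poly r (inverse y) = flat ((r - pderiv r) * [:0, 0, 1:]) y"
      using 1 by (simp add: flat_def algebra_simps)
    finally show ?thesis
      by (rule has_field_derivative_transform_within_open[of _ _ _ "{0<..}"]) (use 1 in \<open>auto simp: flat_def\<close>)
  next
    case 2
    have "((\<lambda>y. 0) has_real_derivative flat ((r - pderiv r) * [:0, 0, 1:]) y) (at y)"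
      using 2 by (simp add: flat_def)
    then show ?thesis
      by (rule has_field_derivative_transform_within_open[of _ _ _ "{..<0}"]) (use 2 in \<open>auto simp: flat_def\<close>)
  next
    case 3
    have l: "((\<lambda>h. (flat r (0 + h) - flat r 0) / h) \<longlongrightarrow> 0) (at_left 0)"
      by (rule tendsto_eventually) (auto simp: flat_def eventually_at_filter)
    \<comment> \<open>Dividing by \<open>h\<close> multiplies the polynomial by its variable, so the
      right difference quotient at 0 is again of flat type and tends to 0.\<close>
    have "((\<lambda>h. poly (r * [:0, 1:]) (inverse h) * exp (- inverse h)) \<longlongrightarrow> 0) (at_right 0)"
      by (rule filterlim_compose[OF poly_times_exp_tendsto_0 filterlim_inverse_at_top_right])
    moreover have "\<forall>\<^sub>F h in at_right 0. poly (r * [:0, 1:]) (inverse h) * exp (- inverse h) = (flat r (0 + h) - flat r 0) / h"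
      by (auto simp: flat_def eventually_at_filter divide_inverse)
    ultimately have "((\<lambda>h. (flat r (0 + h) - flat r 0) / h) \<longlongrightarrow> 0) (at_right 0)"
      by (rule Lim_transform_eventually)
    with l have "((\<lambda>h. (flat r (0 + h) - flat r 0) / h) \<longlongrightarrow> 0) (at 0)" by (rule filterlim_split_at)
    then show ?thesis unfolding 3 DERIV_def by (simp add: flat_def)
  qed
qed

text \<open>\<open>test_function\<close> asks for derivatives of every order. A class whose members
  have derivatives in the same class gives them by induction on the order, without formulas for
  higher derivatives.\<close>

inductive tame :: "(real \<Rightarrow> real) \<Rightarrow> bool" where
  flat: "tame (\<lambda>x. flat r (c * x + d))"
| const: "tame (\<lambda>x. c)"
| add: "tame f \<Longrightarrow> tame h \<Longrightarrow> tame (\<lambda>x. f x + h x)"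
| mult: "tame f \<Longrightarrow> tame h \<Longrightarrow> tame (\<lambda>x. f x * h x)"

lemma tame_has_derivative: "tame f \<Longrightarrow> \<exists>f'. tame f' \<and> (\<forall>x. (f has_real_derivative f' x) (at x))"
proof (induction rule: tame.induct)
  case (flat r c d)
  define f' where "f' x = flat ((r - pderiv r) * [:0, 0, 1:]) (c * x + d) * c" for x
  have "tame f'" unfolding f'_def by (intro tame.mult tame.flat tame.const)
  moreover have "((\<lambda>x. flat r (c * x + d)) has_real_derivative f' x) (at x)" for x
    unfolding f'_def by (rule DERIV_chain2[OF flat_has_derivative]) (auto intro!: derivative_eq_intros)
  ultimately show ?case by blast
next
  case (const c)
  show ?case by (intro exI[of _ "\<lambda>x. 0"]) (auto intro: tame.const)
next
  case (add f h)
  then obtain f' h' where "tame f'" "tame h'" "\<And>x. (f has_real_derivative f' x) (at x)" "\<And>x. (h has_real_derivative h' x) (at x)"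
    by blast
  then show ?case by (intro exI[of _ "\<lambda>x. f' x + h' x"]) (auto intro: tame.add DERIV_add)
next
  case (mult f h)
  then obtain f' h' where d: "tame f'" "tame h'" "\<And>x. (f has_real_derivative f' x) (at x)" "\<And>x. (h has_real_derivative h' x) (at x)"
    by blast
  then show ?case using mult(1,2)
    by (intro exI[of _ "\<lambda>x. f' x * h x + h' x * f x"]) (auto intro: tame.add tame.mult DERIV_mult)
qed

lemma tame_deriv: "tame f \<Longrightarrow> tame (deriv f)"
proof -
  assume "tame f"
  then obtain f' where f': "tame f'" "\<And>x. (f has_real_derivative f' x) (at x)"
    using tame_has_derivative by blast
  then have "deriv f = f'" by (auto intro: DERIV_imp_deriv)
  then show ?thesis using f' by simp
qed

lemma tame_deriv_funpow: "tame f \<Longrightarrow> tame ((deriv ^^ n) f)"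
  by (induction n) (auto intro: tame_deriv)

lemma tame_differentiable: "tame f \<Longrightarrow> (deriv ^^ n) f differentiable at x"
  using tame_has_derivative[OF tame_deriv_funpow] unfolding real_differentiable_def by blast

text \<open>Tameness is asked of the derivative, so that primitives of combinations of bumps are
  covered as well.\<close>

lemma test_function_if_deriv:
  assumes \<theta>: "\<And>x. (\<theta> has_real_derivative \<psi> x) (at x)" and \<psi>: "tame \<psi>"
    and supp: "a < c" "d < b" "\<And>x. x \<notin> {c..d} \<Longrightarrow> \<theta> x = 0"
  shows "test_function a b \<theta>" and "deriv \<theta> = \<psi>"
proof -
  show d: "deriv \<theta> = \<psi>" using \<theta> by (auto intro: DERIV_imp_deriv)
  have "(deriv ^^ n) \<theta> differentiable at x" for n x
  proof (cases n)
    case 0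
    then show ?thesis using \<theta> unfolding real_differentiable_def by auto
  next
    case (Suc k)
    have "(deriv ^^ n) \<theta> = (deriv ^^ k) \<psi>" unfolding Suc funpow_Suc_right o_def d ..
    then show ?thesis using tame_differentiable[OF \<psi>] by simp
  qed
  then show "test_function a b \<theta>" unfolding test_function_def using supp by blast
qed

text \<open>Two one-sided flat functions with steepness \<open>Suc n\<close>, one rising at
  \<open>p\<close>, one falling at \<open>q\<close>. As \<open>n\<close> grows, the product tends to
  the indicator of the open interval; this is how test functions reach interval integrals.\<close>

definition bump :: "nat \<Rightarrow> real \<Rightarrow> real \<Rightarrow> real \<Rightarrow> real" where
  "bump n p q x = flat 1 (real (Suc n) * x + - (real (Suc n) * p)) * flat 1 (- real (Suc n) * x + real (Suc n) * q)"

lemma tame_bump: "tame (bump n p q)"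
  unfolding bump_def by (intro tame.mult tame.flat)

lemma bump_eq:
  "bump n p q x = (if p < x \<and> x < q then exp (- inverse (real (Suc n) * (x - p))) * exp (- inverse (real (Suc n) * (q - x))) else 0)"
proof -
  have 1: "real (Suc n) * x + - (real (Suc n) * p) = real (Suc n) * (x - p)"
    and 2: "- real (Suc n) * x + real (Suc n) * q = real (Suc n) * (q - x)" by (auto simp: algebra_simps)
  show ?thesis unfolding bump_def 1 2 flat_def by (auto simp: zero_less_mult_iff)
qed

lemma bump_bounds: "0 \<le> bump n p q x" "bump n p q x \<le> 1"
proof -
  show "0 \<le> bump n p q x" by (simp add: bump_eq)
  show "bump n p q x \<le> 1"
  proof (cases "p < x \<and> x < q")
    case True
    then have "exp (- inverse (real (Suc n) * (x - p))) \<le> 1" "exp (- inverse (real (Suc n) * (q - x))) \<le> 1" by auto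
    then show ?thesis unfolding bump_eq using True by (simp add: mult_le_one)
  qed (auto simp: bump_eq)
qed

lemma bump_tendsto: "(\<lambda>n. bump n p q x) \<longlonglongrightarrow> indicator {p<..<q} x"
proof (cases "p < x \<and> x < q")
  case True
  have l: "(\<lambda>n. inverse (real (Suc n) * h)) \<longlonglongrightarrow> 0" for h
    using tendsto_mult_left_zero[OF LIMSEQ_inverse_real_of_nat, of "inverse h"] by simp
  have "(\<lambda>n. exp (- inverse (real (Suc n) * (x - p))) * exp (- inverse (real (Suc n) * (q - x)))) \<longlonglongrightarrow> exp (- 0) * exp (- 0)"
    by (intro tendsto_intros l)
  then show ?thesis using True unfolding bump_eq by simp
next
  case False
  then have "bump n p q x = 0" for n by (auto simp: bump_eq)
  then show ?thesis using False by auto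
qed

lemma bump_test_function:
  assumes "a < p" "q < b"
  shows "test_function a b (bump n p q)"
proof -
  obtain f' where "tame f'" "\<And>x. (bump n p q has_real_derivative f' x) (at x)"
    using tame_has_derivative[OF tame_bump] by blast
  then show ?thesis
    by (intro test_function_if_deriv(1)[where \<psi> = f' and c = p and d = q]) (use assms in \<open>auto simp: bump_eq\<close>)
qed

lemma continuous_bump: "continuous_on S (bump n p q)"
  using tame_has_derivative[OF tame_bump, of n p q]
  by (meson DERIV_isCont continuous_at_imp_continuous_on)

section \<open>Test functions and the fundamental lemma\<close>

lemma test_function_support:
  assumes "test_function a b \<theta>"
  shows "\<exists>c d. a < c \<and> d < b \<and> (\<forall>x. x \<notin> {c..d} \<longrightarrow> \<theta> x = 0)"
  using assms unfolding test_function_def by blast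

lemma test_function_regularity:
  assumes "test_function a b \<theta>"
  shows "(\<theta> has_real_derivative deriv \<theta> x) (at x)" "continuous_on S \<theta>" "continuous_on S (deriv \<theta>)"
proof -
  have D: "(deriv ^^ n) \<theta> differentiable at x" for n x using assms unfolding test_function_def by blast
  show d: "(\<theta> has_real_derivative deriv \<theta> x) (at x)" for x
    using D[of 0 x] by (simp add: DERIV_deriv_iff_real_differentiable)
  show "continuous_on S \<theta>" using d by (meson DERIV_isCont continuous_at_imp_continuous_on)
  show "continuous_on S (deriv \<theta>)"
    using D[of 1] by (auto intro!: continuous_at_imp_continuous_on differentiable_imp_continuous_within)
qed

lemma locally_integrable_times_continuous:
  assumes g: "locally_integrable a b g" and \<theta>: "continuous_on UNIV \<theta>"
    and cd: "a < c" "d < b" "\<And>x. x \<notin> {c..d} \<Longrightarrow> \<theta> x = 0"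
  shows "integrable (lebesgue_on {a<..<b}) (\<lambda>x. g x * \<theta> x)"
proof -
  have gi: "integrable (lebesgue_on {c..d}) g" using g cd unfolding locally_integrable_def by blast
  have "bounded (\<theta> ` {c..d})" by (intro compact_imp_bounded compact_continuous_image continuous_on_subset[OF \<theta>]) auto
  then obtain B where B: "\<forall>x\<in>{c..d}. \<bar>\<theta> x\<bar> \<le> B" unfolding bounded_iff by auto
  have "integrable (lebesgue_on {c..d}) (\<lambda>x. g x * \<theta> x)"
  proof (rule Bochner_Integration.integrable_bound)
    show "integrable (lebesgue_on {c..d}) (\<lambda>x. B * g x)" using gi by (rule integrable_mult_right)
    show "(\<lambda>x. g x * \<theta> x) \<in> borel_measurable (lebesgue_on {c..d})"
      by (intro borel_measurable_times borel_measurable_integrable[OF gi]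
          continuous_imp_measurable_on_sets_lebesgue continuous_on_subset[OF \<theta>]) auto
    show "AE x in lebesgue_on {c..d}. norm (g x * \<theta> x) \<le> norm (B * g x)"
    proof (rule AE_I2)
      fix x assume "x \<in> space (lebesgue_on {c..d})"
      then have "\<bar>\<theta> x\<bar> \<le> \<bar>B\<bar>" using B by force
      then show "norm (g x * \<theta> x) \<le> norm (B * g x)" by (simp add: abs_mult mult.commute mult_right_mono)
    qed
  qed
  then have "integrable lebesgue (\<lambda>x. indicator {c..d} x *\<^sub>R (g x * \<theta> x))"
    by (subst (asm) integrable_restrict_space) auto
  then have i: "integrable lebesgue (\<lambda>x. indicator {c..d} x *\<^sub>R (g x * \<theta> x))" .
  have e: "indicator {c..d} x *\<^sub>R (g x * \<theta> x) = indicator {a<..<b} x * (g x * \<theta> x)" for x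
    using cd by (cases "x \<in> {c..d}") (auto simp: indicator_def)
  show ?thesis using i unfolding integrable_on_interval_iff e .
qed

lemma L2_locally_integrable:
  assumes "f \<in> L2 a b"
  shows "locally_integrable a b f"
  unfolding locally_integrable_def
proof (intro allI impI)
  fix c d assume cd: "a < c" "d < b"
  have "integrable lebesgue (\<lambda>x. indicator {a<..<b} x * f x)"
    using L2_integrable[OF assms] unfolding integrable_on_interval_iff .
  from integrable_mult_indicator[OF _ this, of "{c..d}"]
  have i: "integrable lebesgue (\<lambda>x. indicator {c..d} x *\<^sub>R (indicator {a<..<b} x * f x))" by simp
  have e: "indicator {c..d} x *\<^sub>R (indicator {a<..<b} x * f x) = indicator {c..d} x *\<^sub>R f x" for x
    using cd by (auto simp: indicator_def)
  show "integrable (lebesgue_on {c..d}) f" using i unfolding e by (subst integrable_restrict_space) auto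
qed

text \<open>Letting \<open>n\<close> grow in the bumps gives vanishing integrals over rational
  intervals. As \<open>h\<close> is integrable only on compact parts, this is used on the intervals
  shrunk by 1 / (n + 1) at both ends, which exhaust (a,b).\<close>

lemma fundamental_lemma:
  assumes h: "locally_integrable a b h"
    and z: "\<And>n p q. p \<in> \<rat> \<Longrightarrow> q \<in> \<rat> \<Longrightarrow> a < p \<Longrightarrow> p < q \<Longrightarrow> q < b \<Longrightarrow>
        (LINT x|lebesgue_on {a<..<b}. h x * bump n p q x) = 0"
  shows "AE x in lebesgue_on {a<..<b}. h x = 0"
proof -
  have loc: "integrable (lebesgue_on {c<..<d}) h" if "a < c" "d < b" for c d
  proof -
    have "integrable (lebesgue_on {c..d}) h" using h that unfolding locally_integrable_def by blast
    then have "integrable lebesgue (\<lambda>x. indicator {c..d} x *\<^sub>R h x)"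
      by (subst (asm) integrable_restrict_space) auto
    from integrable_mult_indicator[OF _ this, of "{c<..<d}"]
    have i: "integrable lebesgue (\<lambda>x. indicator {c<..<d} x *\<^sub>R (indicator {c..d} x *\<^sub>R h x))" by simp
    have e: "indicator {c<..<d} x *\<^sub>R (indicator {c..d} x *\<^sub>R h x) = indicator {c<..<d} x * h x" for x
      by (auto simp: indicator_def)
    show ?thesis using i unfolding integrable_on_interval_iff e .
  qed
  have zero: "(LINT x|lebesgue_on {p<..<q}. h x) = 0" if pq: "p \<in> \<rat>" "q \<in> \<rat>" "a < p" "p < q" "q < b" for p q
  proof -
    have i: "integrable (lebesgue_on {p<..<q}) h" using loc pq by blast
    have "(\<lambda>n. LINT x|lebesgue_on {p<..<q}. h x * bump n p q x) \<longlonglongrightarrow> (LINT x|lebesgue_on {p<..<q}. h x)"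
    proof (rule integral_dominated_convergence[where w = "\<lambda>x. norm (h x)"])
      show "AE x in lebesgue_on {p<..<q}. (\<lambda>n. h x * bump n p q x) \<longlonglongrightarrow> h x"
      proof (rule AE_I2)
        fix x assume "x \<in> space (lebesgue_on {p<..<q})"
        then show "(\<lambda>n. h x * bump n p q x) \<longlonglongrightarrow> h x"
          using tendsto_mult_left[OF bump_tendsto[of p q x], of "h x"] by simp
      qed
      show "AE x in lebesgue_on {p<..<q}. norm (h x * bump n p q x) \<le> norm (h x)" for n
        using bump_bounds by (auto simp: abs_mult mult_left_le)
      show "(\<lambda>x. h x * bump n p q x) \<in> borel_measurable (lebesgue_on {p<..<q})" for n
        by (intro borel_measurable_times borel_measurable_integrable[OF i] continuous_imp_measurable_on_sets_lebesgue continuous_bump) auto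
    qed (use i in auto)
    moreover have "(LINT x|lebesgue_on {p<..<q}. h x * bump n p q x) = 0" for n
    proof -
      have "(LINT x|lebesgue_on {p<..<q}. h x * bump n p q x) = (LINT x|lebesgue_on {a<..<b}. h x * bump n p q x)"
        unfolding integral_on_interval using pq
        by (intro Bochner_Integration.integral_cong) (auto simp: indicator_def bump_eq)
      then show ?thesis using z[OF pq] by simp
    qed
    ultimately show ?thesis by (simp add: LIMSEQ_const_iff)
  qed
  have "AE x in lebesgue. a + 1 / real (Suc n) < x \<and> x < b - 1 / real (Suc n) \<longrightarrow> h x = 0" for n
  proof -
    let ?e = "1 / real (Suc n)"
    have "AE x in lebesgue_on {a + ?e<..<b - ?e}. h x = 0"
    proof (rule rational_integrals_zero_imp_AE_zero[OF loc])
      fix p q assume r: "p \<in> \<rat>" "q \<in> \<rat>" "a + ?e < p" "p < q" "q < b - ?e"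
      have "?e > 0" by simp
      then have "a < p" "q < b" using r by linarith+
      then show "(LINT x|lebesgue_on {p<..<q}. h x) = 0" using zero r by blast
    qed auto
    then show ?thesis unfolding AE_on_interval_iff .
  qed
  then have "AE x in lebesgue. \<forall>n. a + 1 / real (Suc n) < x \<and> x < b - 1 / real (Suc n) \<longrightarrow> h x = 0"
    unfolding AE_all_countable by blast
  then show ?thesis unfolding AE_on_interval_iff
  proof eventually_elim
    case (elim x)
    show ?case
    proof
      assume x: "a < x \<and> x < b"
      then obtain n where "1 / real (Suc n) < min (x - a) (b - x)"
        using nat_approx_posE[of "min (x - a) (b - x)"] by auto
      then have "a + 1 / real (Suc n) < x \<and> x < b - 1 / real (Suc n)" by linarith
      then show "h x = 0" using elim by blast
    qed
  qed
qed

lemma distr_deriv_unique: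
  assumes g: "has_distr_deriv a b v g" and g': "has_distr_deriv a b v g'"
  shows "AE x in lebesgue_on {a<..<b}. g x = g' x"
proof -
  have lg: "locally_integrable a b g" "locally_integrable a b g'" using g g' unfolding has_distr_deriv_def by blast+
  then have "locally_integrable a b (\<lambda>x. g x - g' x)" unfolding locally_integrable_def by auto
  then have "AE x in lebesgue_on {a<..<b}. g x - g' x = 0"
  proof (rule fundamental_lemma)
    fix n p q assume pq: "p \<in> \<rat>" "q \<in> \<rat>" "a < p" "p < q" "q < b"
    have t: "test_function a b (bump n p q)" using pq by (intro bump_test_function) auto
    have i: "integrable (lebesgue_on {a<..<b}) (\<lambda>x. f x * bump n p q x)" if "locally_integrable a b f" for f
      by (rule locally_integrable_times_continuous[OF that continuous_bump pq(3,5)]) (auto simp: bump_eq)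
    have "(LINT x|lebesgue_on {a<..<b}. g x * bump n p q x) = (LINT x|lebesgue_on {a<..<b}. g' x * bump n p q x)"
    proof -
      have "(LINT x|lebesgue_on {a<..<b}. v x * deriv (bump n p q) x) = - (LINT x|lebesgue_on {a<..<b}. f x * bump n p q x)"
        if "has_distr_deriv a b v f" for f
        using that t unfolding has_distr_deriv_def by simp
      from this[OF g] this[OF g'] show ?thesis by simp
    qed
    then show "(LINT x|lebesgue_on {a<..<b}. (g x - g' x) * bump n p q x) = 0"
      using i[OF lg(1)] i[OF lg(2)] by (simp add: left_diff_distrib)
  qed
  then show ?thesis by eventually_elim simp
qed

lemma integral_on_interval_continuous:
  fixes f :: "real \<Rightarrow> real"
  assumes "continuous_on {a..b} f"
  shows "(LINT x|lebesgue_on {a<..<b}. f x) = integral {a..b} f"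
  using lebesgue_integral_eq_integral[OF L2_integrable[OF L2_continuous[OF assms]]] integral_open_interval_real[of a b f] by simp

text \<open>Integration by parts; the support of the test function removes the boundary terms. It
  serves in space for explicit primitives and in time for the equations of motion.\<close>

lemma C1_has_distr_deriv:
  assumes F: "\<And>t. t \<in> {a..b} \<Longrightarrow> (F has_real_derivative h t) (at t within {a..b})"
    and h: "continuous_on {a..b} h" and ab: "a \<le> b"
  shows "has_distr_deriv a b F h"
proof -
  have Fc: "continuous_on {a..b} F"
    using F by (meson DERIV_continuous continuous_on_eq_continuous_within)
  have "(LINT x|lebesgue_on {a<..<b}. F x * deriv \<theta> x) = - (LINT x|lebesgue_on {a<..<b}. h x * \<theta> x)"
    if "test_function a b \<theta>" for \<theta>
  proof -
    from test_function_support[OF that] obtain c d where cd: "a < c" "d < b" "\<And>x. x \<notin> {c..d} \<Longrightarrow> \<theta> x = 0"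
      by blast
    note D = test_function_regularity(1)[OF that] and c = test_function_regularity(2,3)[OF that]
    have c1: "continuous_on {a..b} (\<lambda>x. F x * deriv \<theta> x)" "continuous_on {a..b} (\<lambda>x. h x * \<theta> x)"
      by (intro continuous_intros Fc h c)+
    have "((\<lambda>x. h x * \<theta> x + deriv \<theta> x * F x) has_integral (F b * \<theta> b - F a * \<theta> a)) {a..b}"
    proof (rule fundamental_theorem_of_calculus[OF ab])
      fix x assume x: "x \<in> {a..b}"
      have "(\<theta> has_real_derivative deriv \<theta> x) (at x within {a..b})" using D by (rule has_field_derivative_at_within)
      from DERIV_mult[OF F[OF x] this]
      show "((\<lambda>x. F x * \<theta> x) has_vector_derivative (h x * \<theta> x + deriv \<theta> x * F x)) (at x within {a..b})"
        by (simp add: has_real_derivative_iff_has_vector_derivative)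
    qed
    moreover have "\<theta> a = 0" "\<theta> b = 0" using cd by auto
    ultimately have "integral {a..b} (\<lambda>x. h x * \<theta> x + deriv \<theta> x * F x) = 0" by (simp add: integral_unique)
    then have "integral {a..b} (\<lambda>x. h x * \<theta> x) + integral {a..b} (\<lambda>x. F x * deriv \<theta> x) = 0"
      using c1 by (subst (asm) Henstock_Kurzweil_Integration.integral_add)
        (auto intro: integrable_continuous_real simp: mult.commute)
    then show ?thesis unfolding integral_on_interval_continuous[OF c1(1)] integral_on_interval_continuous[OF c1(2)] by simp
  qed
  then show ?thesis unfolding has_distr_deriv_def
    using L2_locally_integrable[OF L2_continuous[OF Fc]] L2_locally_integrable[OF L2_continuous[OF h]] by blast
qed

section \<open>The integration operator and the Sobolev spaces\<close>

lemma AE_interval_exists: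
  assumes ae: "AE x in lebesgue_on {a<..<b::real}. Q x" and cd: "a \<le> c" "c < d" "d \<le> b"
  shows "\<exists>x. c < x \<and> x < d \<and> Q x"
proof (rule ccontr)
  assume n: "\<not> (\<exists>x. c < x \<and> x < d \<and> Q x)"
  have "AE x in lebesgue. a < x \<and> x < b \<longrightarrow> Q x" using ae unfolding AE_on_interval_iff .
  then have "AE x in lebesgue. x \<notin> {c<..<d}"
    by eventually_elim (use n cd in auto)
  then have "{c<..<d} \<in> null_sets lebesgue" by (simp add: AE_iff_null_sets)
  then have "emeasure lebesgue {c<..<d} = 0" by auto
  then show False using cd by simp
qed

lemma indicator_L2: "indicator {0<..<x} \<in> L2 0 L"
proof (rule L2_bounded[of _ _ _ 1])
  show "indicat_real {0<..<x} \<in> borel_measurable (lebesgue_on {0<..<L})"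
    unfolding measurable_on_interval_iff by (intro borel_measurable_times borel_measurable_indicator) auto
qed (auto simp: indicator_def)

text \<open>The primitive of \<open>a\<close> starting at 0, as an inner product: linearity, the
  uniform bound and pointwise convergence under weak convergence are then immediate.\<close>

definition pr :: "real \<Rightarrow> l2 \<Rightarrow> real \<Rightarrow> real" where
  "pr L a x = a \<bullet> cls L (indicator {0<..<x})"

definition K_op :: "real \<Rightarrow> l2 \<Rightarrow> l2" where
  "K_op L a = cls L (pr L a)"

text \<open>Solution spaces and \<open>wderiv\<close> involve arbitrary representatives, so
  functions are tied to classes by a relation, not a map.\<close>

definition rep :: "real \<Rightarrow> (real \<Rightarrow> real) \<Rightarrow> l2 \<Rightarrow> bool" where
  "rep L v a \<longleftrightarrow> (AE x in lebesgue_on {0<..<L}. v x = emb L a x)"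

text \<open>Codes that name no bump with rational endpoints inside (0,L) yield the zero function,
  which is harmless in a total system.\<close>

definition bump_seq :: "real \<Rightarrow> nat \<Rightarrow> real \<Rightarrow> real" where
  "bump_seq L j = (case from_nat j of (n, p, q) \<Rightarrow>
     if 0 < p \<and> p < q \<and> real_of_rat q < L then bump n (real_of_rat p) (real_of_rat q) else (\<lambda>x. 0))"

context
  fixes L :: real
  assumes L: "L > 0"
begin

lemma rep_L2: "rep L v a \<Longrightarrow> v \<in> L2 0 L"
  unfolding rep_def by (rule L2_cong_AE[OF emb_L2[OF L]]) (auto elim: eventually_mono)

lemma rep_cls: "v \<in> L2 0 L \<Longrightarrow> rep L v (cls L v)"
  unfolding rep_def by (drule emb_cls[OF L]) (auto elim: eventually_mono)

lemma rep_emb: "rep L (emb L a) a"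
  by (simp add: rep_def)

lemma rep_iff_cls: "rep L v a \<longleftrightarrow> v \<in> L2 0 L \<and> cls L v = a"
proof
  assume r: "rep L v a"
  have "cls L v = cls L (emb L a)"
    using cls_eq_iff[OF L rep_L2[OF r] emb_L2[OF L]] r unfolding rep_def by blast
  then show "v \<in> L2 0 L \<and> cls L v = a" using rep_L2[OF r] cls_emb[OF L] by simp
qed (use rep_cls in auto)

lemma rep_inner: "rep L v a \<Longrightarrow> rep L u b \<Longrightarrow> L2_inner 0 L v u = a \<bullet> b"
  using inner_cls[OF L] rep_iff_cls by auto

lemma rep_lincomb: "rep L v a \<Longrightarrow> rep L u b \<Longrightarrow> rep L (\<lambda>x. c * v x + d * u x) (c *\<^sub>R a + d *\<^sub>R b)"
  by (simp add: rep_iff_cls L2_lincomb) (metis cls_lincomb[OF L])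

lemma rep_diff: "rep L v a \<Longrightarrow> rep L u b \<Longrightarrow> rep L (\<lambda>x. v x - u x) (a - b)"
  using rep_lincomb[of v a u b 1 "-1"] by simp

lemma rep_cong: "rep L v a \<Longrightarrow> AE x in lebesgue_on {0<..<L}. v x = u x \<Longrightarrow> rep L u a"
  unfolding rep_def by (auto elim: eventually_elim2)

lemma rep_norm: "rep L v a \<Longrightarrow> L2_norm 0 L v = norm a"
  using rep_inner[of v a v a] by (simp add: L2_norm_def norm_eq_sqrt_inner)

lemma pr_linear: "pr L (c *\<^sub>R a + d *\<^sub>R b) x = c * pr L a x + d * pr L b x"
  by (simp add: pr_def inner_add_left)

lemma L2_integrable_on:
  assumes f: "f \<in> L2 0 L"
  shows "f integrable_on {0..L}"
  using integrable_on_lebesgue_on[OF L2_integrable[OF f]] integrable_on_open_interval_real[of f 0 L] by simp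

lemma pr_cls:
  assumes f: "f \<in> L2 0 L" and x: "x \<in> {0..L}"
  shows "pr L (cls L f) x = integral {0..x} f"
proof -
  have i: "integrable lebesgue (\<lambda>y. indicator {0<..<L} y * f y)"
    using L2_integrable[OF f] unfolding integrable_on_interval_iff .
  have e: "indicator {0<..<x} y *\<^sub>R (indicator {0<..<L} y * f y) = indicator {0<..<x} y * f y" for y
    using x by (auto simp: indicator_def)
  have "integrable lebesgue (\<lambda>y. indicator {0<..<x} y *\<^sub>R (indicator {0<..<L} y * f y))"
    by (rule integrable_mult_indicator[OF _ i]) simp
  then have ix: "integrable (lebesgue_on {0<..<x}) f" unfolding e integrable_on_interval_iff .
  have "pr L (cls L f) x = L2_inner 0 L f (indicator {0<..<x})"
    unfolding pr_def by (rule inner_cls[OF L f indicator_L2])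
  also have "\<dots> = integral\<^sup>L (lebesgue_on {0<..<x}) f"
    unfolding L2_inner_def integral_on_interval
    by (rule Bochner_Integration.integral_cong) (use x in \<open>auto simp: indicator_def\<close>)
  also have "\<dots> = integral {0<..<x} f" by (rule lebesgue_integral_eq_integral[OF ix]) simp
  finally show ?thesis by (simp add: integral_open_interval_real)
qed

lemma pr_eq_integral: "x \<in> {0..L} \<Longrightarrow> pr L a x = integral {0..x} (emb L a)"
  using pr_cls[OF emb_L2[OF L, of a]] by (simp add: cls_emb[OF L])

lemma continuous_pr: "continuous_on {0..L} (pr L a)"
  using indefinite_integral_continuous_1[OF L2_integrable_on[OF emb_L2[OF L, of a]]]
  by (rule continuous_on_eq) (simp add: pr_eq_integral)

lemma pr_0: "pr L a 0 = 0"
  using pr_eq_integral[of 0 a] L by simp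

lemma pr_L2: "pr L a \<in> L2 0 L"
  by (rule L2_continuous[OF continuous_pr])

lemma norm_cls_indicator: "norm (cls L (indicator {0<..<x})) \<le> sqrt L"
proof -
  have "L2_inner 0 L (indicator {0<..<x}) (indicator {0<..<x}) \<le> (LINT y|lebesgue_on {0<..<L}. 1)"
    unfolding L2_inner_def
    by (rule integral_mono[OF L2_mult[OF indicator_L2 indicator_L2] L2_integrable[OF L2_const]]) (auto simp: indicator_def)
  also have "\<dots> = L" using L by (simp add: measure_restrict_space)
  finally show ?thesis
    by (simp add: norm_cls[OF L indicator_L2] L2_norm_def)
qed

lemma pr_bound: "\<bar>pr L a x\<bar> \<le> norm a * sqrt L"
  unfolding pr_def
  by (rule order_trans[OF Cauchy_Schwarz_ineq2 mult_left_mono[OF norm_cls_indicator]]) simp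

lemma rep_pr: "rep L (pr L a) (K_op L a)"
  by (simp add: rep_iff_cls K_op_def pr_L2)

lemma K_lincomb: "K_op L (c *\<^sub>R a + d *\<^sub>R b) = c *\<^sub>R K_op L a + d *\<^sub>R K_op L b"
proof -
  have "pr L (c *\<^sub>R a + d *\<^sub>R b) = (\<lambda>x. c * pr L a x + d * pr L b x)"
    by (intro ext pr_linear)
  then show ?thesis
    using rep_lincomb[OF rep_pr[of a] rep_pr[of b], of c d] by (simp add: rep_iff_cls K_op_def)
qed

lemma bounded_linear_K: "bounded_linear (K_op L)"
proof (rule bounded_linear_intro[where K = L])
  show "K_op L (a + b) = K_op L a + K_op L b" for a b
    using K_lincomb[of 1 a 1 b] by simp
  show "K_op L (c *\<^sub>R a) = c *\<^sub>R K_op L a" for c a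
    using K_lincomb[of c a 0 a] by simp
  show "norm (K_op L a) \<le> norm a * L" for a
  proof -
    have "L2_inner 0 L (pr L a) (pr L a) \<le> (LINT y|lebesgue_on {0<..<L}. (norm a * sqrt L)\<^sup>2)"
      unfolding L2_inner_def
    proof (rule integral_mono[OF L2_mult[OF pr_L2 pr_L2] L2_integrable[OF L2_const]])
      fix x
      have "\<bar>pr L a x\<bar>\<^sup>2 \<le> (norm a * sqrt L)\<^sup>2" by (intro power_mono pr_bound) auto
      then show "pr L a x * pr L a x \<le> (norm a * sqrt L)\<^sup>2" by (simp add: power2_eq_square)
    qed
    also have "\<dots> = (norm a * sqrt L)\<^sup>2 * L" using L by (simp add: measure_restrict_space)
    also have "\<dots> = (norm a * L)\<^sup>2" using L by (simp add: power_mult_distrib) (simp add: power2_eq_square)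
    finally have "(norm (K_op L a))\<^sup>2 \<le> (norm a * L)\<^sup>2"
      by (simp add: rep_norm[OF rep_pr, symmetric] L2_norm_square)
    then show ?thesis by (rule power2_le_imp_le) (use L in auto)
  qed
qed

text \<open>Weak convergence gives convergence of \<open>pr\<close> at every point,
  \<open>pr_bound\<close> a common constant bound, and dominated convergence the convergence in
  norm.\<close>

lemma K_compact:
  assumes C: "\<And>n. norm (v n) \<le> C" and w: "\<And>l. bounded_linear l \<Longrightarrow> (\<lambda>n. l (v n) :: real) \<longlonglongrightarrow> l y"
  shows "(\<lambda>n. K_op L (v n)) \<longlonglongrightarrow> K_op L y"
proof -
  define B where "B = C * sqrt L + norm y * sqrt L"
  have d: "norm (K_op L (v n) - K_op L y) = L2_norm 0 L (\<lambda>x. pr L (v n) x - pr L y x)" for n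
    by (rule rep_norm[symmetric]) (rule rep_diff[OF rep_pr rep_pr])
  have b: "\<bar>pr L (v n) x - pr L y x\<bar> \<le> B" for n x
  proof -
    have "norm (v n) * sqrt L \<le> C * sqrt L" using C L by (intro mult_right_mono) auto
    then show ?thesis using pr_bound[of "v n" x] pr_bound[of y x] unfolding B_def by linarith
  qed
  have "(\<lambda>n. LINT x|lebesgue_on {0<..<L}. (pr L (v n) x - pr L y x) * (pr L (v n) x - pr L y x)) \<longlonglongrightarrow> (LINT x|lebesgue_on {0<..<L}. 0)"
  proof (rule integral_dominated_convergence[where w = "\<lambda>x. B * B"])
    show "AE x in lebesgue_on {0<..<L}. (\<lambda>n. (pr L (v n) x - pr L y x) * (pr L (v n) x - pr L y x)) \<longlonglongrightarrow> 0"
    proof (rule AE_I2)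
      fix x
      have "(\<lambda>n. pr L (v n) x) \<longlonglongrightarrow> pr L y x" unfolding pr_def by (rule w) (rule bounded_linear_inner_left)
      then have "(\<lambda>n. pr L (v n) x - pr L y x) \<longlonglongrightarrow> 0" by (simp add: LIM_zero)
      from tendsto_mult[OF this this] show "(\<lambda>n. (pr L (v n) x - pr L y x) * (pr L (v n) x - pr L y x)) \<longlonglongrightarrow> 0" by simp
    qed
    show "AE x in lebesgue_on {0<..<L}. norm ((pr L (v n) x - pr L y x) * (pr L (v n) x - pr L y x)) \<le> B * B" for n
    proof (rule AE_I2)
      fix x
      show "norm ((pr L (v n) x - pr L y x) * (pr L (v n) x - pr L y x)) \<le> B * B"
        using b[of n x] unfolding real_norm_def abs_mult by (intro mult_mono) auto
    qed
    show "(\<lambda>x. (pr L (v n) x - pr L y x) * (pr L (v n) x - pr L y x)) \<in> borel_measurable (lebesgue_on {0<..<L})" for n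
      by (intro borel_measurable_times L2_measurable[OF L2_diff[OF pr_L2 pr_L2]])
  qed (use L2_integrable[OF L2_const] in auto)
  then have "(\<lambda>n. (norm (K_op L (v n) - K_op L y))\<^sup>2) \<longlonglongrightarrow> 0"
    unfolding d L2_norm_square by (simp add: L2_inner_def)
  then have "(\<lambda>n. sqrt ((norm (K_op L (v n) - K_op L y))\<^sup>2)) \<longlonglongrightarrow> sqrt 0" by (rule tendsto_real_sqrt)
  then have "(\<lambda>n. norm (K_op L (v n) - K_op L y)) \<longlonglongrightarrow> 0" by simp
  then have "(\<lambda>n. K_op L (v n) - K_op L y) \<longlonglongrightarrow> 0" by (simp only: tendsto_norm_zero_iff)
  then show ?thesis by (simp only: LIM_zero_iff)
qed

lemma continuous_bump_seq: "continuous_on S (bump_seq L j)"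
  unfolding bump_seq_def by (auto split: prod.split intro: continuous_bump)

lemma bump_seq_L2: "bump_seq L j \<in> L2 0 L"
  by (rule L2_continuous[OF continuous_bump_seq])

lemma orthogonal_bumps_imp_0:
  assumes "\<And>n p q. 0 < p \<Longrightarrow> p < q \<Longrightarrow> q < L \<Longrightarrow> p \<in> \<rat> \<Longrightarrow> q \<in> \<rat> \<Longrightarrow> x \<bullet> cls L (bump n p q) = 0"
  shows "x = 0"
proof -
  have "AE y in lebesgue_on {0<..<L}. emb L x y = 0"
  proof (rule fundamental_lemma[OF L2_locally_integrable[OF emb_L2[OF L]]])
    fix n p q assume pq: "p \<in> \<rat>" "q \<in> \<rat>" "0 < p" "p < q" "q < L"
    have "L2_inner 0 L (emb L x) (bump n p q) = x \<bullet> cls L (bump n p q)"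
      by (rule rep_inner[OF rep_emb rep_cls[OF L2_continuous[OF continuous_bump]]])
    then show "(LINT y|lebesgue_on {0<..<L}. emb L x y * bump n p q y) = 0"
      using assms[OF pq(3,4,5,1,2)] by (simp add: L2_inner_def)
  qed
  then have "L2_inner 0 L (emb L x) (emb L x) = 0" using L2_inner_eq_0_iff[OF emb_L2[OF L]] by blast
  then show ?thesis by (simp add: inner_emb[OF L])
qed

lemma bump_seq_total:
  assumes x: "\<And>j. x \<bullet> cls L (bump_seq L j) = 0"
  shows "x = 0"
proof (rule orthogonal_bumps_imp_0)
  fix n p q assume pq: "0 < p" "p < q" "q < L" "p \<in> \<rat>" "q \<in> \<rat>"
  then obtain p' q' where r: "p = real_of_rat p'" "q = real_of_rat q'" by (auto elim!: Rats_cases)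
  have "bump_seq L (to_nat (n, p', q')) = bump n p q"
    using pq unfolding r by (simp add: bump_seq_def of_rat_less)
  then show "x \<bullet> cls L (bump n p q) = 0" using x by metis
qed

lemma test_function_L2:
  assumes "test_function a b \<theta>"
  shows "\<theta> \<in> L2 0 L" "deriv \<theta> \<in> L2 0 L"
  using test_function_regularity(2,3)[OF assms] L2_continuous by blast+

lemma pr_has_distr_deriv:
  assumes f: "continuous_on {0..L} f"
  shows "has_distr_deriv 0 L (pr L (cls L f)) f"
proof (rule C1_has_distr_deriv[OF _ f])
  fix t assume t: "t \<in> {0..L}"
  have fL: "f \<in> L2 0 L" by (rule L2_continuous[OF f])
  have "((\<lambda>x. integral {0..x} f) has_vector_derivative f t) (at t within {0..L})"
    using integral_has_vector_derivative[OF f t] .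
  then have "(pr L (cls L f) has_vector_derivative f t) (at t within {0..L})"
    by (rule has_vector_derivative_transform[OF t, rotated]) (simp add: pr_cls[OF fL])
  then show "(pr L (cls L f) has_real_derivative f t) (at t within {0..L})"
    by (simp add: has_real_derivative_iff_has_vector_derivative)
qed (use L in simp)

lemma K_integration_by_parts:
  assumes \<theta>: "test_function 0 L \<theta>"
  shows "K_op L a \<bullet> cls L (deriv \<theta>) = - (a \<bullet> cls L \<theta>)"
proof -
  \<comment> \<open>Both sides are continuous in \<open>a\<close>, so it suffices to treat the total system of bump functions,
    for which the identity is the classical one.\<close>
  define S where "S = {a. K_op L a \<bullet> cls L (deriv \<theta>) + a \<bullet> cls L \<theta> = 0}"
  interpret K: bounded_linear "K_op L" by (rule bounded_linear_K)
  define g where "g j = cls L (bump_seq L j)" for j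
  have g_tot: "x = 0" if "\<And>j. x \<bullet> g j = 0" for x using bump_seq_total that unfolding g_def by blast
  have sub: "subspace S" unfolding S_def
  proof (rule subspaceI)
    fix x y assume "x \<in> {a. K_op L a \<bullet> cls L (deriv \<theta>) + a \<bullet> cls L \<theta> = 0}" "y \<in> {a. K_op L a \<bullet> cls L (deriv \<theta>) + a \<bullet> cls L \<theta> = 0}"
    then show "x + y \<in> {a. K_op L a \<bullet> cls L (deriv \<theta>) + a \<bullet> cls L \<theta> = 0}"
      by (simp add: K.add inner_add_left)
  next
    fix c x assume "x \<in> {a. K_op L a \<bullet> cls L (deriv \<theta>) + a \<bullet> cls L \<theta> = 0}"
    then show "c *\<^sub>R x \<in> {a. K_op L a \<bullet> cls L (deriv \<theta>) + a \<bullet> cls L \<theta> = 0}"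
      by (simp add: K.scaleR flip: distrib_left)
  qed (simp add: K.zero)
  have "a \<in> S"
  proof (rule ip.total_induct[OF ip_gram_schmidt[of g, OF g_tot] sub])
    show "closed S" unfolding S_def
      by (intro closed_Collect_eq continuous_intros K.continuous_on)
    have "g j \<in> S" for j
    proof -
      have r: "rep L (pr L (g j)) (K_op L (g j))" "rep L (bump_seq L j) (g j)"
        "rep L \<theta> (cls L \<theta>)" "rep L (deriv \<theta>) (cls L (deriv \<theta>))"
        using rep_pr rep_cls bump_seq_L2 test_function_L2[OF \<theta>] unfolding g_def by auto
      have "has_distr_deriv 0 L (pr L (g j)) (bump_seq L j)"
        unfolding g_def by (rule pr_has_distr_deriv[OF continuous_bump_seq])
      then have "L2_inner 0 L (pr L (g j)) (deriv \<theta>) = - L2_inner 0 L (bump_seq L j) \<theta>"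
        using \<theta> unfolding has_distr_deriv_def L2_inner_def by blast
      then show ?thesis unfolding S_def using r by (simp add: rep_inner)
    qed
    then have "span (range g) \<subseteq> S" using sub by (intro span_minimal) auto
    then show "ipg.gram_schmidt g j \<in> S" for j using ipg.gram_schmidt_in_span[of g j] by blast
  qed
  then show ?thesis unfolding S_def by simp
qed

lemma has_distr_deriv_rep:
  assumes v: "rep L v (K_op L a)" and w: "rep L w a"
  shows "has_distr_deriv 0 L v w"
proof -
  have "(LINT x|lebesgue_on {0<..<L}. v x * deriv \<theta> x) = - (LINT x|lebesgue_on {0<..<L}. w x * \<theta> x)"
    if \<theta>: "test_function 0 L \<theta>" for \<theta>
    using K_integration_by_parts[OF \<theta>, of a] rep_inner[OF v rep_cls[OF test_function_L2(2)[OF \<theta>]]]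
      rep_inner[OF w rep_cls[OF test_function_L2(1)[OF \<theta>]]]
    by (simp add: L2_inner_def)
  then show ?thesis unfolding has_distr_deriv_def
    using L2_locally_integrable rep_L2 v w by blast
qed

text \<open>The choice in \<open>wderiv\<close> picks a weak derivative once one exists, and any two
  agree almost everywhere.\<close>

lemma wderiv_rep_if_deriv:
  assumes d: "has_distr_deriv 0 L v w" and w: "rep L w a"
  shows "rep L (wderiv L v) a"
proof -
  have "has_distr_deriv 0 L v (wderiv L v)" unfolding wderiv_def by (rule someI[of "has_distr_deriv 0 L v", OF d])
  from distr_deriv_unique[OF d this] show ?thesis by (rule rep_cong[OF w])
qed

lemma rep_wderiv: "rep L v (K_op L a) \<Longrightarrow> rep L (wderiv L v) a"
  by (rule wderiv_rep_if_deriv[OF has_distr_deriv_rep[OF _ rep_emb] rep_emb])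

lemma rep_vanishes:
  assumes "rep L v (K_op L a)"
  shows "vanishes_at_0 L v"
proof -
  have "AE x in lebesgue_on {0<..<L}. v x = pr L a x"
    using assms rep_pr[of a] unfolding rep_def by eventually_elim simp
  then show ?thesis unfolding vanishes_at_0_def using continuous_pr pr_0 by blast
qed

lemma bump_integral_pos:
  assumes "0 < p" "p < q" "q < L"
  shows "(LINT x|lebesgue_on {0<..<L}. bump n p q x) > 0"
proof -
  have i: "integrable (lebesgue_on {0<..<L}) (bump n p q)"
    by (rule L2_integrable[OF L2_continuous[OF continuous_bump]])
  have "(LINT x|lebesgue_on {0<..<L}. bump n p q x) \<noteq> 0"
  proof
    assume "(LINT x|lebesgue_on {0<..<L}. bump n p q x) = 0"
    then have "AE x in lebesgue_on {0<..<L}. bump n p q x = 0"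
      using integral_nonneg_eq_0_iff_AE[OF i] bump_bounds by simp
    from AE_interval_exists[OF this, of p q] assms obtain x where "p < x" "x < q" "bump n p q x = 0" by auto
    then show False by (simp add: bump_eq)
  qed
  moreover have "(LINT x|lebesgue_on {0<..<L}. bump n p q x) \<ge> 0" using bump_bounds by simp
  ultimately show ?thesis by simp
qed

text \<open>The primitive from 0 vanishes left of \<open>c\<close> trivially and right of
  \<open>d\<close> because the mean is zero, so its support is compact in (0,L).\<close>

lemma mean_zero_antiderivative:
  assumes \<psi>: "tame \<psi>" and supp: "0 < c" "c < d" "d < L" "\<And>x. x \<notin> {c..d} \<Longrightarrow> \<psi> x = 0"
    and mean: "(LINT x|lebesgue_on {0<..<L}. \<psi> x) = 0"
  shows "\<exists>\<theta>. test_function 0 L \<theta> \<and> deriv \<theta> = \<psi>"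
proof -
  define \<theta> where "\<theta> x = integral {0..x} \<psi>" for x
  have cont: "continuous_on S \<psi>" for S
    using tame_has_derivative[OF \<psi>] by (meson DERIV_isCont continuous_at_imp_continuous_on)
  have int: "\<psi> integrable_on {x..y}" for x y by (rule integrable_continuous_real[OF cont])
  have "integral {0..L} \<psi> = 0" using mean integral_on_interval_continuous[OF cont] by simp
  moreover have z: "integral {x..y} \<psi> = 0" if "y \<le> c \<or> d \<le> x" for x y
  proof -
    have "integral {x<..<y} \<psi> = integral {x<..<y} (\<lambda>_. 0)"
      by (rule Henstock_Kurzweil_Integration.integral_cong) (use that supp in auto)
    then show ?thesis by (simp add: integral_open_interval_real)
  qed
  moreover have "integral {0..d} \<psi> + integral {d..L} \<psi> = integral {0..L} \<psi>"
    by (rule Henstock_Kurzweil_Integration.integral_combine[OF _ _ int]) (use supp in auto)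
  ultimately have d0: "integral {0..d} \<psi> = 0" by simp
  have \<theta>0: "\<theta> x = 0" if "x \<notin> {c..d}" for x
  proof (cases "x < c")
    case False
    then have x: "d < x" using that by auto
    have "integral {0..d} \<psi> + integral {d..x} \<psi> = integral {0..x} \<psi>"
      by (rule Henstock_Kurzweil_Integration.integral_combine[OF _ _ int]) (use supp x in auto)
    then show ?thesis unfolding \<theta>_def using z[of x d] d0 by simp
  qed (simp add: \<theta>_def z)
  \<comment> \<open>For negative \<open>x\<close> the interval \<open>{0..x}\<close> is empty and
    the integral is 0; the fundamental theorem is used only for \<open>x \<ge> c\<close>, where
    \<open>x\<close> is interior to \<open>{0..x + 1}\<close>.\<close>
  have "(\<theta> has_real_derivative \<psi> x) (at x)" for x
  proof (cases "x < c")
    case True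
    have "((\<lambda>x. 0) has_real_derivative \<psi> x) (at x)" using True supp by simp
    then show ?thesis
      by (rule has_field_derivative_transform_within_open[of _ _ _ "{..<c}"]) (use True \<theta>0 in auto)
  next
    case False
    then have x: "x \<in> {0<..<x + 1}" using supp by auto
    have "(\<theta> has_real_derivative \<psi> x) (at x within {0..x + 1})"
      unfolding \<theta>_def using integral_has_real_derivative[OF cont, of x 0 "x + 1"] x by auto
    then have "(\<theta> has_real_derivative \<psi> x) (at x within {0<..<x + 1})"
      by (rule DERIV_subset) auto
    then show ?thesis using x by (simp add: at_within_open[OF x])
  qed
  then show ?thesis
    using test_function_if_deriv[where \<theta> = \<theta>, OF _ \<psi> supp(1,3)] \<theta>0 by blast
qed

lemma zero_distr_deriv_imp_constant:
  assumes w: "w \<in> L2 0 L"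
    and z: "\<And>\<theta>. test_function 0 L \<theta> \<Longrightarrow> (LINT x|lebesgue_on {0<..<L}. w x * deriv \<theta> x) = 0"
  shows "\<exists>k. AE x in lebesgue_on {0<..<L}. w x = k"
proof -
  \<comment> \<open>For a bump \<open>\<phi>\<close>, the function \<open>\<phi> - c \<rho>\<close> with \<open>c\<close> chosen to have mean zero is the derivative of
    a test function, so \<open>w\<close> pairs with \<open>\<phi>\<close> like a constant.\<close>
  define \<rho> where "\<rho> = bump 0 (L / 3) (2 * L / 3)"
  define I where "I f = (LINT x|lebesgue_on {0<..<L}. f x)" for f :: "real \<Rightarrow> real"
  have \<rho>: "I \<rho> > 0" unfolding \<rho>_def I_def by (rule bump_integral_pos) (use L in auto)
  have bL: "bump n p q \<in> L2 0 L" for n p q by (rule L2_continuous[OF continuous_bump])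
  have \<rho>L: "\<rho> \<in> L2 0 L" unfolding \<rho>_def by (rule bL)
  define k where "k = I (\<lambda>x. w x * \<rho> x) / I \<rho>"
  have "AE x in lebesgue_on {0<..<L}. w x - k = 0"
  proof (rule fundamental_lemma[OF L2_locally_integrable[OF L2_diff[OF w L2_const]]])
    fix n p q assume pq: "0 < p" "p < q" "q < L"
    define \<phi> where "\<phi> = bump n p q"
    have \<phi>L: "\<phi> \<in> L2 0 L" unfolding \<phi>_def by (rule bL)
    define c where "c = I \<phi> / I \<rho>"
    define \<psi> where "\<psi> x = \<phi> x + (- c) * \<rho> x" for x
    have "tame \<psi>" unfolding \<psi>_def \<phi>_def \<rho>_def by (intro tame.add tame.mult tame.const tame_bump)
    moreover have "\<psi> x = 0" if "x \<notin> {min p (L / 3)..max q (2 * L / 3)}" for x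
      using that unfolding \<psi>_def \<phi>_def \<rho>_def bump_eq by auto
    moreover have "I \<psi> = 0"
    proof -
      have "I \<psi> = I \<phi> + (- c) * I \<rho>" unfolding I_def \<psi>_def
        using L2_integrable[OF \<phi>L] L2_integrable[OF \<rho>L] by (subst Bochner_Integration.integral_add) auto
      then show ?thesis using \<rho> by (simp add: c_def)
    qed
    ultimately obtain \<theta> where "test_function 0 L \<theta>" "deriv \<theta> = \<psi>"
      using mean_zero_antiderivative[of \<psi> "min p (L / 3)" "max q (2 * L / 3)"] pq L unfolding I_def by fastforce
    then have "I (\<lambda>x. w x * \<psi> x) = 0" using z unfolding I_def by blast
    moreover have "I (\<lambda>x. w x * \<psi> x) = I (\<lambda>x. w x * \<phi> x) - c * I (\<lambda>x. w x * \<rho> x)"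
    proof -
      have e: "w x * \<psi> x = w x * \<phi> x - c * (w x * \<rho> x)" for x by (simp add: \<psi>_def algebra_simps)
      show ?thesis unfolding I_def e
        using L2_mult[OF w \<phi>L] L2_mult[OF w \<rho>L] by simp
    qed
    moreover have "I (\<lambda>x. (w x - k) * \<phi> x) = I (\<lambda>x. w x * \<phi> x) - k * I \<phi>"
      unfolding I_def left_diff_distrib using L2_mult[OF w \<phi>L] L2_integrable[OF \<phi>L] by simp
    ultimately have "I (\<lambda>x. (w x - k) * \<phi> x) = 0" by (simp add: c_def k_def)
    then show "(LINT x|lebesgue_on {0<..<L}. (w x - k) * bump n p q x) = 0" unfolding I_def \<phi>_def .
  qed
  then show ?thesis by (intro exI[of _ k]) (auto elim: eventually_mono)
qed

text \<open>The difference of \<open>v\<close> and the primitive of its weak derivative has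
  derivative 0, hence is constant almost everywhere; the boundary value makes the constant
  0.\<close>

lemma rep_K_if_deriv:
  assumes v: "v \<in> L2 0 L" and d: "has_distr_deriv 0 L v g" and g: "rep L g a" and v0: "vanishes_at_0 L v"
  shows "rep L v (K_op L a)"
proof -
  define w where "w x = v x - pr L a x" for x
  have wL: "w \<in> L2 0 L" unfolding w_def by (rule L2_diff[OF v pr_L2])
  have "(LINT x|lebesgue_on {0<..<L}. w x * deriv \<theta> x) = 0" if \<theta>: "test_function 0 L \<theta>" for \<theta>
  proof -
    have "(LINT x|lebesgue_on {0<..<L}. v x * deriv \<theta> x) = - (LINT x|lebesgue_on {0<..<L}. g x * \<theta> x)"
      using d \<theta> unfolding has_distr_deriv_def by blast
    moreover have "(LINT x|lebesgue_on {0<..<L}. pr L a x * deriv \<theta> x) = - (LINT x|lebesgue_on {0<..<L}. g x * \<theta> x)"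
      using has_distr_deriv_rep[OF rep_pr g] \<theta> unfolding has_distr_deriv_def by blast
    ultimately show ?thesis unfolding w_def left_diff_distrib
      using L2_mult[OF v test_function_L2(2)[OF \<theta>]] L2_mult[OF pr_L2 test_function_L2(2)[OF \<theta>]] by simp
  qed
  then obtain k where k: "AE x in lebesgue_on {0<..<L}. w x = k"
    using zero_distr_deriv_imp_constant[OF wL] by blast
  obtain c where c: "continuous_on {0..L} c" "AE x in lebesgue_on {0<..<L}. v x = c x" "c 0 = 0"
    using v0 unfolding vanishes_at_0_def by blast
  have ae: "AE x in lebesgue_on {0<..<L}. c x - pr L a x = k"
    using k c(2) unfolding w_def by eventually_elim simp
  have cc: "continuous_on {0..L} (\<lambda>x. c x - pr L a x)" by (intro continuous_intros c(1) continuous_pr)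
  have k0: "k = 0"
  proof -
    \<comment> \<open>An identity almost everywhere says nothing at the point 0; it supplies points
      tending to 0 at which it holds, and continuity does the rest.\<close>
    have "\<forall>n. \<exists>x. 0 < x \<and> x < L / real (Suc n) \<and> c x - pr L a x = k"
    proof
      fix n
      have "L / real (Suc n) \<le> L / 1" using L by (intro divide_left_mono) auto
      then show "\<exists>x. 0 < x \<and> x < L / real (Suc n) \<and> c x - pr L a x = k"
        using AE_interval_exists[OF ae, of 0 "L / real (Suc n)"] L by simp
    qed
    from choice[OF this] obtain x where x: "\<And>n. 0 < x n" "\<And>n. x n < L / real (Suc n)" "\<And>n. c (x n) - pr L a (x n) = k" by blast
    have lim: "(\<lambda>n. L / real (Suc n)) \<longlonglongrightarrow> 0"
      using tendsto_mult_right_zero[OF LIMSEQ_inverse_real_of_nat, of L] by (simp add: divide_inverse)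
    have "x \<longlonglongrightarrow> 0"
      by (rule tendsto_sandwich[OF _ _ tendsto_const lim]) (use x in \<open>auto intro!: always_eventually less_imp_le\<close>)
    moreover have "x n \<in> {0..L}" for n
    proof -
      have "L / real (Suc n) \<le> L / 1" using L by (intro divide_left_mono) auto
      then show ?thesis using x(1)[of n] x(2)[of n] by auto
    qed
    ultimately have "(\<lambda>n. c (x n) - pr L a (x n)) \<longlonglongrightarrow> c 0 - pr L a 0"
      using cc L unfolding continuous_on_sequentially o_def by auto
    then show ?thesis using x(3) by (simp add: c(3) pr_0 LIMSEQ_const_iff)
  qed
  have "AE x in lebesgue_on {0<..<L}. pr L a x = v x"
    using k unfolding w_def k0 by eventually_elim simp
  then show ?thesis by (rule rep_cong[OF rep_pr])
qed

text \<open>The dictionary to the abstract problem: weak derivative and boundary condition together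
  say that the class is in the range of \<open>K\<close>.\<close>

lemma H1_star_iff: "v \<in> H1_star L \<longleftrightarrow> (\<exists>a. rep L v (K_op L a))"
proof
  assume "v \<in> H1_star L"
  then obtain g where "v \<in> L2 0 L" "g \<in> L2 0 L" "has_distr_deriv 0 L v g" "vanishes_at_0 L v"
    unfolding H1_star_def H1_def by blast
  then show "\<exists>a. rep L v (K_op L a)" using rep_K_if_deriv rep_cls by blast
next
  assume "\<exists>a. rep L v (K_op L a)"
  then obtain a where a: "rep L v (K_op L a)" by blast
  then show "v \<in> H1_star L"
    unfolding H1_star_def H1_def
    using has_distr_deriv_rep[OF a rep_emb] rep_L2[OF a] emb_L2[OF L] rep_vanishes[OF a] by blast
qed

text \<open>The second boundary condition concerns the chosen \<open>wderiv L v\<close>; it is first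
  moved to the weak derivative \<open>g\<close> that itself has the derivative \<open>h\<close>, and
  then \<open>rep_K_if_deriv\<close> applies twice.\<close>

lemma H2_star_iff: "v \<in> H2_star L \<longleftrightarrow> (\<exists>a. rep L v (K_op L (K_op L a)))"
proof
  assume "v \<in> H2_star L"
  then obtain g h where v: "v \<in> L2 0 L" "g \<in> L2 0 L" "h \<in> L2 0 L" "has_distr_deriv 0 L v g" "has_distr_deriv 0 L g h"
    "vanishes_at_0 L v" "vanishes_at_0 L (wderiv L v)"
    unfolding H2_star_def H2_def by blast
  have w: "AE x in lebesgue_on {0<..<L}. wderiv L v x = g x"
    using wderiv_rep_if_deriv[OF v(4) rep_cls[OF v(2)]] rep_cls[OF v(2)] unfolding rep_def by eventually_elim simp
  obtain c where c: "continuous_on {0..L} c" "AE x in lebesgue_on {0<..<L}. wderiv L v x = c x" "c 0 = 0"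
    using v(7) unfolding vanishes_at_0_def by blast
  have "AE x in lebesgue_on {0<..<L}. g x = c x" using w c(2) by eventually_elim simp
  then have "vanishes_at_0 L g" unfolding vanishes_at_0_def using c by blast
  then have "rep L g (K_op L (cls L h))" by (rule rep_K_if_deriv[OF v(2,5) rep_cls[OF v(3)]])
  from rep_K_if_deriv[OF v(1,4) this v(6)] show "\<exists>a. rep L v (K_op L (K_op L a))" by blast
next
  assume "\<exists>a. rep L v (K_op L (K_op L a))"
  then obtain a where a: "rep L v (K_op L (K_op L a))" by blast
  have "has_distr_deriv 0 L v (emb L (K_op L a))" "has_distr_deriv 0 L (emb L (K_op L a)) (emb L a)"
    using has_distr_deriv_rep[OF a rep_emb] has_distr_deriv_rep[OF rep_emb rep_emb] by blast+
  then show "v \<in> H2_star L"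
    unfolding H2_star_def H2_def
    using rep_L2[OF a] emb_L2[OF L] rep_vanishes[OF a] rep_vanishes[OF rep_wderiv[OF a]] by blast
qed

end

section \<open>Weak solutions of the beam problem\<close>

lemma bounded_bilinear_lincomb:
  fixes f h :: "'a::real_normed_vector \<Rightarrow> 'b::real_normed_vector \<Rightarrow> real"
  assumes f: "bounded_bilinear f" and h: "bounded_bilinear h"
  shows "bounded_bilinear (\<lambda>x y. c * f x y + d * h x y)"
proof -
  interpret f: bounded_bilinear f by (rule f)
  interpret h: bounded_bilinear h by (rule h)
  obtain A where A: "A \<ge> 0" "\<And>x y. norm (f x y) \<le> norm x * norm y * A" using f.nonneg_bounded by auto
  obtain B where B: "B \<ge> 0" "\<And>x y. norm (h x y) \<le> norm x * norm y * B" using h.nonneg_bounded by auto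
  show ?thesis
  proof (rule bounded_bilinear.intro)
    have "norm (c * f x y + d * h x y) \<le> norm x * norm y * (\<bar>c\<bar> * A + \<bar>d\<bar> * B)" for x y
    proof -
      have "norm (c * f x y + d * h x y) \<le> \<bar>c\<bar> * norm (f x y) + \<bar>d\<bar> * norm (h x y)"
        by (rule order_trans[OF norm_triangle_ineq]) (simp add: abs_mult)
      also have "\<dots> \<le> \<bar>c\<bar> * (norm x * norm y * A) + \<bar>d\<bar> * (norm x * norm y * B)"
        by (intro add_mono mult_left_mono A B) auto
      finally show ?thesis by (simp add: algebra_simps)
    qed
    then show "\<exists>K. \<forall>a b. norm (c * f a b + d * h a b) \<le> norm a * norm b * K" by blast
  qed (simp_all add: f.add_left f.add_right h.add_left h.add_right f.scaleR_left f.scaleR_right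
      h.scaleR_left h.scaleR_right algebra_simps)
qed

lemma test_function_deriv:
  assumes "test_function a b \<theta>"
  shows "test_function a b (deriv \<theta>)"
proof -
  obtain c d where cd: "a < c" "d < b" "\<And>x. x \<notin> {c..d} \<Longrightarrow> \<theta> x = 0"
    using test_function_support[OF assms] by blast
  have "deriv \<theta> x = 0" if "x \<notin> {c..d}" for x
  proof -
    have "((\<lambda>x. 0) has_real_derivative 0) (at x)" by simp
    then have "(\<theta> has_real_derivative 0) (at x)"
      by (rule has_field_derivative_transform_within_open[of _ _ _ "- {c..d}"]) (use cd that in auto)
    then show ?thesis by (rule DERIV_imp_deriv)
  qed
  moreover have "(deriv ^^ n) (deriv \<theta>) differentiable at x" for n x
  proof -
    have "(deriv ^^ Suc n) \<theta> differentiable at x" using assms unfolding test_function_def by blast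
    then show ?thesis by (simp only: funpow_Suc_right o_def)
  qed
  ultimately show ?thesis unfolding test_function_def using cd by blast
qed

lemma weak_path_approximation:
  assumes "weak_path T C u"
  shows "\<exists>s. (\<forall>n. simple_function (lebesgue_on {0<..<T}) (s n)) \<and> (\<forall>t\<in>{0<..<T}. (\<lambda>n. s n t) \<longlonglongrightarrow> u t)"
  using assms unfolding weak_path_def by (elim conjE)

context
  fixes L :: real
  assumes L: "L > 0"
begin

interpretation K: bounded_linear "K_op L" by (rule bounded_linear_K[OF L])

lemma test_function_in_range_K:
  assumes "test_function 0 L \<theta>"
  shows "cls L \<theta> = K_op L (cls L (deriv \<theta>))"
proof -
  have d: "has_distr_deriv 0 L \<theta> (deriv \<theta>)"
    by (rule C1_has_distr_deriv)
       (use test_function_regularity[OF assms] L in \<open>auto intro: has_field_derivative_at_within\<close>)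
  obtain c d where "0 < c" "\<And>x. x \<notin> {c..d} \<Longrightarrow> \<theta> x = 0" using test_function_support[OF assms] by blast
  then have "\<theta> 0 = 0" by auto
  then have "vanishes_at_0 L \<theta>"
    unfolding vanishes_at_0_def using test_function_regularity(2)[OF assms] by blast
  then have "rep L \<theta> (K_op L (cls L (deriv \<theta>)))"
    by (rule rep_K_if_deriv[OF L test_function_L2(1)[OF L assms] d rep_cls[OF L test_function_L2(2)[OF L assms]]])
  then show ?thesis by (simp add: rep_iff_cls[OF L])
qed

text \<open>A test function and its derivative both vanish near 0, so each is the primitive of its
  own derivative. This puts a total system into the range of \<open>P\<close> and yields
  \<open>P_dense\<close>.\<close>

lemma bump_seq_in_range: "\<exists>\<eta>. cls L (bump_seq L j) = K_op L (K_op L \<eta>)"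
proof -
  have "test_function 0 L (\<lambda>x. 0)"
    by (rule test_function_if_deriv(1)[of _ "\<lambda>x. 0" _ "L / 3" "L / 2"]) (use L in \<open>auto intro: tame.const\<close>)
  then have t: "test_function 0 L (bump_seq L j)"
    unfolding bump_seq_def by (auto split: prod.split intro!: bump_test_function)
  show ?thesis
    using test_function_in_range_K[OF t] test_function_in_range_K[OF test_function_deriv[OF t]] by auto
qed

lemma K_inj:
  assumes "K_op L a = 0"
  shows "a = 0"
proof (rule orthogonal_bumps_imp_0[OF L])
  fix n p q assume "0 < p" "p < q" "q < L"
  then have "test_function 0 L (bump n p q)" by (intro bump_test_function)
  from K_integration_by_parts[OF L this, of a] assms show "a \<bullet> cls L (bump n p q) = 0" by simp
qed

text \<open>\<open>F\<close> maps the abstract variable to the class of the displacement or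
  velocity, and assumption \<open>X\<close> bounds it in the target norm. The functional then pulls
  back to a bounded functional, to which the weak continuity of \<open>u\<close> applies.\<close>

lemma weak_path_continuous_bounded_functional:
  assumes u: "weak_path T C u" and F: "bounded_linear F"
    and X: "\<And>v a. rep L v (F a) \<Longrightarrow> v \<in> X \<and> 0 \<le> N v \<and> N v \<le> M * norm a"
  shows "(\<lambda>t. emb L (F (u t))) \<in> C_weak T X N"
  unfolding C_weak_def
proof (intro CollectI conjI ballI allI impI)
  show "emb L (F (u t)) \<in> X" for t using X[OF rep_emb[OF L]] by blast
  fix l assume l: "bounded_functional X N l"
  interpret F: bounded_linear F by (rule F)
  obtain A where A: "\<And>v. v \<in> X \<Longrightarrow> \<bar>l v\<bar> \<le> A * N v" using l unfolding bounded_functional_def by blast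
  have lin: "l (\<lambda>x. a * v x + b * w x) = a * l v + b * l w" if "v \<in> X" "w \<in> X" for a b v w
    using l that unfolding bounded_functional_def by blast
  \<comment> \<open>\<open>l\<close> acts on functions, not on classes. Representatives of one class
    differ by a function of norm 0, so the bound on \<open>l\<close> equates their values; linearity
    of the pullback rests on this, as \<open>emb\<close> picks representatives.\<close>
  have eq: "l v = l w" if v: "rep L v (F a)" and w: "rep L w (F a)" for v w a
  proof -
    have "rep L (\<lambda>x. 1 * v x + (-1) * w x) (F 0)" using rep_lincomb[OF L v w, of 1 "-1"] by (simp add: F.zero)
    from X[OF this] have n: "(\<lambda>x. 1 * v x + (-1) * w x) \<in> X" "N (\<lambda>x. 1 * v x + (-1) * w x) = 0" by auto
    have "l (\<lambda>x. 1 * v x + (-1) * w x) = 0" using A[OF n(1)] n(2) by simp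
    then show ?thesis using lin[of v w 1 "-1"] X v w by auto
  qed
  have "bounded_linear (\<lambda>a. l (emb L (F a)))"
  proof (rule bounded_linear_intro[where K = "\<bar>A\<bar> * M"])
    fix a b
    have "rep L (\<lambda>x. 1 * emb L (F a) x + 1 * emb L (F b) x) (F (a + b))"
      using rep_lincomb[OF L rep_emb[OF L, of "F a"] rep_emb[OF L, of "F b"], of 1 1] by (simp add: F.add)
    from eq[OF rep_emb[OF L] this] show "l (emb L (F (a + b))) = l (emb L (F a)) + l (emb L (F b))"
      using lin[of "emb L (F a)" "emb L (F b)" 1 1] X[OF rep_emb[OF L]] by auto
  next
    fix c a
    have "rep L (\<lambda>x. c * emb L (F a) x + 0 * emb L (F a) x) (F (c *\<^sub>R a))"
      using rep_lincomb[OF L rep_emb[OF L, of "F a"] rep_emb[OF L, of "F a"], of c 0] by (simp add: F.scaleR)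
    from eq[OF rep_emb[OF L] this] show "l (emb L (F (c *\<^sub>R a))) = c *\<^sub>R l (emb L (F a))"
      using lin[of "emb L (F a)" "emb L (F a)" c 0] X[OF rep_emb[OF L]] by auto
  next
    fix a
    have "N (emb L (F a)) \<le> M * norm a" "0 \<le> N (emb L (F a))" "emb L (F a) \<in> X" using X[OF rep_emb[OF L]] by auto
    then have "\<bar>l (emb L (F a))\<bar> \<le> \<bar>A\<bar> * (M * norm a)"
      using order_trans[OF A[of "emb L (F a)"] mult_mono[OF abs_ge_self, of "N (emb L (F a))" "M * norm a" A]]
      by simp
    then show "norm (l (emb L (F a))) \<le> norm a * (\<bar>A\<bar> * M)" by (simp add: ac_simps)
  qed
  then show "continuous_on {0..T} (\<lambda>t. l (emb L (F (u t))))"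
    using u unfolding weak_path_def by blast
qed

lemma weak_path_strongly_measurable:
  assumes u: "weak_path T C u" and F: "bounded_linear F"
    and X: "\<And>v a. rep L v (F a) \<Longrightarrow> v \<in> X \<and> 0 \<le> N v \<and> N v \<le> M * norm a"
  shows "strongly_measurable T X N (\<lambda>t. emb L (F (u t)))"
proof -
  interpret F: bounded_linear F by (rule F)
  obtain s where s: "\<And>n. simple_function (lebesgue_on {0<..<T}) (s n)" "\<And>t. t \<in> {0<..<T} \<Longrightarrow> (\<lambda>n. s n t) \<longlonglongrightarrow> u t"
    using weak_path_approximation[OF u] by blast
  have "simple_function (lebesgue_on {0<..<T}) (\<lambda>t. emb L (F (s n t)))" for n
    by (rule simple_function_compose1[OF s(1)])
  moreover have "(\<lambda>n. N (\<lambda>x. emb L (F (s n t)) x - emb L (F (u t)) x)) \<longlonglongrightarrow> 0" if t: "t \<in> {0<..<T}" for t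
  proof (rule tendsto_sandwich[OF _ _ tendsto_const])
    have r: "rep L (\<lambda>x. emb L (F (s n t)) x - emb L (F (u t)) x) (F (s n t - u t))" for n
      unfolding F.diff by (rule rep_diff[OF L rep_emb[OF L] rep_emb[OF L]])
    show "\<forall>\<^sub>F n in sequentially. 0 \<le> N (\<lambda>x. emb L (F (s n t)) x - emb L (F (u t)) x)"
      using X[OF r] by auto
    show "\<forall>\<^sub>F n in sequentially. N (\<lambda>x. emb L (F (s n t)) x - emb L (F (u t)) x) \<le> M * norm (s n t - u t)"
      using X[OF r] by auto
    have "(\<lambda>n. s n t - u t) \<longlonglongrightarrow> 0" using s(2)[OF t] by (simp add: LIM_zero)
    then show "(\<lambda>n. M * norm (s n t - u t)) \<longlonglongrightarrow> 0"
      by (intro tendsto_mult_right_zero tendsto_norm_zero)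
  qed
  ultimately show ?thesis unfolding strongly_measurable_def using X[OF rep_emb[OF L]]
    by (intro exI[of _ "\<lambda>n t. emb L (F (s n t))"]) auto
qed

lemma weak_path_Linf:
  assumes u: "weak_path T C u" and F: "bounded_linear F"
    and X: "\<And>v a. rep L v (F a) \<Longrightarrow> v \<in> X \<and> 0 \<le> N v \<and> N v \<le> M * norm a"
  shows "(\<lambda>t. emb L (F (u t))) \<in> Linf_time T X N"
proof -
  have "N (emb L (F (u t))) \<le> \<bar>M\<bar> * C" if "t \<in> {0<..<T}" for t
  proof -
    have "N (emb L (F (u t))) \<le> M * norm (u t)" using X[OF rep_emb[OF L]] by blast
    also have "\<dots> \<le> \<bar>M\<bar> * C" using u that unfolding weak_path_def by (intro mult_mono) auto
    finally show ?thesis .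
  qed
  then have "AE t in lebesgue_on {0<..<T}. N (emb L (F (u t))) \<le> \<bar>M\<bar> * C" by (intro AE_I2) simp
  then show ?thesis
    unfolding Linf_time_def using weak_path_strongly_measurable[OF u F X] by blast
qed

lemma weak_path_L2_time:
  assumes u: "weak_path T C u" and F: "bounded_linear F"
  shows "(\<lambda>t. emb L (F (u t))) \<in> L2_time T (L2 0 L) (L2_norm 0 L)"
proof -
  interpret F: bounded_linear F by (rule F)
  obtain M where M: "M \<ge> 0" "\<And>a. norm (F a) \<le> norm a * M" using F.nonneg_bounded by auto
  have "strongly_measurable T (L2 0 L) (L2_norm 0 L) (\<lambda>t. emb L (F (u t)))"
  proof (rule weak_path_strongly_measurable[OF u F])
    fix v a assume r: "rep L v (F a)"
    then show "v \<in> L2 0 L \<and> 0 \<le> L2_norm 0 L v \<and> L2_norm 0 L v \<le> M * norm a"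
      using rep_L2[OF L r] rep_norm[OF L r] M(2)[of a] by (simp add: mult.commute)
  qed
  moreover have "integrable (lebesgue_on {0<..<T}) (\<lambda>t. (L2_norm 0 L (emb L (F (u t))))\<^sup>2)"
  proof -
    have e: "L2_norm 0 L (emb L (F (u t))) = norm (F (u t))" for t by (rule rep_norm[OF L rep_emb[OF L]])
    obtain s where s: "\<And>n. simple_function (lebesgue_on {0<..<T}) (s n)" "\<And>t. t \<in> {0<..<T} \<Longrightarrow> (\<lambda>n. s n t) \<longlonglongrightarrow> u t"
      using weak_path_approximation[OF u] by blast
    have m: "(\<lambda>t. norm (F (u t))) \<in> borel_measurable (lebesgue_on {0<..<T})"
    proof (rule borel_measurable_LIMSEQ_real)
      show "(\<lambda>t. norm (F (s n t))) \<in> borel_measurable (lebesgue_on {0<..<T})" for n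
        by (rule borel_measurable_simple_function[OF simple_function_compose1[OF s(1)]])
      show "(\<lambda>n. norm (F (s n t))) \<longlonglongrightarrow> norm (F (u t))" if "t \<in> space (lebesgue_on {0<..<T})" for t
        using s(2)[of t] that by (intro tendsto_norm F.tendsto) auto
    qed
    have "\<bar>norm (F (u t))\<bar> \<le> C * M" if "t \<in> {0<..<T}" for t
    proof -
      have "norm (u t) \<le> C" using u that unfolding weak_path_def by auto
      then have "norm (u t) * M \<le> C * M" using M(1) by (rule mult_right_mono)
      then show ?thesis using M(2)[of "u t"] by simp
    qed
    then have "(\<lambda>t. norm (F (u t))) \<in> L2 0 T" by (rule L2_bounded[OF m])
    from L2_square[OF this] show ?thesis unfolding e .
  qed
  ultimately show ?thesis unfolding L2_time_def by blast
qed

lemma beam_weak_solution: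
  assumes D: "D > 0" and b2: "b2 > 0" and p0: "p0 \<in> L2 0 L" and \<alpha>: "\<alpha> \<ge> 0" and T: "T > 0"
    and w0: "w0 \<in> H2_star L" and w1: "w1 \<in> L_alpha \<alpha> L"
  shows "\<exists>w. weak_solution L D b1 b2 U \<beta> k0 p0 \<alpha> T w0 w1 w"
proof -
  define V where "V = (if \<alpha> > 0 then K_op L else (\<lambda>a. a))"
  define P where "P = (if \<alpha> > 0 then K_op L else (\<lambda>a. K_op L (K_op L a)))"
  \<comment> \<open>The factor 1, and the summand \<open>0 * (x \<bullet> y)\<close> in
    \<open>B2\<close>, give the expressions the shape of
    \<open>bounded_bilinear_lincomb\<close>.\<close>
  define m where "m x y = 1 * (V x \<bullet> V y) + \<alpha> * (x \<bullet> y)" for x y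
  define p where "p a = cls L p0 \<bullet> V a" for a
  \<comment> \<open>The damping with \<open>k0\<close> goes through the same operator as the
    inertia, hence the full form \<open>m\<close>; the damping with \<open>\<beta>\<close> acts on
    the velocity alone.\<close>
  define B1 where "B1 x y = (- \<beta>) * (V x \<bullet> V y) + (- k0) * m x y" for x y
  define B2 where "B2 x y = (- (\<beta> * U)) * (K_op L x \<bullet> V y) + 0 * (x \<bullet> y)" for x y
  define g where "g j = cls L (bump_seq L j)" for j
  define \<kappa> where "\<kappa> = (if \<alpha> > 0 then \<alpha> else 1)"
  have V: "bounded_linear V" unfolding V_def using K.bounded_linear_axioms bounded_linear_ident by simp
  have P: "bounded_linear P"
    unfolding P_def using K.bounded_linear_axioms bounded_linear_compose[OF K.bounded_linear_axioms K.bounded_linear_axioms] by simp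
  interpret V: bounded_linear V by (rule V)
  interpret P: bounded_linear P by (rule P)
  have VP: "V (P a) = K_op L (K_op L a)" for a by (simp add: V_def P_def)
  have mb: "bounded_bilinear m" unfolding m_def
    by (intro bounded_bilinear_lincomb bounded_bilinear.comp[OF bounded_bilinear_inner V V] bounded_bilinear_inner)
  interpret m: coercive_form m \<kappa>
  proof -
    interpret bounded_bilinear m by (rule mb)
    show "coercive_form m \<kappa>"
    proof
      show "m x y = m y x" for x y by (simp add: m_def inner_commute)
      show "\<kappa> > 0" by (simp add: \<kappa>_def)
      show "\<kappa> * (norm x)\<^sup>2 \<le> m x x" for x
        using \<alpha> by (auto simp: \<kappa>_def m_def V_def power2_norm_eq_inner)
    qed
  qed
  have g_tot: "x = 0" if "\<And>j. x \<bullet> g j = 0" for x using bump_seq_total[OF L] that unfolding g_def by blast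
  have g_range: "\<exists>\<eta>. g j = P \<eta>" for j
    using bump_seq_in_range[of j] unfolding g_def P_def by auto
  interpret beam_equation m \<kappa> P "K_op L" p B1 B2 D b1 b2 g
  proof (intro beam_equation.intro beam_equation_axioms.intro)
    show "coercive_form m \<kappa>" by (rule m.coercive_form_axioms)
    show "bounded_linear P" "bounded_linear (K_op L)" by (rule P, rule K.bounded_linear_axioms)
    show "P x = 0 \<Longrightarrow> x = 0" for x unfolding P_def using K_inj by (auto split: if_splits)
    \<comment> \<open>The range of \<open>P\<close> contains the total system \<open>g\<close>, so
      \<open>x\<close> is \<open>m\<close>-orthogonal to everything, in particular to
      itself.\<close>
    show "x = 0" if x: "\<And>\<eta>. m x (P \<eta>) = 0" for x
    proof -
      define S where "S = {y. m x y = 0}"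
      have sub: "subspace S" unfolding S_def
        by (rule subspaceI) (auto simp: m.zero_right m.add_right m.scaleR_right)
      have "x \<in> S"
      proof (rule ip.total_induct[OF ip_gram_schmidt[of g, OF g_tot] sub])
        show "closed S" unfolding S_def
          by (intro closed_Collect_eq continuous_on_const m.continuous_on continuous_on_id)
        have "g j \<in> S" for j unfolding S_def using g_range[of j] x by auto
        then have "span (range g) \<subseteq> S" using sub by (intro span_minimal) auto
        then show "ipg.gram_schmidt g j \<in> S" for j using ipg.gram_schmidt_in_span[of g j] by blast
      qed
      then have "\<kappa> * (norm x)\<^sup>2 \<le> 0" using m.coercive[of x] by (simp add: S_def)
      then show "x = 0" using m.\<kappa> by (simp add: mult_le_0_iff)
    qed
    show "bounded_linear p" unfolding p_def by (rule bounded_linear_compose[OF bounded_linear_inner_right V])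
    show "bounded_bilinear B1" unfolding B1_def
      by (intro bounded_bilinear_lincomb bounded_bilinear.comp[OF bounded_bilinear_inner V V] mb)
    show "bounded_bilinear B2" unfolding B2_def
      by (intro bounded_bilinear_lincomb bounded_bilinear.comp[OF bounded_bilinear_inner K.bounded_linear_axioms V] bounded_bilinear_inner)
    show "D > 0" "b2 > 0" by (rule D, rule b2)
    show "x = 0" if "\<And>j. x \<bullet> g j = 0" for x using g_tot that .
    show "(\<lambda>n. K_op L (v n)) \<longlonglongrightarrow> K_op L y"
      if "\<And>n. norm (v n) \<le> C" "\<And>l. bounded_linear l \<Longrightarrow> (\<lambda>n. l (v n) :: real) \<longlonglongrightarrow> l y" for v C y
      by (rule K_compact[where v = v and C = C, OF L]) (use that in blast)+
  qed
  obtain u0 where u0: "rep L w0 (K_op L (K_op L u0))" using w0 H2_star_iff[OF L] by blast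
  have "\<exists>a. rep L w1 (V a)"
  proof (cases "\<alpha> > 0")
    case True
    then show ?thesis using w1 H1_star_iff[OF L] by (simp add: L_alpha_def V_def)
  next
    case False
    then show ?thesis using w1 rep_cls[OF L] by (auto simp: L_alpha_def V_def)
  qed
  then obtain z0 where z0: "rep L w1 (V z0)" by blast
  obtain u z C where init: "u 0 = u0" "z 0 = z0"
    and wu: "weak_path T C u" and wz: "weak_path T C z"
    and cK: "continuous_on {0..T} (\<lambda>t. K_op L (u t))"
    and dP: "\<forall>l. bounded_linear l \<longrightarrow> (\<forall>t\<in>{0..T}. ((\<lambda>t. l (P (u t)) :: real) has_real_derivative l (z t)) (at t within {0..T}))"
    and dm: "\<forall>\<eta>. \<forall>t\<in>{0..T}. ((\<lambda>t. m (z t) (P \<eta>)) has_real_derivative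
        (- D * (u t \<bullet> \<eta>) - (b2 * (norm (K_op L (u t)))\<^sup>2 - b1) * (K_op L (u t) \<bullet> K_op L \<eta>)
     + p (P \<eta>) + B1 (z t) (P \<eta>) + B2 (u t) (P \<eta>))) (at t within {0..T})"
    using solution_exists[OF T, of u0 z0] by (elim exE conjE) (rule that)
  have cu: "continuous_on {0..T} (\<lambda>t. l (u t) :: real)" and cz: "continuous_on {0..T} (\<lambda>t. l (z t) :: real)"
    if "bounded_linear l" for l using wu wz that unfolding weak_path_def by blast+
  define w where "w t = emb L (K_op L (K_op L (u t)))" for t
  define wt where "wt t = emb L (V (z t))" for t
  have KK: "bounded_linear (\<lambda>a. K_op L (K_op L a))"
    by (rule bounded_linear_compose[OF K.bounded_linear_axioms K.bounded_linear_axioms])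
  have rw: "rep L (w t) (K_op L (K_op L (u t)))" and rwt: "rep L (wt t) (V (z t))" for t
    unfolding w_def wt_def by (rule rep_emb[OF L])+
  note rwx = rep_wderiv[OF L rw] and rwxx = rep_wderiv[OF L rep_wderiv[OF L rw]]
  have XH2: "v \<in> H2_star L \<and> 0 \<le> H2_star_norm D L v \<and> H2_star_norm D L v \<le> sqrt D * norm a"
    if r: "rep L v (K_op L (K_op L a))" for v a
  proof -
    note r2 = rep_wderiv[OF L rep_wderiv[OF L r]]
    have "H2_star_norm D L v = sqrt D * norm a"
      unfolding H2_star_norm_def H2_star_inner_def rep_inner[OF L r2 r2]
      by (simp add: real_sqrt_mult norm_eq_sqrt_inner)
    then show ?thesis using r H2_star_iff[OF L] D by auto
  qed
  obtain kK where kK: "kK \<ge> 0" "\<And>a. norm (K_op L a) \<le> norm a * kK" using K.nonneg_bounded by auto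
  \<comment> \<open>One constant for both cases: \<open>\<alpha> + kK\<^sup>2\<close> serves
    \<open>\<alpha> > 0\<close>, and 1 serves \<open>\<alpha> = 0\<close>, where the norm is
    preserved.\<close>
  have XV: "v \<in> L_alpha \<alpha> L \<and> 0 \<le> L_alpha_norm \<alpha> L v \<and> L_alpha_norm \<alpha> L v \<le> sqrt (max 1 (\<alpha> + kK\<^sup>2)) * norm a"
    if r: "rep L v (V a)" for v a
  proof (cases "\<alpha> > 0")
    case True
    then have r': "rep L v (K_op L a)" using r by (simp add: V_def)
    have "L_alpha_norm \<alpha> L v = sqrt (\<alpha> * (norm a)\<^sup>2 + (norm (K_op L a))\<^sup>2)"
      unfolding L_alpha_norm_def using True by (simp add: rep_norm[OF L r'] rep_norm[OF L rep_wderiv[OF L r']])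
    also have "\<dots> \<le> sqrt (max 1 (\<alpha> + kK\<^sup>2) * (norm a)\<^sup>2)"
    proof (rule real_sqrt_le_mono)
      have "(norm (K_op L a))\<^sup>2 \<le> (norm a * kK)\<^sup>2" using kK(2)[of a] by (intro power_mono) auto
      then have "\<alpha> * (norm a)\<^sup>2 + (norm (K_op L a))\<^sup>2 \<le> (\<alpha> + kK\<^sup>2) * (norm a)\<^sup>2"
        by (simp add: power_mult_distrib algebra_simps)
      also have "\<dots> \<le> max 1 (\<alpha> + kK\<^sup>2) * (norm a)\<^sup>2" by (intro mult_right_mono) auto
      finally show "\<alpha> * (norm a)\<^sup>2 + (norm (K_op L a))\<^sup>2 \<le> max 1 (\<alpha> + kK\<^sup>2) * (norm a)\<^sup>2" .
    qed
    also have "\<dots> = sqrt (max 1 (\<alpha> + kK\<^sup>2)) * norm a" by (simp add: real_sqrt_mult)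
    finally have "L_alpha_norm \<alpha> L v \<le> sqrt (max 1 (\<alpha> + kK\<^sup>2)) * norm a" .
    moreover have "0 \<le> L_alpha_norm \<alpha> L v" using True by (simp add: L_alpha_norm_def)
    ultimately show ?thesis using True r' H1_star_iff[OF L] by (auto simp: L_alpha_def)
  next
    case False
    then have r': "rep L v a" using r by (simp add: V_def)
    have "norm a \<le> sqrt (max 1 (\<alpha> + kK\<^sup>2)) * norm a"
      using mult_right_mono[of 1 "sqrt (max 1 (\<alpha> + kK\<^sup>2))" "norm a"] by simp
    then show ?thesis using False rep_L2[OF L r'] rep_norm[OF L r'] by (simp add: L_alpha_def L_alpha_norm_def)
  qed
  have weak_deriv: "has_weak_time_deriv T L w wt"
    unfolding has_weak_time_deriv_def
  proof
    fix \<psi> assume "\<psi> \<in> L2 0 L"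
    then have r: "rep L \<psi> (cls L \<psi>)" by (rule rep_cls[OF L])
    \<comment> \<open>With this functional the abstract identity for \<open>P u\<close> reads as the
      time derivative of \<open>w\<close>, since \<open>V (P u)\<close> is
      \<open>K (K u)\<close>.\<close>
    have bl: "bounded_linear (\<lambda>a. V a \<bullet> cls L \<psi>)" by (rule bounded_linear_compose[OF bounded_linear_inner_left V])
    show "has_distr_deriv 0 T (\<lambda>t. L2_inner 0 L (w t) \<psi>) (\<lambda>t. L2_inner 0 L (wt t) \<psi>)"
      unfolding rep_inner[OF L rw r] rep_inner[OF L rwt r] VP[symmetric]
      using C1_has_distr_deriv[OF dP[rule_format, OF bl] cz[OF bl]] T by simp
  qed
  have equation: "has_distr_deriv 0 T
          (\<lambda>t. L2_inner 0 L (wt t) \<phi> + \<alpha> * L2_inner 0 L (wderiv L (wt t)) (wderiv L \<phi>))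
          (\<lambda>t. (L2_inner 0 L p0 \<phi> - \<beta> * L2_inner 0 L (wt t) \<phi>
                  - \<beta> * U * L2_inner 0 L (wderiv L (w t)) \<phi>)
               - (H2_star_inner D L (w t) \<phi>
                  + (b2 * (L2_norm 0 L (wderiv L (w t)))\<^sup>2 - b1)
                      * L2_inner 0 L (wderiv L (w t)) (wderiv L \<phi>)
                  + k0 * L2_inner 0 L (wt t) \<phi>
                  + \<alpha> * k0 * L2_inner 0 L (wderiv L (wt t)) (wderiv L \<phi>)))"
    if \<phi>: "\<phi> \<in> H2_star L" for \<phi>
  proof -
    obtain \<eta> where r: "rep L \<phi> (K_op L (K_op L \<eta>))" using \<phi> H2_star_iff[OF L] by blast
    note rx = rep_wderiv[OF L r] and rxx = rep_wderiv[OF L rep_wderiv[OF L r]]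
    \<comment> \<open>For \<open>\<alpha> > 0\<close> both \<open>V\<close> and \<open>P\<close> are
      \<open>K\<close>, so the weak derivatives of \<open>wt\<close> and \<open>\<phi>\<close> are
      \<open>z\<close> and \<open>K \<eta> = P \<eta>\<close>. For \<open>\<alpha> = 0\<close> the
      factor removes whatever \<open>wderiv\<close> returns.\<close>
    have \<alpha>t: "\<alpha> * L2_inner 0 L (wderiv L (wt t)) (wderiv L \<phi>) = \<alpha> * (z t \<bullet> P \<eta>)" for t
    proof (cases "\<alpha> > 0")
      case True
      then have "rep L (wderiv L (wt t)) (z t)" using rwt[of t] by (intro rep_wderiv[OF L]) (simp add: V_def)
      from rep_inner[OF L this rx] show ?thesis using True by (simp add: P_def)
    next
      case False
      then show ?thesis using \<alpha> by simp
    qed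
    have lhs: "L2_inner 0 L (wt t) \<phi> + \<alpha> * L2_inner 0 L (wderiv L (wt t)) (wderiv L \<phi>) = m (z t) (P \<eta>)" for t
      unfolding \<alpha>t rep_inner[OF L rwt r] by (simp add: m_def VP)
    have k0t: "k0 * L2_inner 0 L (wt t) \<phi> + \<alpha> * k0 * L2_inner 0 L (wderiv L (wt t)) (wderiv L \<phi>) = k0 * m (z t) (P \<eta>)" for t
      using arg_cong[OF lhs[of t], of "\<lambda>x. k0 * x"] by (simp add: algebra_simps)
    have rhs: "(L2_inner 0 L p0 \<phi> - \<beta> * L2_inner 0 L (wt t) \<phi>
                  - \<beta> * U * L2_inner 0 L (wderiv L (w t)) \<phi>)
               - (H2_star_inner D L (w t) \<phi>
                  + (b2 * (L2_norm 0 L (wderiv L (w t)))\<^sup>2 - b1)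
                      * L2_inner 0 L (wderiv L (w t)) (wderiv L \<phi>)
                  + k0 * L2_inner 0 L (wt t) \<phi>
                  + \<alpha> * k0 * L2_inner 0 L (wderiv L (wt t)) (wderiv L \<phi>))
         = - D * (u t \<bullet> \<eta>) - (b2 * (norm (K_op L (u t)))\<^sup>2 - b1) * (K_op L (u t) \<bullet> K_op L \<eta>)
     + p (P \<eta>) + B1 (z t) (P \<eta>) + B2 (u t) (P \<eta>)" for t
      using k0t[of t]
      unfolding H2_star_inner_def rep_inner[OF L rep_cls[OF L p0] r] rep_inner[OF L rwt r] rep_inner[OF L rwx r]
        rep_inner[OF L rwx rx] rep_inner[OF L rwxx rxx] rep_norm[OF L rwx] p_def B1_def B2_def VP
      by simp
    have "continuous_on {0..T} (\<lambda>t. - D * (u t \<bullet> \<eta>) - (b2 * (norm (K_op L (u t)))\<^sup>2 - b1) * (K_op L (u t) \<bullet> K_op L \<eta>)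
     + p (P \<eta>) + B1 (z t) (P \<eta>) + B2 (u t) (P \<eta>))"
      by (intro continuous_intros cK cu[OF bounded_linear_inner_left]
          cz[OF bounded_bilinear.bounded_linear_left[OF B1]] cu[OF bounded_bilinear.bounded_linear_left[OF B2]])
    from C1_has_distr_deriv[OF dm[rule_format] this] show ?thesis unfolding lhs rhs using T by simp
  qed
  have at0: "((\<lambda>t. h t) \<longlongrightarrow> h 0) (at_right 0)" if "continuous_on {0..T} h" for h :: "real \<Rightarrow> real"
  proof -
    have "(h \<longlongrightarrow> h 0) (at 0 within {0..T})" using that T unfolding continuous_on_def by simp
    then show ?thesis by (simp add: at_within_Icc_at_right[OF T])
  qed
  have init_w: "((\<lambda>t. H2_star_inner D L (w t) \<eta>) \<longlongrightarrow> H2_star_inner D L w0 \<eta>) (at_right 0)"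
    if \<eta>: "\<eta> \<in> H2_star L" for \<eta>
  proof -
    obtain a where a: "rep L \<eta> (K_op L (K_op L a))" using \<eta> H2_star_iff[OF L] by blast
    note axx = rep_wderiv[OF L rep_wderiv[OF L a]] and w0xx = rep_wderiv[OF L rep_wderiv[OF L u0]]
    have "continuous_on {0..T} (\<lambda>t. D * (u t \<bullet> a))"
      by (intro continuous_intros cu[OF bounded_linear_inner_left])
    from at0[OF this] show ?thesis
      unfolding H2_star_inner_def rep_inner[OF L rwxx axx] rep_inner[OF L w0xx axx] init .
  qed
  have init_wt: "((\<lambda>t. L2_inner 0 L (wt t) \<psi>) \<longlongrightarrow> L2_inner 0 L w1 \<psi>) (at_right 0)"
    if \<psi>: "\<psi> \<in> L2 0 L" for \<psi>
  proof -
    have r: "rep L \<psi> (cls L \<psi>)" by (rule rep_cls[OF L \<psi>])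
    have bl: "bounded_linear (\<lambda>a. V a \<bullet> cls L \<psi>)" by (rule bounded_linear_compose[OF bounded_linear_inner_left V])
    from at0[OF cz[OF bl]] show ?thesis
      unfolding rep_inner[OF L rwt r] rep_inner[OF L z0 r] init .
  qed
  have "weak_solution L D b1 b2 U \<beta> k0 p0 \<alpha> T w0 w1 w"
    unfolding weak_solution_def
    using weak_path_L2_time[OF wu KK] weak_path_L2_time[OF wz V]
      weak_path_Linf[OF wu KK XH2] weak_path_continuous_bounded_functional[OF wu KK XH2]
      weak_path_Linf[OF wz V XV] weak_path_continuous_bounded_functional[OF wz V XV]
      weak_deriv equation init_w init_wt
    unfolding w_def[abs_def, symmetric] wt_def[abs_def, symmetric]
    by (intro exI[of _ wt]) blast
  then show ?thesis by blast
qed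

end

theorem theorem2p1:
  fixes L D b1 b2 U \<beta> k0 :: real and p0 :: "real \<Rightarrow> real"
  assumes "L > 0" and "D > 0" and "b2 > 0" and "U \<ge> 0" and "\<beta> \<ge> 0" and "k0 \<ge> 0"
    and "p0 \<in> L2 0 L"
  shows "\<forall>\<alpha>\<ge>0. \<forall>T>0. \<forall>(w0, w1) \<in> H_alpha \<alpha> L.
           \<exists>w. weak_solution L D b1 b2 U \<beta> k0 p0 \<alpha> T w0 w1 w"
  using beam_weak_solution[OF assms(1,2,3,7)] by (auto simp: H_alpha_def)

end
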